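(* Let $n \geq 2$ and, for $j = 1,\dots,n$, let $\Omega_j \subset \mathbb{R}^{d_j}$ with $d_j \in \mathbb{N}$ be open. Put $\Omega = \Omega_1 \times \dots \times \Omega_n \subset \mathbb{R}^d$ with $d = d_1 + \dots + d_n$. Let $\mathcal{H}_j = H_0^1(\Omega_j)$ for each $j$, and let $T$ be the self-adjoint operator on $L^2(\Omega)$ associated with $\mathcal{H}_1,\dots,\mathcal{H}_n$ (as defined in the context). Then $T = -\Delta_\Omega^D$, where $\Delta_\Omega^D$ is the Dirichlet Laplacian on $\Omega$. In particular, $H_0^1(\Omega) = \bigotimes_{j=1}^n H_0^1(\Omega_j)$.
   Context: All function spaces consist of complex-valued functions, and inner products are linear in the first argument. $H^1$ is the $L^2$-based first-order Sobolev space, and $H_0^1(\Omega)$ is the closure of $C_c^\infty(\Omega)$ in $H^1(\Omega)$. For each $j$ let $\mathcal{H}_j$ be a closed subspace of $H^1(\Omega_j)$ that is dense in $L^2(\Omega_j)$. For $f_j \in \mathcal{H}_j$, the elementary tensor $\bigotimes_{j=1}^n f_j \in H^1(\Omega)$ is the function $(x_1,\dots,x_n) \mapsto \prod_{j=1}^n f_j(x_j)$, $x_j \in \Omega_j$. Let $\mathcal{K} = \operatorname{span}_{\mathbb{C}}\{ \bigotimes_{j=1}^n f_j : f_j \in \mathcal{H}_j \} \subset H^1(\Omega)$, and define $\mathcal{H} = \bigotimes_{j=1}^n \mathcal{H}_j$ to be the closure of $\mathcal{K}$ in $H^1(\Omega)$ (with respect to the $H^1(\Omega)$-norm). The form $\mathfrak{t}[f,g]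 = \sum_{k=1}^d \langle \partial_k f, \partial_k g \rangle_{L^2(\Omega)}$, $f,g \in \mathcal{H}$, is closed, nonnegative, and densely defined on $L^2(\Omega)$. $T$ denotes the unique nonnegative self-adjoint operator on $L^2(\Omega)$ with $\operatorname{Dom}(T) \subset \mathcal{H}$ and $\mathfrak{t}[f,g] = \langle Tf, g\rangle_{L^2(\Omega)}$ for all $f \in \operatorname{Dom}(T)$, $g \in \mathcal{H}$. The Dirichlet Laplacian $\Delta_\Omega^D$ is the Laplacian with form domain $H_0^1(\Omega)$, i.e. $-\Delta_\Omega^D$ is the unique nonnegative self-adjoint operator on $L^2(\Omega)$ with domain contained in $H_0^1(\Omega)$ and $\sum_{k=1}^d \langle \partial_k f, \partial_k g \rangle_{L^2(\Omega)} = \langle -\Delta_\Omega^D f, g\rangle_{L^2(\Omega)}$ for all $f \in \operatorname{Dom}(\Delta_\Omega^D)$, $g \in H_0^1(\Omega)$. Equality of unbounded operators includes equality of domains. *)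

theory Defs
  imports "HOL-Analysis.Analysis"
begin

text \<open>
  The dimensions range over natural numbers inside one statement, so the points of
  Euclidean d-space are the functions in \<^term>\<open>{..<d} \<rightarrow>\<^sub>E (UNIV :: real set)\<close>, with the product
  topology and the product of one-dimensional Lebesgue measures.  Representatives are Borel
  measurable, which gives the same equivalence classes as Lebesgue measurability.

  Elements of the Lebesgue and Sobolev spaces over an open set are given by representatives:
  complex functions whose values off the open set are irrelevant.  All function spaces and
  operator graphs that are compared below (\<open>H1\<close>, \<open>H01\<close>, \<open>tensor_H\<close>, and the
  relations satisfying \<open>lin_op\<close>) are saturated under almost everywhere equality on the open set,
  so that set equality is equality of the corresponding sets of equivalence classes.
\<close>

type_synonym cfun = "(nat \<Rightarrow> real) \<Rightarrow> complex"

definition euc :: "nat \<Rightarrow> (nat \<Rightarrow> real) topology" where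
  "euc d = product_topology (\<lambda>_. euclideanreal) {..<d}"

definition leb_on :: "nat \<Rightarrow> (nat \<Rightarrow> real) set \<Rightarrow> (nat \<Rightarrow> real) measure" where
  "leb_on d U = restrict_space (Pi\<^sub>M {..<d} (\<lambda>_. lborel)) U"

definition L2 :: "nat \<Rightarrow> (nat \<Rightarrow> real) set \<Rightarrow> cfun set" where
  "L2 d U = {f \<in> borel_measurable (leb_on d U). integrable (leb_on d U) (\<lambda>x. (cmod (f x))\<^sup>2)}"

definition ae_eq :: "nat \<Rightarrow> (nat \<Rightarrow> real) set \<Rightarrow> cfun \<Rightarrow> cfun \<Rightarrow> bool" where
  "ae_eq d U f g \<longleftrightarrow> (AE x in leb_on d U. f x = g x)"

definition L2_inner :: "nat \<Rightarrow> (nat \<Rightarrow> real) set \<Rightarrow> cfun \<Rightarrow> cfun \<Rightarrow> complex" where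
  "L2_inner d U f g = (\<integral>x. f x * cnj (g x) \<partial>leb_on d U)"

definition L2_norm :: "nat \<Rightarrow> (nat \<Rightarrow> real) set \<Rightarrow> cfun \<Rightarrow> real" where
  "L2_norm d U f = sqrt (Re (L2_inner d U f f))"


definition partial_deriv :: "nat \<Rightarrow> cfun \<Rightarrow> cfun" where
  "partial_deriv k f = (\<lambda>x. vector_derivative (\<lambda>t. f (x(k := t))) (at (x k)))"

definition smooth :: "nat \<Rightarrow> cfun \<Rightarrow> bool" where
  "smooth d f \<longleftrightarrow> (\<forall>ks. set ks \<subseteq> {..<d} \<longrightarrow>
     continuous_map (euc d) euclidean (foldr partial_deriv ks f) \<and>
     (\<forall>x \<in> topspace (euc d). \<forall>k<d.
        (\<lambda>t. foldr partial_deriv ks f (x(k := t))) differentiable (at (x k))))"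

definition supp :: "nat \<Rightarrow> cfun \<Rightarrow> (nat \<Rightarrow> real) set" where
  "supp d f = euc d closure_of {x \<in> topspace (euc d). f x \<noteq> 0}"

text \<open>A test function on the open set is identified with its extension by zero.\<close>

definition test_funs :: "nat \<Rightarrow> (nat \<Rightarrow> real) set \<Rightarrow> cfun set" where
  "test_funs d U = {\<phi>. smooth d \<phi> \<and> compactin (euc d) (supp d \<phi>) \<and> supp d \<phi> \<subseteq> U}"

definition is_weak_deriv :: "nat \<Rightarrow> (nat \<Rightarrow> real) set \<Rightarrow> nat \<Rightarrow> cfun \<Rightarrow> cfun \<Rightarrow> bool" where
  "is_weak_deriv d U k f g \<longleftrightarrow>
     (\<forall>\<phi> \<in> test_funs d U.
        (\<integral>x. f x * partial_deriv k \<phi> x \<partial>leb_on d U) = - (\<integral>x. g x * \<phi> x \<partial>leb_on d U))"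

definition H1 :: "nat \<Rightarrow> (nat \<Rightarrow> real) set \<Rightarrow> cfun set" where
  "H1 d U = {f \<in> L2 d U. \<forall>k<d. \<exists>g \<in> L2 d U. is_weak_deriv d U k f g}"

text \<open>Weak derivatives are unique up to null sets; any representative may be chosen.\<close>

definition weak_deriv :: "nat \<Rightarrow> (nat \<Rightarrow> real) set \<Rightarrow> nat \<Rightarrow> cfun \<Rightarrow> cfun" where
  "weak_deriv d U k f = (SOME g. g \<in> L2 d U \<and> is_weak_deriv d U k f g)"

definition grad_form :: "nat \<Rightarrow> (nat \<Rightarrow> real) set \<Rightarrow> cfun \<Rightarrow> cfun \<Rightarrow> complex" where
  "grad_form d U f g = (\<Sum>k<d. L2_inner d U (weak_deriv d U k f) (weak_deriv d U k g))"

definition H1_norm :: "nat \<Rightarrow> (nat \<Rightarrow> real) set \<Rightarrow> cfun \<Rightarrow> real" where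
  "H1_norm d U f = sqrt (Re (L2_inner d U f f + grad_form d U f f))"

definition H1_closure :: "nat \<Rightarrow> (nat \<Rightarrow> real) set \<Rightarrow> cfun set \<Rightarrow> cfun set" where
  "H1_closure d U S = {f \<in> H1 d U. \<forall>\<epsilon>>0. \<exists>g \<in> S. H1_norm d U (\<lambda>x. f x - g x) < \<epsilon>}"

definition H01 :: "nat \<Rightarrow> (nat \<Rightarrow> real) set \<Rightarrow> cfun set" where
  "H01 d U = H1_closure d U (test_funs d U)"


text \<open>
  The n factors are indexed from 0.  Coordinates of the product space are the concatenation of
  the coordinates of the factors; \<open>block d j x\<close> is the j-th component of x.
\<close>

definition total_dim :: "nat \<Rightarrow> (nat \<Rightarrow> nat) \<Rightarrow> nat" where
  "total_dim n d = (\<Sum>j<n. d j)"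

definition block :: "(nat \<Rightarrow> nat) \<Rightarrow> nat \<Rightarrow> (nat \<Rightarrow> real) \<Rightarrow> (nat \<Rightarrow> real)" where
  "block d j x = (\<lambda>i\<in>{..<d j}. x ((\<Sum>l<j. d l) + i))"

definition prod_set ::
    "nat \<Rightarrow> (nat \<Rightarrow> nat) \<Rightarrow> (nat \<Rightarrow> (nat \<Rightarrow> real) set) \<Rightarrow> (nat \<Rightarrow> real) set" where
  "prod_set n d U = {x \<in> topspace (euc (total_dim n d)). \<forall>j<n. block d j x \<in> U j}"

definition elem_tensor :: "nat \<Rightarrow> (nat \<Rightarrow> nat) \<Rightarrow> (nat \<Rightarrow> cfun) \<Rightarrow> cfun" where
  "elem_tensor n d f = (\<lambda>x. \<Prod>j<n. f j (block d j x))"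

definition cspan :: "cfun set \<Rightarrow> cfun set" where
  "cspan S = {(\<lambda>x. \<Sum>s\<in>A. c s * s x) | A c. finite A \<and> A \<subseteq> S}"

definition tensor_H ::
    "nat \<Rightarrow> (nat \<Rightarrow> nat) \<Rightarrow> (nat \<Rightarrow> (nat \<Rightarrow> real) set) \<Rightarrow> (nat \<Rightarrow> cfun set) \<Rightarrow> cfun set" where
  "tensor_H n d U H =
     H1_closure (total_dim n d) (prod_set n d U)
       (cspan {elem_tensor n d f | f. \<forall>j<n. f j \<in> H j})"


text \<open>Unbounded operators on the Hilbert space \<open>L2 d U\<close> are identified with their graphs.\<close>

type_synonym op_graph = "(cfun \<times> cfun) set"

definition lin_op :: "nat \<Rightarrow> (nat \<Rightarrow> real) set \<Rightarrow> op_graph \<Rightarrow> bool" where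
  "lin_op d U T \<longleftrightarrow>
     T \<subseteq> L2 d U \<times> L2 d U \<and>
     (\<lambda>x. 0, \<lambda>x. 0) \<in> T \<and>
     (\<forall>f h f' h'. (f, h) \<in> T \<longrightarrow> (f', h') \<in> T \<longrightarrow> (\<lambda>x. f x + f' x, \<lambda>x. h x + h' x) \<in> T) \<and>
     (\<forall>c f h. (f, h) \<in> T \<longrightarrow> (\<lambda>x. c * f x, \<lambda>x. c * h x) \<in> T) \<and>
     (\<forall>f h h'. (f, h) \<in> T \<longrightarrow> (f, h') \<in> T \<longrightarrow> ae_eq d U h h') \<and>
     (\<forall>f h. (f, h) \<in> T \<longrightarrow> (\<forall>f' \<in> L2 d U. \<forall>h' \<in> L2 d U.
        ae_eq d U f f' \<longrightarrow> ae_eq d U h h' \<longrightarrow> (f', h') \<in> T))"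

definition L2_dense :: "nat \<Rightarrow> (nat \<Rightarrow> real) set \<Rightarrow> cfun set \<Rightarrow> bool" where
  "L2_dense d U S \<longleftrightarrow> S \<subseteq> L2 d U \<and>
     (\<forall>f \<in> L2 d U. \<forall>\<epsilon>>0. \<exists>g \<in> S. L2_norm d U (\<lambda>x. f x - g x) < \<epsilon>)"

definition adjoint_op :: "nat \<Rightarrow> (nat \<Rightarrow> real) set \<Rightarrow> op_graph \<Rightarrow> op_graph" where
  "adjoint_op d U T = {(g, h). g \<in> L2 d U \<and> h \<in> L2 d U \<and>
     (\<forall>(f, Tf) \<in> T. L2_inner d U Tf g = L2_inner d U f h)}"

definition self_adjoint :: "nat \<Rightarrow> (nat \<Rightarrow> real) set \<Rightarrow> op_graph \<Rightarrow> bool" where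
  "self_adjoint d U T \<longleftrightarrow> lin_op d U T \<and> L2_dense d U (Domain T) \<and> adjoint_op d U T = T"

definition nonneg_op :: "nat \<Rightarrow> (nat \<Rightarrow> real) set \<Rightarrow> op_graph \<Rightarrow> bool" where
  "nonneg_op d U T \<longleftrightarrow>
     (\<forall>(f, Tf) \<in> T. Im (L2_inner d U Tf f) = 0 \<and> 0 \<le> Re (L2_inner d U Tf f))"

text \<open>
  A predicate rather than a definite description: that exactly one such T exists for a closed
  densely defined form is the representation theorem.
\<close>

definition is_form_op :: "nat \<Rightarrow> (nat \<Rightarrow> real) set \<Rightarrow> cfun set \<Rightarrow> op_graph \<Rightarrow> bool" where
  "is_form_op d U H T \<longleftrightarrow>
     self_adjoint d U T \<and> nonneg_op d U T \<and> Domain T \<subseteq> H \<and>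
     (\<forall>(f, Tf) \<in> T. \<forall>g \<in> H. grad_form d U f g = L2_inner d U Tf g)"

definition neg_op :: "op_graph \<Rightarrow> op_graph" where
  "neg_op T = {(f, \<lambda>x. - h x) | f h. (f, h) \<in> T}"

definition is_dirichlet_laplacian :: "nat \<Rightarrow> (nat \<Rightarrow> real) set \<Rightarrow> op_graph \<Rightarrow> bool" where
  "is_dirichlet_laplacian d U L \<longleftrightarrow> is_form_op d U (H01 d U) (neg_op L)"

end

theory Submission
  imports Defs
begin

text \<open>
  That the closed span of elementary tensors lies in \<open>H01\<close> follows by approximating each factor by
  test functions, because the square norm is multiplicative on tensors and weak derivatives are
  stable under square-integrable limits.  For the converse, a test function \<open>f\<close> on the product is
  approximated, together with its first derivatives, by
  \<open>\<Sum>\<kappa>. (f y + \<nabla>f y \<cdot> (x - y)) * (\<Prod>i. \<psi> (x i / h - \<kappa> i))\<close> with \<open>y = h \<kappa>\<close>, where the integer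
  translates of the smooth bump \<open>\<psi>\<close> form a partition of unity on the line.  This is a finite sum of
  products of functions of one variable whose supports lie in small cubes around points of the
  support of \<open>f\<close>, so no mollification is needed: the first-order Taylor term absorbs the factor
  \<open>1 / h\<close> from differentiating \<open>\<psi>\<close>.  Once the form domains agree, two self-adjoint operators of
  the same form are each contained in the adjoint of the other, hence equal.
\<close>

section \<open>Smooth functions of one real variable\<close>

text \<open>The number and sizes of the blocks vary, so the approximation is carried out in single
  coordinates: a product of functions of one real variable regroups into an elementary tensor for
  every division into blocks. What has to be protected is the support, since each factor must be a
  test function on its own \<open>U j\<close>. This holds because the jet of \<open>f\<close>
  vanishes at every node off the support of \<open>f\<close>, while around a node in the support a
  whole cube of radius \<open>h\<close> fits into the product set, and so do its projections to the
  blocks. The same \<open>h\<close> must keep the oscillation of the gradient below \<omega>;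
  compactness of the support supplies it. The resulting error is \<omega> times a constant that does
  not depend on \<open>h\<close>, because the number of bumps meeting at a point is bounded in terms
  of the dimension alone. The other obstacle is that \<open>weak_deriv\<close> is an arbitrary
  choice: a Sobolev norm can be computed from a known derivative only once weak derivatives are
  known to be unique almost everywhere, which is what the fundamental lemma is for.\<close>

fun ndiff :: "nat \<Rightarrow> (real \<Rightarrow> real) \<Rightarrow> bool" where
  "ndiff 0 f = True"
| "ndiff (Suc n) f = (\<exists>f'. (\<forall>t. (f has_real_derivative f' t) (at t)) \<and> ndiff n f')"

lemma ndiff_SucI:
  assumes "\<forall>t. (f has_real_derivative f' t) (at t)" "ndiff n f'"
  shows "ndiff (Suc n) f"
  using assms by auto

lemma ndiff_SucE:
  assumes "ndiff (Suc n) f"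
  obtains f' where "\<forall>t. (f has_real_derivative f' t) (at t)" "ndiff n f'"
  using assms by auto

declare ndiff.simps(2) [simp del]

lemma ndiff_SucD: "ndiff (Suc n) f \<Longrightarrow> ndiff n f"
proof (induction n arbitrary: f)
  case (Suc n)
  then show ?case by (metis ndiff_SucE ndiff_SucI)
qed simp

lemma ndiff_const: "ndiff n (\<lambda>t. c)"
proof (induction n arbitrary: c)
  case (Suc n)
  show ?case by (rule ndiff_SucI[of _ "\<lambda>_. 0"]) (auto simp: Suc)
qed simp

lemma ndiff_add: "ndiff n f \<Longrightarrow> ndiff n g \<Longrightarrow> ndiff n (\<lambda>t. f t + g t)"
proof (induction n arbitrary: f g)
  case (Suc n)
  obtain f' where "\<forall>t. (f has_real_derivative f' t) (at t)" "ndiff n f'"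
    using Suc.prems(1) by (rule ndiff_SucE)
  moreover obtain g' where "\<forall>t. (g has_real_derivative g' t) (at t)" "ndiff n g'"
    using Suc.prems(2) by (rule ndiff_SucE)
  ultimately show ?case
    by (intro ndiff_SucI[of _ "\<lambda>t. f' t + g' t"] Suc.IH allI DERIV_add) auto
qed simp

lemma ndiff_mult: "ndiff n f \<Longrightarrow> ndiff n g \<Longrightarrow> ndiff n (\<lambda>t. f t * g t)"
proof (induction n arbitrary: f g)
  case (Suc n)
  obtain f' where f: "\<forall>t. (f has_real_derivative f' t) (at t)" "ndiff n f'"
    using Suc.prems(1) by (rule ndiff_SucE)
  obtain g' where g: "\<forall>t. (g has_real_derivative g' t) (at t)" "ndiff n g'"
    using Suc.prems(2) by (rule ndiff_SucE)
  have "ndiff n (\<lambda>t. f' t * g t + g' t * f t)"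
    using f g Suc.prems[THEN ndiff_SucD] by (intro ndiff_add Suc.IH)
  then show ?case
    by (rule ndiff_SucI[rotated]) (intro allI DERIV_mult f(1)[THEN spec] g(1)[THEN spec])
qed simp

text \<open>The derivative of \<open>1 / f\<close> is a product of \<open>f'\<close> and two copies
  of \<open>1 / f\<close> itself; the induction supplies \<open>1 / f\<close> at the lower
  order.\<close>

lemma ndiff_inverse:
  assumes "\<And>t. f t \<noteq> 0"
  shows "ndiff n f \<Longrightarrow> ndiff n (\<lambda>t. inverse (f t))"
proof (induction n)
  case (Suc n)
  obtain f' where *: "\<forall>t. (f has_real_derivative f' t) (at t)" "ndiff n f'"
    using Suc.prems by (rule ndiff_SucE)
  have i: "ndiff n (\<lambda>t. inverse (f t))"
    using Suc.IH Suc.prems[THEN ndiff_SucD] by blast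
  \<comment> \<open>The sign is written as a constant factor so that closure under products
    applies.\<close>
  have "ndiff n (\<lambda>t. (-1) * (inverse (f t) * f' t * inverse (f t)))"
    by (intro ndiff_mult ndiff_const i *)
  then have "ndiff n (\<lambda>t. - (inverse (f t) * f' t * inverse (f t)))" by simp
  then show ?case
    by (rule ndiff_SucI[rotated]) (intro allI DERIV_inverse' *(1)[THEN spec] assms)
qed simp

lemma ndiff_affine: "ndiff n f \<Longrightarrow> ndiff n (\<lambda>t. f (a * t + b))"
proof (induction n arbitrary: f)
  case (Suc n)
  obtain f' where *: "\<forall>t. (f has_real_derivative f' t) (at t)" "ndiff n f'"
    using Suc.prems by (rule ndiff_SucE)
  have d: "((\<lambda>t. f (a * t + b)) has_real_derivative a * f' (a * t + b)) (at t)" for t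
  proof -
    have "((\<lambda>t. a * t + b) has_real_derivative a) (at t)"
      by (auto intro!: derivative_eq_intros)
    from DERIV_chain2[OF *(1)[THEN spec] this] show ?thesis by (simp add: mult.commute)
  qed
  show ?case
    by (rule ndiff_SucI[OF allI, OF d]) (intro ndiff_mult ndiff_const Suc.IH *)
qed simp

text \<open>Smoothness through the existential derivatives of \<open>ndiff\<close>: closure under
  products and inverses is then an induction that never needs a Leibniz formula for iterated
  \<open>deriv\<close>.\<close>

definition smooth1 :: "(real \<Rightarrow> real) \<Rightarrow> bool" where
  "smooth1 f \<longleftrightarrow> (\<forall>n. ndiff n f)"

lemma smooth1_const: "smooth1 (\<lambda>t. c)"
  and smooth1_add: "smooth1 f \<Longrightarrow> smooth1 g \<Longrightarrow> smooth1 (\<lambda>t. f t + g t)"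
  and smooth1_mult: "smooth1 f \<Longrightarrow> smooth1 g \<Longrightarrow> smooth1 (\<lambda>t. f t * g t)"
  and smooth1_affine: "smooth1 f \<Longrightarrow> smooth1 (\<lambda>t. f (a * t + b))"
  by (auto simp: smooth1_def ndiff_const ndiff_add ndiff_mult ndiff_affine)

lemma smooth1_id: "smooth1 (\<lambda>t. t)"
  unfolding smooth1_def
proof
  show "ndiff n (\<lambda>t. t)" for n
    by (cases n) (auto intro!: ndiff_SucI[of _ "\<lambda>_. 1"] ndiff_const)
qed

text \<open>Derivatives are unique, so every witness inside \<open>ndiff\<close> is
  \<open>deriv\<close> of the previous function. The induction peels off the innermost derivative,
  hence the generalisation over \<open>g\<close>.\<close>

lemma smooth1_derivs:
  assumes "smooth1 f"
  shows "((deriv ^^ n) f has_real_derivative (deriv ^^ Suc n) f t) (at t)"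
proof -
  have "ndiff (Suc n) g \<Longrightarrow> ((deriv ^^ n) g has_real_derivative (deriv ^^ Suc n) g t) (at t)" for g
  proof (induction n arbitrary: g)
    case 0
    then obtain g' where "\<forall>t. (g has_real_derivative g' t) (at t)"
      by (rule ndiff_SucE)
    moreover from this have "deriv g = g'" by (intro ext DERIV_imp_deriv) auto
    ultimately show ?case by simp
  next
    case (Suc n)
    obtain g' where *: "\<forall>t. (g has_real_derivative g' t) (at t)" "ndiff (Suc n) g'"
      using Suc.prems by (rule ndiff_SucE)
    have "deriv g = g'" using *(1) by (intro ext DERIV_imp_deriv) auto
    with Suc.IH[OF *(2)] show ?case
      by (simp only: funpow_Suc_right o_apply)
  qed
  then show ?thesis using assms unfolding smooth1_def by blast
qed

section \<open>Flat exponentials and a smooth step function\<close>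

definition flat_pow :: "nat \<Rightarrow> real \<Rightarrow> real" where
  "flat_pow m t = (if t > 0 then inverse t ^ m * exp (- inverse t) else 0)"

text \<open>From the right, the substitution \<open>s = 1 / t\<close> turns the claim into decay of
  \<open>s ^ m / exp s\<close> at infinity.\<close>

lemma flat_pow_tendsto_0: "(flat_pow m \<longlongrightarrow> 0) (at 0)"
proof (rule filterlim_split_at)
  show "filterlim (flat_pow m) (nhds 0) (at_left 0)"
    by (rule tendsto_eventually) (auto simp: flat_pow_def eventually_at_filter)
  have "((\<lambda>t::real. inverse t ^ m / exp (inverse t)) \<longlongrightarrow> 0) (at_right 0)"
    by (rule filterlim_compose[OF tendsto_power_div_exp_0 filterlim_inverse_at_top_right])
  then show "filterlim (flat_pow m) (nhds 0) (at_right 0)"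
    by (rule Lim_transform_eventually)
       (auto simp: flat_pow_def eventually_at_filter exp_minus field_simps)
qed

text \<open>The functions \<open>t ^ (-m) * exp (- 1 / t)\<close>, extended by zero, are closed
  under differentiation up to linear combinations. This makes the smoothness proof an induction over
  the whole family instead of over one function.\<close>

lemma flat_pow_DERIV:
  "(flat_pow m has_real_derivative flat_pow (m + 2) t - real m * flat_pow (m + 1) t) (at t)"
proof -
  consider "t > 0" | "t < 0" | "t = 0" by linarith
  then show ?thesis
  proof cases
    case 1
    have "((\<lambda>t. inverse t ^ m * exp (- inverse t)) has_real_derivative
        flat_pow (m + 2) t - real m * flat_pow (m + 1) t) (at t)"
      using 1
      apply (cases m)
       apply (auto intro!: derivative_eq_intros simp: flat_pow_def field_simps power2_eq_square)
      subgoal for k by (cases k) auto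
      done
    then show ?thesis
      by (rule has_field_derivative_transform_within_open[of _ _ _ "{0<..}"])
         (use 1 in \<open>auto simp: flat_pow_def\<close>)
  next
    case 2
    have "((\<lambda>t. 0) has_real_derivative flat_pow (m + 2) t - real m * flat_pow (m + 1) t) (at t)"
      using 2 by (auto simp: flat_pow_def)
    then show ?thesis
      by (rule has_field_derivative_transform_within_open[of _ _ _ "{..<0}"])
         (use 2 in \<open>auto simp: flat_pow_def\<close>)
  next
    case 3
    \<comment> \<open>At the origin the difference quotient of \<open>flat_pow m\<close> is
      \<open>flat_pow (Suc m)\<close>, so the limit is the one already known.\<close>
    have "((\<lambda>h. (flat_pow m (0 + h) - flat_pow m 0) / h) \<longlongrightarrow> 0) (at 0)"
      by (rule Lim_transform_eventually[OF flat_pow_tendsto_0[of "Suc m"]])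
         (auto simp: flat_pow_def eventually_at_filter field_simps)
    then show ?thesis using 3 by (simp add: DERIV_def flat_pow_def)
  qed
qed

lemma smooth1_flat_pow: "smooth1 (flat_pow m)"
  unfolding smooth1_def
proof
  show "ndiff n (flat_pow m)" for n
  proof (induction n arbitrary: m)
    case (Suc n)
    have "ndiff n (\<lambda>t. flat_pow (m + 2) t + (- real m) * flat_pow (m + 1) t)"
      by (intro ndiff_add ndiff_mult ndiff_const Suc)
    then have "ndiff n (\<lambda>t. flat_pow (m + 2) t - real m * flat_pow (m + 1) t)" by simp
    then show ?case by (rule ndiff_SucI[OF allI, OF flat_pow_DERIV])
  qed simp
qed

definition sstep :: "real \<Rightarrow> real" where
  "sstep t = flat_pow 0 t * inverse (flat_pow 0 t + flat_pow 0 (1 - t))"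

text \<open>At least one of \<open>t\<close> and \<open>1 - t\<close> is positive.\<close>

lemma sstep_denom_pos: "flat_pow 0 t + flat_pow 0 (1 - t) > 0"
  by (auto simp: flat_pow_def add_pos_pos)

lemma sstep_eq_0: "t \<le> 0 \<Longrightarrow> sstep t = 0"
  and sstep_eq_1: "t \<ge> 1 \<Longrightarrow> sstep t = 1"
  by (auto simp: sstep_def flat_pow_def)

lemma sstep_bounds: "0 \<le> sstep t" "sstep t \<le> 1"
  using sstep_denom_pos[of t]
  by (auto simp: sstep_def field_simps) (auto simp: flat_pow_def)

lemma smooth1_sstep: "smooth1 sstep"
proof -
  have "smooth1 (\<lambda>t. flat_pow 0 (- 1 * t + 1))"
    by (intro smooth1_affine smooth1_flat_pow)
  then have "smooth1 (\<lambda>t. flat_pow 0 t + flat_pow 0 (1 - t))"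
    by (intro smooth1_add smooth1_flat_pow) (simp add: add.commute[of _ "1::real"])
  then have "smooth1 (\<lambda>t. inverse (flat_pow 0 t + flat_pow 0 (1 - t)))"
    using sstep_denom_pos by (auto simp: smooth1_def intro!: ndiff_inverse) (metis less_irrefl)
  then show ?thesis
    unfolding sstep_def[abs_def] by (intro smooth1_mult smooth1_flat_pow)
qed

section \<open>The topology and Borel structure of Euclidean space\<close>

lemma topspace_euc: "topspace (euc d) = {..<d} \<rightarrow>\<^sub>E UNIV"
  by (simp add: euc_def)

lemma space_PiM_lborel: "space (Pi\<^sub>M {..<d} (\<lambda>_. lborel :: real measure)) = topspace (euc d)"
  by (simp add: topspace_euc space_PiM)

lemma topspace_euc_upd: "x \<in> topspace (euc d) \<Longrightarrow> k < d \<Longrightarrow> x(k := t) \<in> topspace (euc d)"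
  by (auto simp: topspace_euc PiE_iff extensional_def)

lemma continuous_map_euc_proj: "i < d \<Longrightarrow> continuous_map (euc d) euclideanreal (\<lambda>x. x i)"
  using continuous_map_product_projection[of i "{..<d}" "\<lambda>_. euclideanreal"]
  by (simp add: euc_def)

text \<open>The closed ball of the maximum norm. Cubes are used because the support of a product of
  functions of one variable sits in a box.\<close>

definition sball :: "nat \<Rightarrow> (nat \<Rightarrow> real) \<Rightarrow> real \<Rightarrow> (nat \<Rightarrow> real) set" where
  "sball d x r = {y \<in> topspace (euc d). \<forall>i<d. \<bar>y i - x i\<bar> \<le> r}"

lemma openin_euc_sball:
  assumes "openin (euc d) U" "x \<in> U"
  shows "\<exists>r>0. sball d x r \<subseteq> U"
proof -
  obtain X where X: "x \<in> Pi\<^sub>E {..<d} X" "\<And>i. openin euclideanreal (X i)" "Pi\<^sub>E {..<d} X \<subseteq> U"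
    using product_topology_open_contains_basis[OF assms[unfolded euc_def]] by metis
  have "\<forall>i<d. \<exists>r>0. cball (x i) r \<subseteq> X i"
    using X(1,2) by (auto simp: PiE_iff open_contains_cball)
  then obtain r where r: "\<And>i. i < d \<Longrightarrow> r i > 0" "\<And>i. i < d \<Longrightarrow> cball (x i) (r i) \<subseteq> X i"
    by metis
  \<comment> \<open>The inserted 1 keeps the minimum meaningful when \<open>d = 0\<close>.\<close>
  define s where "s = Min (insert 1 (r ` {..<d}))"
  have "s > 0" using r(1) by (auto simp: s_def)
  moreover have "s \<le> r i" if "i < d" for i
    unfolding s_def using that by (intro Min_le) auto
  ultimately have s: "s > 0" "\<And>i. i < d \<Longrightarrow> s \<le> r i" by auto
  have "sball d x s \<subseteq> Pi\<^sub>E {..<d} X"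
  proof
    fix y assume y: "y \<in> sball d x s"
    have "y i \<in> X i" if "i < d" for i
      using r(2)[OF that] s(2)[OF that] y that
      by (force simp: sball_def dist_real_def abs_minus_commute)
    then show "y \<in> Pi\<^sub>E {..<d} X" using y by (auto simp: sball_def topspace_euc PiE_iff)
  qed
  with X(3) s(1) show ?thesis by blast
qed

lemma openin_euc_box:
  "openin (euc d) (Pi\<^sub>E {..<d} (\<lambda>i. {a i<..<b i}))"
  unfolding euc_def by (subst openin_PiE) auto

lemma compactin_euc_box:
  "compactin (euc d) (Pi\<^sub>E {..<d} (\<lambda>i. {a i..b i}))"
  unfolding euc_def by (subst compactin_PiE) auto

lemma closedin_euc_box:
  "closedin (euc d) (Pi\<^sub>E {..<d} (\<lambda>i. {a i..b i}))"
  unfolding euc_def by (subst closedin_product_topology) auto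

definition obox :: "nat \<Rightarrow> (nat \<Rightarrow> real) \<Rightarrow> (nat \<Rightarrow> real) \<Rightarrow> (nat \<Rightarrow> real) set" where
  "obox d a b = Pi\<^sub>E {..<d} (\<lambda>i. {a i<..<b i})"

text \<open>Rational corners make the family countable. The closed boxes are kept inside
  \<open>U\<close> so that functions supported in them are test functions on
  \<open>U\<close>.\<close>

lemma openin_euc_countable_boxes:
  assumes "openin (euc d) U"
  obtains B where "countable B" "\<Union>B = U"
    "\<forall>Q\<in>B. \<exists>a b. Q = obox d a b \<and> Pi\<^sub>E {..<d} (\<lambda>i. {a i..b i}) \<subseteq> U"
proof -
  define R where "R = Pi\<^sub>E {..<d} (\<lambda>_. \<rat> :: real set)"
  define P where "P = {(a, b) \<in> R \<times> R. Pi\<^sub>E {..<d} (\<lambda>i. {a i..b i}) \<subseteq> U}"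
  define B where "B = (\<lambda>(a, b). obox d a b) ` P"
  have "countable R" unfolding R_def by (intro countable_PiE countable_rat finite_lessThan)
  then have "countable P"
    by (intro countable_subset[of P "R \<times> R"] countable_SIGMA) (auto simp: P_def)
  then have "countable B" by (simp add: B_def)
  moreover have "\<Union>B = U"
  proof (intro equalityI subsetI)
    fix x assume "x \<in> \<Union>B"
    then obtain a b where ab: "(a, b) \<in> P" "x \<in> obox d a b" by (auto simp: B_def)
    from ab(2) have "x \<in> Pi\<^sub>E {..<d} (\<lambda>i. {a i..b i})"
      by (auto simp: obox_def PiE_iff less_imp_le)
    with ab(1) show "x \<in> U" by (auto simp: P_def)
  next
    fix x assume x: "x \<in> U"
    obtain r where r: "r > 0" "sball d x r \<subseteq> U" using openin_euc_sball[OF assms x] by blast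
    have xe: "x \<in> topspace (euc d)" using openin_subset[OF assms] x by blast
    have "\<exists>q\<in>\<rat>. x i - r < q \<and> q < x i" "\<exists>q\<in>\<rat>. x i < q \<and> q < x i + r" for i
      using Rats_dense_in_real r by auto
    then obtain a b where "\<forall>i. a i \<in> \<rat> \<and> x i - r < a i \<and> a i < x i"
      "\<forall>i. b i \<in> \<rat> \<and> x i < b i \<and> b i < x i + r"
      unfolding Bex_def by moura
    then have ab: "\<And>i. a i \<in> \<rat>" "\<And>i. x i - r < a i" "\<And>i. a i < x i"
      "\<And>i. b i \<in> \<rat>" "\<And>i. x i < b i" "\<And>i. b i < x i + r"
      by auto
    \<comment> \<open>Only the truncations to the first \<open>d\<close> coordinates belong to the
      countable set \<open>R\<close>.\<close>
    define a' b' where "a' = restrict a {..<d}" and "b' = restrict b {..<d}"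
    have "Pi\<^sub>E {..<d} (\<lambda>i. {a' i..b' i}) \<subseteq> sball d x r"
    proof
      fix y assume y: "y \<in> Pi\<^sub>E {..<d} (\<lambda>i. {a' i..b' i})"
      have "\<bar>y i - x i\<bar> \<le> r" if "i < d" for i
      proof -
        have "y i \<in> {a' i..b' i}" using y that unfolding PiE_iff by blast
        then show ?thesis using ab(2,6)[of i] that by (auto simp: a'_def b'_def abs_le_iff)
      qed
      with y show "y \<in> sball d x r" by (auto simp: sball_def topspace_euc PiE_iff)
    qed
    with r ab have "(a', b') \<in> P"
      by (auto simp: P_def R_def a'_def b'_def)
    moreover have "x \<in> obox d a' b'"
      using ab xe by (auto simp: obox_def a'_def b'_def topspace_euc PiE_iff)
    ultimately show "x \<in> \<Union>B" by (auto simp: B_def)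
  qed
  moreover have "\<exists>a b. Q = obox d a b \<and> Pi\<^sub>E {..<d} (\<lambda>i. {a i..b i}) \<subseteq> U" if "Q \<in> B" for Q
    using that by (auto simp: B_def P_def)
  then have "\<forall>Q\<in>B. \<exists>a b. Q = obox d a b \<and> Pi\<^sub>E {..<d} (\<lambda>i. {a i..b i}) \<subseteq> U" by blast
  ultimately show ?thesis by (rule that)
qed

lemma sets_obox: "obox d a b \<in> sets (Pi\<^sub>M {..<d} (\<lambda>_. lborel))"
  unfolding obox_def by (intro sets_PiM_I_finite) auto

lemma openin_euc_sets:
  assumes "openin (euc d) U"
  shows "U \<in> sets (Pi\<^sub>M {..<d} (\<lambda>_. lborel))"
proof -
  obtain B where B: "countable B" "\<Union>B = U"
    "\<forall>Q\<in>B. \<exists>a b. Q = obox d a b \<and> Pi\<^sub>E {..<d} (\<lambda>i. {a i..b i}) \<subseteq> U"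
    using openin_euc_countable_boxes[OF assms] .
  have "\<Union>B \<in> sets (Pi\<^sub>M {..<d} (\<lambda>_. lborel))"
    using B by (intro sets.countable_Union) (auto intro: sets_obox)
  with B show ?thesis by simp
qed

lemma continuous_map_euc_measurable:
  fixes f :: "(nat \<Rightarrow> real) \<Rightarrow> 'a :: topological_space"
  assumes "continuous_map (euc d) euclidean f"
  shows "f \<in> borel_measurable (Pi\<^sub>M {..<d} (\<lambda>_. lborel))"
proof (rule borel_measurableI)
  fix S :: "'a set" assume "open S"
  then have "openin (euc d) {x \<in> topspace (euc d). f x \<in> S}"
    using assms by (intro openin_continuous_map_preimage) auto
  moreover have "f -` S \<inter> space (Pi\<^sub>M {..<d} (\<lambda>_. lborel)) = {x \<in> topspace (euc d). f x \<in> S}"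
    by (auto simp: space_PiM_lborel)
  ultimately show "f -` S \<inter> space (Pi\<^sub>M {..<d} (\<lambda>_. lborel)) \<in> sets (Pi\<^sub>M {..<d} (\<lambda>_. lborel))"
    by (simp add: openin_euc_sets)
qed

text \<open>A half space is open, hence a countable union of open boxes, so the coordinates are
  measurable for the generated sigma-algebra. Open boxes are stable under intersection, which
  prepares the Dynkin argument in the fundamental lemma.\<close>

lemma sets_PiM_oboxes:
  "sets (Pi\<^sub>M {..<d} (\<lambda>_. lborel)) = sigma_sets (topspace (euc d)) (range (\<lambda>(a, b). obox d a b))"
proof -
  let ?G = "range (\<lambda>(a, b). obox d a b)"
  let ?S = "sigma (topspace (euc d)) ?G"
  have G: "?G \<subseteq> Pow (topspace (euc d))" by (auto simp: obox_def topspace_euc)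
  have "(\<lambda>x. x i) \<in> borel_measurable ?S" if i: "i < d" for i
  proof (rule borel_measurable_iff_greater[THEN iffD2], intro allI)
    fix a :: real
    have "openin (euc d) {x \<in> topspace (euc d). x i \<in> {a<..}}"
      using i by (intro openin_continuous_map_preimage[of _ euclideanreal] continuous_map_euc_proj) auto
    from openin_euc_countable_boxes[OF this] obtain B
      where B: "countable B" "\<Union>B = {x \<in> topspace (euc d). x i \<in> {a<..}}"
        and "\<forall>Q\<in>B. \<exists>p q. Q = obox d p q \<and> Pi\<^sub>E {..<d} (\<lambda>j. {p j..q j}) \<subseteq> {x \<in> topspace (euc d). x i \<in> {a<..}}" .
    then have B3: "B \<subseteq> ?G" by fast
    have "\<Union>B \<in> sets ?S"
      using B(1) B3 G by (intro sets.countable_Union) (auto simp: sets_measure_of)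
    moreover have "{w \<in> space ?S. a < w i} = \<Union>B"
      unfolding B(2) using G by (simp add: space_measure_of_conv)
    ultimately show "{w \<in> space ?S. a < w i} \<in> sets ?S" by simp
  qed
  then have "(\<lambda>x. x) \<in> measurable ?S (Pi\<^sub>M {..<d} (\<lambda>_. lborel :: real measure))"
    using G by (intro measurable_PiM_single') (auto simp: topspace_euc space_measure_of_conv)
  note id = this
  have "A \<in> sets ?S" if A: "A \<in> sets (Pi\<^sub>M {..<d} (\<lambda>_. lborel))" for A
  proof -
    have "A \<subseteq> topspace (euc d)"
      using sets.sets_into_space[OF A] by (simp add: space_PiM_lborel)
    then have "(\<lambda>x. x) -` A \<inter> space ?S = A" using G by (auto simp: space_measure_of_conv)
    with measurable_sets[OF id A] show ?thesis by simp
  qed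
  moreover have "sigma_sets (topspace (euc d)) ?G \<subseteq> sets (Pi\<^sub>M {..<d} (\<lambda>_. lborel))"
    unfolding space_PiM_lborel[symmetric] by (intro sets.sigma_sets_subset) (auto intro: sets_obox)
  ultimately show ?thesis using G by (auto simp: sets_measure_of)
qed

lemma compactin_euc_bounded:
  assumes "compactin (euc d) K"
  obtains R where "R > 0" "\<And>x i. x \<in> K \<Longrightarrow> i < d \<Longrightarrow> \<bar>x i\<bar> \<le> R"
proof -
  have "\<exists>r. \<forall>x\<in>K. \<bar>x i\<bar> \<le> r" if "i < d" for i
  proof -
    have "compactin euclideanreal ((\<lambda>x. x i) ` K)"
      using that by (intro image_compactin[OF assms] continuous_map_euc_proj)
    then have "bounded ((\<lambda>x. x i) ` K)" by (simp add: compact_imp_bounded)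
    then show ?thesis by (auto simp: bounded_iff)
  qed
  then obtain r where r: "\<And>i x. i < d \<Longrightarrow> x \<in> K \<Longrightarrow> \<bar>x i\<bar> \<le> r i" by metis
  define R where "R = Max (insert 1 (r ` {..<d}))"
  have "R \<ge> 1" unfolding R_def by (intro Max_ge) auto
  moreover have "r i \<le> R" if "i < d" for i unfolding R_def using that by (intro Max_ge) auto
  ultimately show ?thesis using r by (intro that[of R]) (auto intro: order_trans)
qed

text \<open>A Lebesgue number argument for a property \<open>P\<close> that passes to subsets: one
  radius works for all centres in a compact set.\<close>

lemma compactin_euc_uniform_sball:
  assumes K: "compactin (euc d) K"
    and mono: "\<And>A B. A \<subseteq> B \<Longrightarrow> P B \<Longrightarrow> P A"
    and loc: "\<And>y. y \<in> K \<Longrightarrow> \<exists>r>0. P (sball d y r)"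
  shows "\<exists>h>0. \<forall>y\<in>K. P (sball d y h)"
proof -
  obtain r where r: "\<And>y. y \<in> K \<Longrightarrow> r y > 0" "\<And>y. y \<in> K \<Longrightarrow> P (sball d y (r y))"
    using loc by metis
  \<comment> \<open>Half the radius, so that a cube of radius at most \<open>r z / 2\<close> centred
    in \<open>O' z\<close> still lies in \<open>sball d z (r z)\<close>.\<close>
  define O' where "O' y = obox d (\<lambda>i. y i - r y / 2) (\<lambda>i. y i + r y / 2)" for y
  have sub: "K \<subseteq> topspace (euc d)" using K by (rule compactin_subset_topspace)
  have "\<exists>\<F>. finite \<F> \<and> \<F> \<subseteq> O' ` K \<and> K \<subseteq> \<Union>\<F>"
  proof (rule compactinD[OF K])
    show "openin (euc d) U" if "U \<in> O' ` K" for U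
      using that openin_euc_box by (auto simp: O'_def obox_def)
    have "y \<in> O' y" if "y \<in> K" for y
      using r(1)[OF that] that sub by (auto simp: O'_def obox_def topspace_euc PiE_iff)
    then show "K \<subseteq> \<Union> (O' ` K)" by blast
  qed
  then obtain F where F: "finite F" "F \<subseteq> K" "K \<subseteq> \<Union>(O' ` F)"
    by (metis finite_subset_image)
  define h where "h = Min (insert 1 ((\<lambda>y. r y / 2) ` F))"
  have "h > 0" using F(1,2) r(1) by (auto simp: h_def)
  moreover have "h \<le> r y / 2" if "y \<in> F" for y
    unfolding h_def using F(1) that by (intro Min_le) auto
  ultimately have h: "h > 0" "\<And>y. y \<in> F \<Longrightarrow> h \<le> r y / 2" by auto
  have "P (sball d y h)" if "y \<in> K" for y
  proof -
    obtain z where z: "z \<in> F" "y \<in> O' z" using F(3) \<open>y \<in> K\<close> by blast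
    have "sball d y h \<subseteq> sball d z (r z)"
    proof
      fix x assume x: "x \<in> sball d y h"
      have "\<bar>x i - z i\<bar> \<le> r z" if "i < d" for i
      proof -
        have "\<bar>x i - y i\<bar> \<le> h" using x that by (auto simp: sball_def)
        moreover have "y i \<in> {z i - r z / 2<..<z i + r z / 2}"
          using z(2) that unfolding O'_def obox_def PiE_iff by blast
        then have "\<bar>y i - z i\<bar> \<le> r z / 2" unfolding greaterThanLessThan_iff by linarith
        ultimately show ?thesis using h(2)[OF z(1)] by linarith
      qed
      with x show "x \<in> sball d z (r z)" by (auto simp: sball_def)
    qed
    with mono r(2)[of z] F z show ?thesis by blast
  qed
  with h(1) show ?thesis by blast
qed

section \<open>Test functions\<close>

lemma partial_deriv_apply:
  fixes f :: cfun
  shows   "partial_deriv k f x = vector_derivative (\<lambda>t. f (x(k := t))) (at (x k))"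
  by (simp add: partial_deriv_def)

lemma foldr_partial_deriv_Cons:
  "foldr partial_deriv (k # ks) f x =
    vector_derivative (\<lambda>t. foldr partial_deriv ks f (x(k := t))) (at (x k))"
  by (simp only: foldr.simps o_apply partial_deriv_apply)

text \<open>Candidates \<open>D ks\<close> for all iterated derivatives are supplied in advance. If
  each is continuous and differentiates into the next, induction on the list identifies them with
  the true ones, so smoothness of a sum, a product or a tensor reduces to writing down a
  formula.\<close>

lemma
  assumes D0: "\<And>x. x \<in> topspace (euc d) \<Longrightarrow> D [] x = f x"
    and cont: "\<And>ks. set ks \<subseteq> {..<d} \<Longrightarrow> continuous_map (euc d) euclidean (D ks)"
    and der: "\<And>ks k x. set ks \<subseteq> {..<d} \<Longrightarrow> k < d \<Longrightarrow> x \<in> topspace (euc d) \<Longrightarrow>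
      ((\<lambda>t. D ks (x(k := t))) has_vector_derivative D (k # ks) x) (at (x k))"
  shows smooth_familyI: "smooth d f"
    and foldr_partial_deriv_family:
      "set ks \<subseteq> {..<d} \<Longrightarrow> x \<in> topspace (euc d) \<Longrightarrow> foldr partial_deriv ks f x = D ks x"
proof -
  have *: "foldr partial_deriv ks f x = D ks x" if "set ks \<subseteq> {..<d}" "x \<in> topspace (euc d)" for ks x
    using that
  proof (induction ks arbitrary: x)
    case (Cons k ks)
    then have "(\<lambda>t. foldr partial_deriv ks f (x(k := t))) = (\<lambda>t. D ks (x(k := t)))"
      by (intro ext Cons.IH topspace_euc_upd) auto
    then show ?case using der[of ks k x] Cons.prems
      by (simp only: foldr_partial_deriv_Cons) (simp add: vector_derivative_at)
  qed (simp add: D0)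
  show "foldr partial_deriv ks f x = D ks x" if "set ks \<subseteq> {..<d}" "x \<in> topspace (euc d)"
    using * that .
  show "smooth d f"
    unfolding smooth_def
  proof (intro allI impI conjI ballI)
    fix ks assume ks: "set ks \<subseteq> {..<d}"
    show "continuous_map (euc d) euclidean (foldr partial_deriv ks f)"
      using cont[OF ks] by (rule continuous_map_eq) (simp add: * ks)
    fix x k assume x: "x \<in> topspace (euc d)" and k: "k < d"
    have "(\<lambda>t. foldr partial_deriv ks f (x(k := t))) = (\<lambda>t. D ks (x(k := t)))"
      using ks x k by (intro ext * topspace_euc_upd)
    then show "(\<lambda>t. foldr partial_deriv ks f (x(k := t))) differentiable at (x k)"
      using der[OF ks k x] by (auto intro: differentiableI_vector)
  qed
qed

lemma smooth_continuous: "smooth d f \<Longrightarrow> set ks \<subseteq> {..<d} \<Longrightarrow>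
    continuous_map (euc d) euclidean (foldr partial_deriv ks f)"
  by (simp add: smooth_def)

lemma smooth_foldr_derivative:
  assumes "smooth d f" "set ks \<subseteq> {..<d}" "k < d" "x \<in> topspace (euc d)"
  shows "((\<lambda>t. foldr partial_deriv ks f (x(k := t))) has_vector_derivative
    foldr partial_deriv (k # ks) f x) (at (x k))"
  unfolding foldr_partial_deriv_Cons vector_derivative_works[symmetric]
  using assms by (simp add: smooth_def)

lemma smooth_imp_continuous: "smooth d f \<Longrightarrow> continuous_map (euc d) euclidean f"
  and smooth_imp_continuous_partial:
    "smooth d f \<Longrightarrow> k < d \<Longrightarrow> continuous_map (euc d) euclidean (partial_deriv k f)"
  using smooth_continuous[of d f "[]"] smooth_continuous[of d f "[k]"] by auto

lemma smooth_partial_derivative: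
  assumes "smooth d f" "k < d" "x \<in> topspace (euc d)"
  shows "((\<lambda>t. f (x(k := t))) has_vector_derivative partial_deriv k f (x(k := s))) (at s)"
  using smooth_foldr_derivative[of d f "[]" k "x(k := s)"] assms by (simp add: topspace_euc_upd)

lemma smooth_partial: "smooth d f \<Longrightarrow> k < d \<Longrightarrow> smooth d (partial_deriv k f)"
  unfolding smooth_def
proof (intro allI impI)
  fix ks assume f: "\<forall>ks. set ks \<subseteq> {..<d} \<longrightarrow>
      continuous_map (euc d) euclidean (foldr partial_deriv ks f) \<and>
      (\<forall>x\<in>topspace (euc d). \<forall>k<d. (\<lambda>t. foldr partial_deriv ks f (x(k := t))) differentiable at (x k))"
    and k: "k < d" and ks: "set ks \<subseteq> {..<d}"
  show "continuous_map (euc d) euclidean (foldr partial_deriv ks (partial_deriv k f)) \<and>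
      (\<forall>x\<in>topspace (euc d). \<forall>j<d.
        (\<lambda>t. foldr partial_deriv ks (partial_deriv k f) (x(j := t))) differentiable at (x j))"
    using f[rule_format, of "ks @ [k]"] k ks by simp
qed

lemma smooth_lincomb:
  assumes "smooth d f" "smooth d g"
  shows "smooth d (\<lambda>x. a * f x + b * g x)"
    and "x \<in> topspace (euc d) \<Longrightarrow> k < d \<Longrightarrow>
      partial_deriv k (\<lambda>x. a * f x + b * g x) x = a * partial_deriv k f x + b * partial_deriv k g x"
proof -
  let ?D = "\<lambda>ks x. a * foldr partial_deriv ks f x + b * foldr partial_deriv ks g x"
  have mult: "continuous_map (euc d) euclidean (\<lambda>x. c * h x)"
    if "continuous_map (euc d) euclidean h" for c :: complex and h
    using continuous_map_compose[OF that, of euclidean "\<lambda>x. c * x"]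
    by (simp add: o_def)
  have cont: "continuous_map (euc d) euclidean (?D ks)" if "set ks \<subseteq> {..<d}" for ks
    using assms that by (intro continuous_map_add mult smooth_continuous)
  have der: "((\<lambda>t. ?D ks (x(k := t))) has_vector_derivative ?D (k # ks) x) (at (x k))"
    if "set ks \<subseteq> {..<d}" "k < d" "x \<in> topspace (euc d)" for ks k x
    using assms that
    by (intro has_vector_derivative_add has_vector_derivative_mult_right smooth_foldr_derivative)
  show "smooth d (\<lambda>x. a * f x + b * g x)"
    by (rule smooth_familyI[of d ?D, OF _ cont der]) auto
  show "partial_deriv k (\<lambda>x. a * f x + b * g x) x = a * partial_deriv k f x + b * partial_deriv k g x"
    if "x \<in> topspace (euc d)" "k < d"
    using foldr_partial_deriv_family[of d ?D "\<lambda>x. a * f x + b * g x" "[k]" x, OF _ cont der] that by simp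
qed

lemma supp_subset:
  assumes "closedin (euc d) C" "\<And>x. x \<in> topspace (euc d) \<Longrightarrow> x \<notin> C \<Longrightarrow> f x = 0"
  shows "supp d f \<subseteq> C"
  unfolding supp_def using assms by (intro closure_of_minimal) auto

lemma not_in_supp: "x \<in> topspace (euc d) \<Longrightarrow> x \<notin> supp d f \<Longrightarrow> f x = 0"
  unfolding supp_def
  using closure_of_subset[of "{x \<in> topspace (euc d). f x \<noteq> 0}" "euc d"] by auto

lemma closedin_supp: "closedin (euc d) (supp d f)"
  by (simp add: supp_def)

lemma supp_subset_topspace: "supp d f \<subseteq> topspace (euc d)"
  by (rule closedin_subset[OF closedin_supp])

lemma test_funsI:
  assumes "smooth d f" "compactin (euc d) C" "closedin (euc d) C" "C \<subseteq> U"
    "\<And>x. x \<in> topspace (euc d) \<Longrightarrow> x \<notin> C \<Longrightarrow> f x = 0"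
  shows "f \<in> test_funs d U"
proof -
  have "supp d f \<subseteq> C" by (rule supp_subset) fact+
  then show ?thesis using assms
    by (auto simp: test_funs_def intro!: closed_compactin[OF assms(2)] closedin_supp)
qed

lemma test_funsD:
  assumes "f \<in> test_funs d U"
  shows "smooth d f" "compactin (euc d) (supp d f)" "supp d f \<subseteq> U"
    "x \<in> topspace (euc d) \<Longrightarrow> x \<notin> U \<Longrightarrow> f x = 0"
  using assms not_in_supp[of x d f] by (auto simp: test_funs_def)

text \<open>The complement of the support is open, so \<open>f\<close> vanishes on a segment through
  \<open>x\<close> in direction \<open>k\<close>.\<close>

lemma partial_deriv_not_in_supp:
  assumes "k < d" "x \<in> topspace (euc d)" "x \<notin> supp d f"
  shows "partial_deriv k f x = 0"
proof -
  have "openin (euc d) (topspace (euc d) - supp d f)"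
    by (simp add: closedin_supp openin_diff)
  from openin_euc_sball[OF this] assms obtain r
    where r: "r > 0" "sball d x r \<subseteq> topspace (euc d) - supp d f" by blast
  have 0: "f (x(k := t)) = 0" if "t \<in> {x k - r<..<x k + r}" for t
  proof -
    have "x(k := t) \<in> sball d x r"
      using that assms(1,2) r(1) by (auto simp: sball_def topspace_euc_upd)
    with r(2) show ?thesis using not_in_supp by blast
  qed
  have "((\<lambda>t. 0) has_vector_derivative 0) (at (x k))" by simp
  then have "((\<lambda>t. f (x(k := t))) has_vector_derivative 0) (at (x k))"
    by (rule has_vector_derivative_transform_within_open[of _ _ _ "{x k - r<..<x k + r}"])
      (use r(1) 0 in auto)
  then show ?thesis by (simp add: partial_deriv_apply vector_derivative_at)
qed

lemma test_funs_partial: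
  assumes "f \<in> test_funs d U" "k < d"
  shows "partial_deriv k f \<in> test_funs d U"
  using assms test_funsD(1-3)[OF assms(1)]
  by (intro test_funsI[of d _ "supp d f"] smooth_partial closedin_supp partial_deriv_not_in_supp)

lemma test_funs_lincomb:
  assumes "f \<in> test_funs d U" "g \<in> test_funs d U"
  shows "(\<lambda>x. a * f x + b * g x) \<in> test_funs d U"
proof (rule test_funsI)
  note f = test_funsD(1-3)[OF assms(1)] and g = test_funsD(1-3)[OF assms(2)]
  show "smooth d (\<lambda>x. a * f x + b * g x)" using f g by (intro smooth_lincomb)
  show "compactin (euc d) (supp d f \<union> supp d g)" using f g by (intro compactin_Un)
  show "closedin (euc d) (supp d f \<union> supp d g)" by (intro closedin_Un closedin_supp)
  show "supp d f \<union> supp d g \<subseteq> U" using f g by blast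
qed (auto simp: not_in_supp)

lemma zero_in_test_funs: "(\<lambda>x. 0) \<in> test_funs d U"
  using smooth_familyI[of d "\<lambda>_ _. 0" "\<lambda>x. 0"] by (intro test_funsI[of d _ "{}"]) auto

lemma closedin_bounded_compactin:
  assumes "closedin (euc d) C" "\<And>x i. x \<in> C \<Longrightarrow> i < d \<Longrightarrow> \<bar>x i\<bar> \<le> R"
  shows "compactin (euc d) C"
proof (rule closed_compactin[OF compactin_euc_box])
  show "C \<subseteq> Pi\<^sub>E {..<d} (\<lambda>i. {- R..R})"
  proof
    fix x assume x: "x \<in> C"
    have "x i \<in> {- R..R}" if "i < d" for i
      using assms(2)[OF x that] by (auto simp: abs_le_iff)
    then show "x \<in> Pi\<^sub>E {..<d} (\<lambda>i. {- R..R})"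
      using closedin_subset[OF assms(1)] x by (auto simp: topspace_euc PiE_iff)
  qed
qed fact

definition ctensor :: "nat \<Rightarrow> (nat \<Rightarrow> real \<Rightarrow> real) \<Rightarrow> cfun" where
  "ctensor d \<theta> = (\<lambda>x. of_real (\<Prod>i<d. \<theta> i (x i)))"

text \<open>Differentiation along a list of directions differentiates the \<open>i\<close>-th factor
  as often as \<open>i\<close> occurs in the list, whatever the order.\<close>

lemma smooth_ctensor:
  assumes "\<And>i. i < d \<Longrightarrow> smooth1 (\<theta> i)"
  shows "smooth d (ctensor d \<theta>)"
    and "x \<in> topspace (euc d) \<Longrightarrow> k < d \<Longrightarrow>
      partial_deriv k (ctensor d \<theta>) x = ctensor d (\<lambda>i. if i = k then deriv (\<theta> i) else \<theta> i) x"
proof -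
  let ?D = "\<lambda>ks. ctensor d (\<lambda>i. (deriv ^^ count_list ks i) (\<theta> i))"
  have cont: "continuous_map (euc d) euclidean (?D ks)" for ks
  proof -
    have "continuous_map (euc d) euclideanreal (\<lambda>x. (deriv ^^ m) (\<theta> i) (x i))" if "i < d" for m i
    proof -
      have "continuous_on UNIV ((deriv ^^ m) (\<theta> i))"
        using smooth1_derivs[OF assms[OF that], of m]
        by (meson DERIV_isCont continuous_at_imp_continuous_on)
      then show ?thesis
        using continuous_map_compose[OF continuous_map_euc_proj[OF that], of euclideanreal]
        by (simp add: o_def)
    qed
    then have "continuous_map (euc d) euclideanreal (\<lambda>x. \<Prod>i<d. (deriv ^^ count_list ks i) (\<theta> i) (x i))"
      by (intro continuous_map_prod) auto
    from continuous_map_compose[OF this, of euclidean "of_real :: real \<Rightarrow> complex"]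
    show ?thesis by (simp add: o_def ctensor_def)
  qed
  have der: "((\<lambda>t. ?D ks (x(k := t))) has_vector_derivative ?D (k # ks) x) (at (x k))"
    if "k < d" for ks k x
  proof -
    let ?h = "\<lambda>ks i t. (deriv ^^ count_list ks i) (\<theta> i) t"
    let ?c = "\<Prod>i\<in>{..<d} - {k}. ?h ks i (x i)"
    have rem: "(\<Prod>i<d. h i) = h k * (\<Prod>i\<in>{..<d} - {k}. h i)" for h :: "nat \<Rightarrow> real"
      using that by (intro prod.remove) auto
    have 1: "?D ks (x(k := t)) = of_real (?h ks k t * ?c)" for t
      unfolding ctensor_def by (subst rem) (auto intro!: prod.cong)
    have 2: "?D (k # ks) x = of_real ((deriv ^^ Suc (count_list ks k)) (\<theta> k) (x k) * ?c)"
      unfolding ctensor_def by (subst rem) (auto intro!: prod.cong)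
    have "((\<lambda>t. ?h ks k t * ?c) has_real_derivative (deriv ^^ Suc (count_list ks k)) (\<theta> k) (x k) * ?c) (at (x k))"
      by (intro DERIV_cmult_right smooth1_derivs assms that)
    then show ?thesis unfolding 1 2 by (rule has_vector_derivative_of_real)
  qed
  show "smooth d (ctensor d \<theta>)"
    by (rule smooth_familyI[of d ?D, OF _ cont der]) auto
  show "partial_deriv k (ctensor d \<theta>) x = ctensor d (\<lambda>i. if i = k then deriv (\<theta> i) else \<theta> i) x"
    if "x \<in> topspace (euc d)" "k < d"
  proof -
    have "partial_deriv k (ctensor d \<theta>) x = ?D [k] x"
      using foldr_partial_deriv_family[of d ?D "ctensor d \<theta>" "[k]" x, OF _ cont der] that by simp
    also have "\<dots> = ctensor d (\<lambda>i. if i = k then deriv (\<theta> i) else \<theta> i) x"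
      by (auto simp: ctensor_def intro!: prod.cong)
    finally show ?thesis .
  qed
qed

lemma test_funs_ctensor:
  assumes "\<And>i. i < d \<Longrightarrow> smooth1 (\<theta> i)" "Pi\<^sub>E {..<d} (\<lambda>i. {a i..b i}) \<subseteq> U"
    "\<And>i t. i < d \<Longrightarrow> t \<notin> {a i..b i} \<Longrightarrow> \<theta> i t = 0"
  shows "ctensor d \<theta> \<in> test_funs d U"
proof (rule test_funsI[OF smooth_ctensor(1) compactin_euc_box closedin_euc_box assms(2)])
  fix x assume "x \<in> topspace (euc d)" "x \<notin> Pi\<^sub>E {..<d} (\<lambda>i. {a i..b i})"
  then obtain i where "i < d" "x i \<notin> {a i..b i}" by (auto simp: topspace_euc PiE_iff)
  then have "\<exists>i\<in>{..<d}. \<theta> i (x i) = 0" using assms(3) by blast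
  then show "ctensor d \<theta> x = 0" by (auto simp: ctensor_def)
qed (use assms in auto)

section \<open>Splitting coordinates into two blocks\<close>

definition fst_blk :: "nat \<Rightarrow> (nat \<Rightarrow> real) \<Rightarrow> (nat \<Rightarrow> real)" where
  "fst_blk a x = restrict x {..<a}"

definition snd_blk :: "nat \<Rightarrow> nat \<Rightarrow> (nat \<Rightarrow> real) \<Rightarrow> (nat \<Rightarrow> real)" where
  "snd_blk a b x = (\<lambda>i\<in>{..<b}. x (a + i))"

text \<open>The \<open>n\<close>-fold elementary tensor is treated by splitting off its last factor,
  so only this binary case needs analysis.\<close>

definition tens :: "nat \<Rightarrow> nat \<Rightarrow> cfun \<Rightarrow> cfun \<Rightarrow> cfun" where
  "tens a b f g = (\<lambda>x. f (fst_blk a x) * g (snd_blk a b x))"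

definition prod2 :: "nat \<Rightarrow> nat \<Rightarrow> (nat \<Rightarrow> real) set \<Rightarrow> (nat \<Rightarrow> real) set \<Rightarrow> (nat \<Rightarrow> real) set" where
  "prod2 a b U V = {x \<in> topspace (euc (a + b)). fst_blk a x \<in> U \<and> snd_blk a b x \<in> V}"

lemma fst_blk_topspace [simp]: "fst_blk a x \<in> topspace (euc a)"
  and snd_blk_topspace [simp]: "snd_blk a b x \<in> topspace (euc b)"
  by (auto simp: fst_blk_def snd_blk_def topspace_euc)

lemma continuous_map_fst_blk: "continuous_map (euc (a + b)) (euc a) (fst_blk a)"
  and continuous_map_snd_blk: "continuous_map (euc (a + b)) (euc b) (snd_blk a b)"
  unfolding euc_def[of a] euc_def[of b] continuous_map_componentwise
  using continuous_map_euc_proj[of _ "a + b"]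
  by (auto simp: fst_blk_def snd_blk_def)

lemma blk_upd:
  "k < a \<Longrightarrow> fst_blk a (x(k := t)) = (fst_blk a x)(k := t)"
  "k < a \<Longrightarrow> snd_blk a b (x(k := t)) = snd_blk a b x"
  "k \<ge> a \<Longrightarrow> fst_blk a (x(k := t)) = fst_blk a x"
  "k \<ge> a \<Longrightarrow> k < a + b \<Longrightarrow> snd_blk a b (x(k := t)) = (snd_blk a b x)(k - a := t)"
  by (auto simp: fst_blk_def snd_blk_def restrict_def fun_eq_iff)

lemma blk_apply: "k < a \<Longrightarrow> fst_blk a x k = x k" "k \<ge> a \<Longrightarrow> k < a + b \<Longrightarrow> snd_blk a b x (k - a) = x k"
  by (auto simp: fst_blk_def snd_blk_def)

lemma continuous_map_mult_complex:
  fixes f g :: "'a \<Rightarrow> complex"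
  shows "continuous_map X euclidean f \<Longrightarrow> continuous_map X euclidean g \<Longrightarrow>
    continuous_map X euclidean (\<lambda>x. f x * g x)"
  by (simp add: continuous_map_atin tendsto_mult)

lemma continuous_map_tens:
  assumes "continuous_map (euc a) euclidean f" "continuous_map (euc b) euclidean g"
  shows "continuous_map (euc (a + b)) euclidean (tens a b f g)"
  unfolding tens_def
  using continuous_map_compose[OF continuous_map_fst_blk assms(1)]
    continuous_map_compose[OF continuous_map_snd_blk assms(2)]
  by (intro continuous_map_mult_complex) (simp_all add: o_def)

lemma smooth_tens:
  assumes f: "smooth a f" and g: "smooth b g"
  shows "smooth (a + b) (tens a b f g)"
    and "x \<in> topspace (euc (a + b)) \<Longrightarrow> k < a + b \<Longrightarrow>
      partial_deriv k (tens a b f g) x =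
      (if k < a then tens a b (partial_deriv k f) g x else tens a b f (partial_deriv (k - a) g) x)"
proof -
  \<comment> \<open>Directions below \<open>a\<close> act on the first factor; the others, shifted
    down by \<open>a\<close>, act on the second.\<close>
  let ?l = "\<lambda>ks. filter (\<lambda>k. k < a) ks" and ?r = "\<lambda>ks. map (\<lambda>k. k - a) (filter (\<lambda>k. \<not> k < a) ks)"
  let ?D = "\<lambda>ks. tens a b (foldr partial_deriv (?l ks) f) (foldr partial_deriv (?r ks) g)"
  have lr: "set (?l ks) \<subseteq> {..<a}" "set (?r ks) \<subseteq> {..<b}" if "set ks \<subseteq> {..<a + b}" for ks
    using that by auto
  have cont: "continuous_map (euc (a + b)) euclidean (?D ks)" if "set ks \<subseteq> {..<a + b}" for ks
    using lr[OF that] by (intro continuous_map_tens smooth_continuous f g)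
  have der: "((\<lambda>t. ?D ks (x(k := t))) has_vector_derivative ?D (k # ks) x) (at (x k))"
    if ks: "set ks \<subseteq> {..<a + b}" and k: "k < a + b" for ks k x
  proof (cases "k < a")
    case True
    have "((\<lambda>t. foldr partial_deriv (?l ks) f ((fst_blk a x)(k := t))) has_vector_derivative
        foldr partial_deriv (k # ?l ks) f (fst_blk a x)) (at (fst_blk a x k))"
      by (rule smooth_foldr_derivative[OF f lr(1)[OF ks] True]) simp
    then show ?thesis using True
      by (auto simp: tens_def blk_upd blk_apply intro!: has_vector_derivative_mult_left)
  next
    case False
    have "((\<lambda>t. foldr partial_deriv (?r ks) g ((snd_blk a b x)(k - a := t))) has_vector_derivative
        foldr partial_deriv ((k - a) # ?r ks) g (snd_blk a b x)) (at (snd_blk a b x (k - a)))"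
      by (rule smooth_foldr_derivative[OF g lr(2)[OF ks]]) (use False k in auto)
    then show ?thesis using False k
      by (auto simp: tens_def blk_upd blk_apply intro!: has_vector_derivative_mult_right)
  qed
  show "smooth (a + b) (tens a b f g)"
    by (rule smooth_familyI[of "a + b" ?D, OF _ cont der]) auto
  show "partial_deriv k (tens a b f g) x =
      (if k < a then tens a b (partial_deriv k f) g x else tens a b f (partial_deriv (k - a) g) x)"
    if "x \<in> topspace (euc (a + b))" "k < a + b"
    using foldr_partial_deriv_family[of "a + b" ?D "tens a b f g" "[k]" x, OF _ cont der] that by auto
qed

lemma test_funs_tens:
  assumes "f \<in> test_funs a U" "g \<in> test_funs b V"
  shows "tens a b f g \<in> test_funs (a + b) (prod2 a b U V)"
proof (rule test_funsI)
  note f = test_funsD(1-3)[OF assms(1)] and g = test_funsD(1-3)[OF assms(2)]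
  show "smooth (a + b) (tens a b f g)" using f g by (intro smooth_tens)
  let ?C = "prod2 a b (supp a f) (supp b g)"
  have "?C = {x \<in> topspace (euc (a + b)). fst_blk a x \<in> supp a f} \<inter>
      {x \<in> topspace (euc (a + b)). snd_blk a b x \<in> supp b g}"
    by (auto simp: prod2_def)
  then show cl: "closedin (euc (a + b)) ?C"
    by (auto intro!: closedin_continuous_map_preimage
        continuous_map_fst_blk continuous_map_snd_blk closedin_supp)
  obtain R where R: "\<And>x i. x \<in> supp a f \<Longrightarrow> i < a \<Longrightarrow> \<bar>x i\<bar> \<le> R"
    using compactin_euc_bounded[OF f(2)] by metis
  obtain S where S: "\<And>x i. x \<in> supp b g \<Longrightarrow> i < b \<Longrightarrow> \<bar>x i\<bar> \<le> S"
    using compactin_euc_bounded[OF g(2)] by metis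
  show "compactin (euc (a + b)) ?C"
  proof (rule closedin_bounded_compactin[OF cl, of "max R S"])
    fix x i assume x: "x \<in> ?C" and i: "i < a + b"
    show "\<bar>x i\<bar> \<le> max R S"
    proof (cases "i < a")
      case True
      then show ?thesis using R[of "fst_blk a x" i] x by (auto simp: prod2_def blk_apply)
    next
      case False
      then have "i - a < b" using i by auto
      with False show ?thesis using S[of "snd_blk a b x" "i - a"] x i by (auto simp: prod2_def blk_apply)
    qed
  qed
  show "?C \<subseteq> prod2 a b U V" using f g by (auto simp: prod2_def)
  show "tens a b f g x = 0" if "x \<in> topspace (euc (a + b))" "x \<notin> ?C" for x
    using that not_in_supp[OF fst_blk_topspace, of a x f] not_in_supp[OF snd_blk_topspace, of a b x g]
    by (auto simp: prod2_def tens_def)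
qed

lemma openin_prod2:
  assumes "openin (euc a) U" "openin (euc b) V"
  shows "openin (euc (a + b)) (prod2 a b U V)"
proof -
  have "prod2 a b U V = {x \<in> topspace (euc (a + b)). fst_blk a x \<in> U} \<inter>
      {x \<in> topspace (euc (a + b)). snd_blk a b x \<in> V}"
    by (auto simp: prod2_def)
  then show ?thesis
    using assms by (auto intro!: openin_continuous_map_preimage
        continuous_map_fst_blk continuous_map_snd_blk)
qed

section \<open>Square-integrable functions\<close>

abbreviation lebn :: "nat \<Rightarrow> (nat \<Rightarrow> real) measure" where
  "lebn d \<equiv> Pi\<^sub>M {..<d} (\<lambda>_. lborel)"

lemma openin_sets_lebn:
  assumes "openin (euc d) U"
  shows "U \<in> sets (lebn d)" "U \<inter> space (lebn d) \<in> sets (lebn d)" "space (leb_on d U) = U"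
proof -
  show U: "U \<in> sets (lebn d)" by (rule openin_euc_sets[OF assms])
  from sets.sets_into_space[OF U] show "U \<inter> space (lebn d) \<in> sets (lebn d)" "space (leb_on d U) = U"
    using U by (auto simp: leb_on_def space_restrict_space)
qed

lemma integral_leb_on:
  fixes f :: cfun
  assumes "openin (euc d) U" "\<And>x. x \<in> topspace (euc d) \<Longrightarrow> x \<notin> U \<Longrightarrow> f x = 0"
  shows "(\<integral>x. f x \<partial>leb_on d U) = (\<integral>x. f x \<partial>lebn d)"
  unfolding leb_on_def integral_restrict_space[OF openin_sets_lebn(2)[OF assms(1)]]
  by (rule Bochner_Integration.integral_cong) (use assms in \<open>auto simp: space_PiM_lborel indicator_def\<close>)

text \<open>The squared norm is the working quantity: it is multiplicative on tensors, and the
  inequality with factors 2 for sums replaces the triangle inequality.\<close>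

definition sqn :: "nat \<Rightarrow> (nat \<Rightarrow> real) set \<Rightarrow> cfun \<Rightarrow> real" where
  "sqn d U f = (\<integral>x. (cmod (f x))\<^sup>2 \<partial>leb_on d U)"

lemma sqn_nonneg: "0 \<le> sqn d U f"
  by (simp add: sqn_def)

lemma L2_inner_self: "L2_inner d U f f = of_real (sqn d U f)"
  by (simp add: L2_inner_def sqn_def complex_norm_square[symmetric] flip: of_real_power)

lemma L2D:
  assumes "f \<in> L2 d U"
  shows "f \<in> borel_measurable (leb_on d U)" "integrable (leb_on d U) (\<lambda>x. (cmod (f x))\<^sup>2)"
  using assms by (auto simp: L2_def)

lemma norm_add_square_le: "(norm (x + y :: 'a :: real_normed_vector))\<^sup>2 \<le> 2 * (norm x)\<^sup>2 + 2 * (norm y)\<^sup>2"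
proof -
  have "(norm (x + y))\<^sup>2 \<le> (norm x + norm y)\<^sup>2"
    by (intro power_mono norm_triangle_ineq) auto
  also have "\<dots> \<le> 2 * (norm x)\<^sup>2 + 2 * (norm y)\<^sup>2"
    using sum_squares_bound[of "norm x" "norm y"] by (simp add: power2_sum)
  finally show ?thesis .
qed

lemma L2_scale:
  assumes "f \<in> L2 d U"
  shows "(\<lambda>x. c * f x) \<in> L2 d U" "sqn d U (\<lambda>x. c * f x) = (cmod c)\<^sup>2 * sqn d U f"
  using L2D[OF assms] by (auto simp: L2_def sqn_def norm_mult power_mult_distrib)

lemma L2_add:
  assumes f: "f \<in> L2 d U" and g: "g \<in> L2 d U"
  shows "(\<lambda>x. f x + g x) \<in> L2 d U"
    and "sqn d U (\<lambda>x. f x + g x) \<le> 2 * sqn d U f + 2 * sqn d U g"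
proof -
  note [measurable] = L2D(1)[OF f] L2D(1)[OF g]
  have i: "integrable (leb_on d U) (\<lambda>x. 2 * (cmod (f x))\<^sup>2 + 2 * (cmod (g x))\<^sup>2)"
    using L2D(2)[OF f] L2D(2)[OF g] by auto
  have j: "integrable (leb_on d U) (\<lambda>x. (cmod (f x + g x))\<^sup>2)"
    by (rule Bochner_Integration.integrable_bound[OF i])
      (auto intro!: norm_add_square_le)
  then show "(\<lambda>x. f x + g x) \<in> L2 d U" by (simp add: L2_def)
  have "sqn d U (\<lambda>x. f x + g x) \<le> (\<integral>x. 2 * (cmod (f x))\<^sup>2 + 2 * (cmod (g x))\<^sup>2 \<partial>leb_on d U)"
    unfolding sqn_def by (intro integral_mono i j norm_add_square_le)
  also have "\<dots> = 2 * sqn d U f + 2 * sqn d U g"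
    using L2D(2)[OF f] L2D(2)[OF g] by (simp add: sqn_def)
  finally show "sqn d U (\<lambda>x. f x + g x) \<le> 2 * sqn d U f + 2 * sqn d U g" .
qed

lemma L2_diff:
  assumes f: "f \<in> L2 d U" and g: "g \<in> L2 d U"
  shows "(\<lambda>x. f x - g x) \<in> L2 d U"
    and "sqn d U (\<lambda>x. f x - g x) \<le> 2 * sqn d U f + 2 * sqn d U g"
  using L2_add[OF f L2_scale(1)[OF g, of "-1"]] L2_scale(2)[OF g, of "-1"] by auto

lemma L2_cong_AE:
  assumes "f \<in> L2 d U" "g \<in> borel_measurable (leb_on d U)" "AE x in leb_on d U. f x = g x"
  shows "g \<in> L2 d U" "sqn d U f = sqn d U g"
proof -
  have [measurable]: "f \<in> borel_measurable (leb_on d U)" "g \<in> borel_measurable (leb_on d U)"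
    using assms L2D by auto
  have ae: "AE x in leb_on d U. (cmod (f x))\<^sup>2 = (cmod (g x))\<^sup>2" using assms(3) by auto
  show "sqn d U f = sqn d U g" unfolding sqn_def by (intro integral_cong_AE ae) auto
  have "integrable (leb_on d U) (\<lambda>x. (cmod (g x))\<^sup>2)"
    using integrable_cong_AE[OF _ _ ae] L2D(2)[OF assms(1)] by auto
  then show "g \<in> L2 d U" by (simp add: L2_def)
qed

text \<open>Young's inequality with a free weight \<open>t\<close>, obtained from the square of
  \<open>t * cmod (f x) - cmod (g x)\<close>, takes the place of Cauchy-Schwarz.\<close>

lemma L2_mult:
  assumes f: "f \<in> L2 d U" and g: "g \<in> L2 d U"
  shows "integrable (leb_on d U) (\<lambda>x. f x * g x)"
    and "t > 0 \<Longrightarrow> cmod (\<integral>x. f x * g x \<partial>leb_on d U) \<le> (t * sqn d U f + sqn d U g / t) / 2"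
proof -
  note [measurable] = L2D(1)[OF f] L2D(1)[OF g]
  have le: "cmod (f x * g x) \<le> (t * (cmod (f x))\<^sup>2 + (cmod (g x))\<^sup>2 / t) / 2" if "t > 0" for t x
  proof -
    have "0 \<le> (t * cmod (f x) - cmod (g x))\<^sup>2 / t" using that by simp
    also have "\<dots> = t * (cmod (f x))\<^sup>2 + (cmod (g x))\<^sup>2 / t - 2 * (cmod (f x) * cmod (g x))"
      using that by (simp add: power2_eq_square field_simps)
    finally show ?thesis by (simp add: norm_mult)
  qed
  have i: "integrable (leb_on d U) (\<lambda>x. (t * (cmod (f x))\<^sup>2 + (cmod (g x))\<^sup>2 / t) / 2)" for t
    using L2D(2)[OF f] L2D(2)[OF g] by auto
  show j: "integrable (leb_on d U) (\<lambda>x. f x * g x)"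
    by (rule Bochner_Integration.integrable_bound[OF i[of 1]])
      (use le[of 1] in \<open>auto intro: order_trans\<close>)
  assume t: "t > 0"
  have "cmod (\<integral>x. f x * g x \<partial>leb_on d U) \<le> (\<integral>x. cmod (f x * g x) \<partial>leb_on d U)"
    by (rule integral_norm_bound)
  also have "\<dots> \<le> (\<integral>x. (t * (cmod (f x))\<^sup>2 + (cmod (g x))\<^sup>2 / t) / 2 \<partial>leb_on d U)"
    using j by (intro integral_mono i le t) auto
  also have "\<dots> = (t * sqn d U f + sqn d U g / t) / 2"
    using L2D(2)[OF f] L2D(2)[OF g] by (simp add: sqn_def)
  finally show "cmod (\<integral>x. f x * g x \<partial>leb_on d U) \<le> (t * sqn d U f + sqn d U g / t) / 2" .
qed

lemma L2_pairing_continuous: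
  assumes g: "g \<in> L2 d U" and "\<eta> > 0"
  obtains \<epsilon> where "\<epsilon> > 0"
    "\<forall>f \<in> L2 d U. sqn d U f < \<epsilon> \<longrightarrow> cmod (\<integral>x. f x * g x \<partial>leb_on d U) < \<eta>"
proof
  \<comment> \<open>This weight makes the contribution of \<open>g\<close> at most \<eta>, and the
    threshold \<open>\<eta> / t\<close> makes that of \<open>f\<close> less than \<eta>; the bound
    is half their sum. The added 1 keeps \<open>t\<close> positive when \<open>g\<close>
    vanishes.\<close>
  define t where "t = (sqn d U g + 1) / \<eta>"
  have t: "t > 0" using assms sqn_nonneg[of d U g] by (simp add: t_def)
  show "\<eta> / t > 0" using t assms by simp
  show "\<forall>f \<in> L2 d U. sqn d U f < \<eta> / t \<longrightarrow> cmod (\<integral>x. f x * g x \<partial>leb_on d U) < \<eta>"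
  proof (intro ballI impI)
    fix f assume f: "f \<in> L2 d U" "sqn d U f < \<eta> / t"
    have "t * sqn d U f < \<eta>" using f(2) t by (simp add: field_simps)
    moreover have "sqn d U g / t \<le> \<eta>"
      using assms sqn_nonneg[of d U g] by (simp add: t_def field_simps)
    ultimately show "cmod (\<integral>x. f x * g x \<partial>leb_on d U) < \<eta>"
      using L2_mult(2)[OF f(1) g t] by simp
  qed
qed

section \<open>Boxes and bounded functions with bounded support\<close>

interpretation lborel_prod: product_sigma_finite "\<lambda>_ :: nat. lborel :: real measure"
  by standard

lemma emeasure_lebn_box:
  assumes "\<And>i. i < d \<Longrightarrow> a i \<le> b i"
  shows "emeasure (lebn d) (Pi\<^sub>E {..<d} (\<lambda>i. {a i..b i})) = ennreal (\<Prod>i<d. b i - a i)"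
proof -
  have "emeasure (lebn d) (Pi\<^sub>E {..<d} (\<lambda>i. {a i..b i})) = (\<Prod>i<d. emeasure lborel {a i..b i})"
    by (rule lborel_prod.emeasure_PiM) auto
  also have "\<dots> = (\<Prod>i<d. ennreal (b i - a i))"
    using assms by (intro prod.cong) auto
  also have "\<dots> = ennreal (\<Prod>i<d. b i - a i)"
    using assms by (intro prod_ennreal) auto
  finally show ?thesis .
qed

lemma sets_lebn_box: "Pi\<^sub>E {..<d} (\<lambda>i. {a i..b i}) \<in> sets (lebn d)"
  by (intro sets_PiM_I_finite) auto

text \<open>The factor \<open>(2 * R) ^ d\<close> is the volume of the cube that confines
  \<open>f\<close>. Besides giving integrability, the explicit bound later turns a uniform error
  into an error in square norm.\<close>

lemma L2_bounded:
  fixes f :: cfun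
  assumes U: "openin (euc d) U" and f[measurable]: "f \<in> borel_measurable (lebn d)" and R: "R \<ge> 0"
    and supp: "\<And>x i. x \<in> topspace (euc d) \<Longrightarrow> i < d \<Longrightarrow> \<bar>x i\<bar> > R \<Longrightarrow> f x = 0"
    and bound: "\<And>x. x \<in> topspace (euc d) \<Longrightarrow> cmod (f x) \<le> c"
  shows "f \<in> L2 d U" "integrable (lebn d) f" "sqn d U f \<le> c\<^sup>2 * (2 * R) ^ d"
proof -
  let ?B = "Pi\<^sub>E {..<d} (\<lambda>i. {- R..R})"
  have em: "emeasure (lebn d) ?B = ennreal ((2 * R) ^ d)"
    using emeasure_lebn_box[of d "\<lambda>_. - R" "\<lambda>_. R"] R by simp
  have iB: "integrable (lebn d) (indicat_real ?B)" "(\<integral>x. indicat_real ?B x \<partial>lebn d) = (2 * R) ^ d"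
    using em R sets_lebn_box[of d "\<lambda>_. - R" "\<lambda>_. R"]
    by (auto simp: integrable_indicator_iff measure_def)
  have f0: "f x = 0" if "x \<in> space (lebn d)" "x \<notin> ?B" for x
    using that supp[of x] by (auto simp: topspace_euc PiE_iff space_PiM not_le abs_if)
  have c: "cmod (f x) \<le> c * indicat_real ?B x" if "x \<in> space (lebn d)" for x
    using f0[OF that] bound[of x] that by (auto simp: indicator_def space_PiM_lborel)
  have le: "(cmod (f x))\<^sup>2 \<le> c\<^sup>2 * indicat_real ?B x" if "x \<in> space (lebn d)" for x
    using power_mono[OF c[OF that] norm_ge_zero, of 2] by (cases "x \<in> ?B") (simp_all add: power_mult_distrib)
  show "integrable (lebn d) f"
  proof (rule Bochner_Integration.integrable_bound[of _ "\<lambda>x. c * indicat_real ?B x"])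
    show "AE x in lebn d. norm (f x) \<le> norm (c * indicat_real ?B x)"
      by (intro AE_I2) (simp only: real_norm_def, rule order_trans[OF c abs_ge_self])
  qed (use iB in auto)
  have i: "integrable (lebn d) (\<lambda>x. indicat_real U x *\<^sub>R (cmod (f x))\<^sup>2)"
  proof (rule Bochner_Integration.integrable_bound[of _ "\<lambda>x. c\<^sup>2 * indicat_real ?B x"])
    show "AE x in lebn d. norm (indicat_real U x *\<^sub>R (cmod (f x))\<^sup>2) \<le> norm (c\<^sup>2 * indicat_real ?B x)"
    proof (rule AE_I2)
      fix x assume "x \<in> space (lebn d)"
      then show "norm (indicat_real U x *\<^sub>R (cmod (f x))\<^sup>2) \<le> norm (c\<^sup>2 * indicat_real ?B x)"
        using le[of x] by (cases "x \<in> U") auto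
    qed
  qed (use iB openin_sets_lebn(1)[OF U] in auto)
  then show "f \<in> L2 d U"
    unfolding L2_def leb_on_def
    by (auto simp: integrable_restrict_space[OF openin_sets_lebn(2)[OF U]]
        intro!: measurable_restrict_space1)
  have "sqn d U f = (\<integral>x. indicat_real U x *\<^sub>R (cmod (f x))\<^sup>2 \<partial>lebn d)"
    by (simp only: sqn_def leb_on_def integral_restrict_space[OF openin_sets_lebn(2)[OF U]])
  also have "\<dots> \<le> (\<integral>x. c\<^sup>2 * indicat_real ?B x \<partial>lebn d)"
  proof (intro integral_mono i)
    fix x assume "x \<in> space (lebn d)"
    then show "indicat_real U x *\<^sub>R (cmod (f x))\<^sup>2 \<le> c\<^sup>2 * indicat_real ?B x"
      using le[of x] by (cases "x \<in> U") auto
  qed (use iB in auto)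
  also have "\<dots> = c\<^sup>2 * (2 * R) ^ d" using iB by simp
  finally show "sqn d U f \<le> c\<^sup>2 * (2 * R) ^ d" .
qed

lemma compact_support_bounded:
  fixes f :: cfun
  assumes "continuous_map (euc d) euclidean f" "compactin (euc d) K"
    "\<And>x. x \<in> topspace (euc d) \<Longrightarrow> x \<notin> K \<Longrightarrow> f x = 0"
  obtains c where "c \<ge> 0" "\<forall>x \<in> topspace (euc d). cmod (f x) \<le> c"
proof -
  have "compact (f ` K)" using image_compactin[OF assms(2,1)] by simp
  then obtain c where c: "\<forall>y\<in>f ` K. cmod y \<le> c"
    using compact_imp_bounded bounded_iff by metis
  show ?thesis by (rule that[of "max 0 c"]) (use c assms(3) in \<open>fastforce simp: le_max_iff_disj\<close>)+
qed

lemma compact_support_integrable: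
  fixes f :: cfun
  assumes U: "openin (euc d) U" and f: "continuous_map (euc d) euclidean f" "compactin (euc d) K"
    "\<And>x. x \<in> topspace (euc d) \<Longrightarrow> x \<notin> K \<Longrightarrow> f x = 0"
  shows "f \<in> L2 d U" "integrable (lebn d) f"
proof -
  obtain R where R: "R > 0" "\<And>x i. x \<in> K \<Longrightarrow> i < d \<Longrightarrow> \<bar>x i\<bar> \<le> R"
    using compactin_euc_bounded[OF f(2)] by metis
  obtain c where c: "\<forall>x \<in> topspace (euc d). cmod (f x) \<le> c"
    using compact_support_bounded[OF f] by metis
  have 0: "f x = 0" if "x \<in> topspace (euc d)" "i < d" "\<bar>x i\<bar> > R" for x i
    using f(3)[OF that(1)] R(2)[of x i] that by force
  show "f \<in> L2 d U" "integrable (lebn d) f"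
    using L2_bounded[OF U continuous_map_euc_measurable[OF f(1)], of R c] R(1) 0 c by auto
qed

lemma test_funs_L2:
  assumes "openin (euc d) U" "f \<in> test_funs d V"
  shows "f \<in> L2 d U"
  using test_funsD[OF assms(2)] not_in_supp
  by (intro compact_support_integrable[OF assms(1), of f "supp d f"] smooth_imp_continuous) auto

section \<open>Integration by parts and the fundamental lemma\<close>

lemma continuous_map_euc_upd:
  assumes "x \<in> topspace (euc d)" "k < d"
  shows "continuous_map euclideanreal (euc d) (\<lambda>t. x(k := t))"
  unfolding euc_def continuous_map_componentwise
  using assms by (auto simp: topspace_euc PiE_iff extensional_def)

text \<open>By Fubini the coordinate \<open>k\<close> is integrated first; along each such line the
  integrand is the derivative of \<open>f * g\<close>, and the boundary terms vanish.\<close>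

lemma integral_product_rule:
  assumes f: "f \<in> test_funs d U" and g: "g \<in> test_funs d U" and k: "k < d"
  shows "(\<integral>x. f x * partial_deriv k g x + partial_deriv k f x * g x \<partial>lebn d) = 0"
proof -
  let ?h = "\<lambda>x. f x * partial_deriv k g x + partial_deriv k f x * g x"
  let ?I = "{..<d} - {k}"
  note f' = test_funsD[OF f] and g' = test_funsD[OF g]
  have cont: "continuous_map (euc d) euclidean ?h"
    by (intro continuous_map_add continuous_map_mult_complex
        smooth_imp_continuous smooth_imp_continuous_partial f' g' k)
  have h0: "?h x = 0" if "x \<in> topspace (euc d)" "x \<notin> supp d f" for x
    using not_in_supp[OF that] partial_deriv_not_in_supp[OF k that] by simp
  have "openin (euc d) (topspace (euc d))" by simp
  then have int: "integrable (lebn d) ?h"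
    by (rule compact_support_integrable[OF _ cont f'(2) h0])
  obtain R where R: "R > 0" "\<And>x i. x \<in> supp d f \<Longrightarrow> i < d \<Longrightarrow> \<bar>x i\<bar> \<le> R"
    using compactin_euc_bounded[OF f'(2)] by metis
  have inner: "(\<integral>y. ?h (x(k := y)) \<partial>lborel) = 0" if x: "x \<in> space (Pi\<^sub>M ?I (\<lambda>_. lborel :: real measure))" for x
  proof -
    have xt: "x(k := y) \<in> topspace (euc d)" for y
      using x k by (auto simp: space_PiM topspace_euc PiE_iff extensional_def)
    have out: "x(k := y) \<notin> supp d f" if "\<bar>y\<bar> > R" for y
      using R(2)[of "x(k := y)" k] k that by auto
    have der: "((\<lambda>y. f (x(k := y)) * g (x(k := y))) has_vector_derivative ?h (x(k := y))) (at y)" for y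
      using has_vector_derivative_mult[OF smooth_partial_derivative[OF f'(1) k xt[of 0], of y]
          smooth_partial_derivative[OF g'(1) k xt[of 0], of y]] by simp
    have "continuous_map euclideanreal euclidean (\<lambda>y. ?h (x(k := y)))"
      using continuous_map_compose[OF continuous_map_euc_upd[OF xt[of 0] k] cont] by (simp add: o_def)
    \<comment> \<open>The radius is enlarged to \<open>R + 1\<close> so that the endpoints lie
      strictly outside the support.\<close>
    then have ch: "continuous_on {- (R + 1)..R + 1} (\<lambda>y. ?h (x(k := y)))"
      by (auto intro: continuous_on_subset)
    have "(\<integral>y. ?h (x(k := y)) \<partial>lborel) =
        (\<integral>y. indicator {- (R + 1)..R + 1} y *\<^sub>R ?h (x(k := y)) \<partial>lborel)"
    proof (rule Bochner_Integration.integral_cong[OF refl])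
      fix y show "?h (x(k := y)) = indicator {- (R + 1)..R + 1} y *\<^sub>R ?h (x(k := y))"
      proof (cases "y \<in> {- (R + 1)..R + 1}")
        case False
        then have "\<bar>y\<bar> > R" by (auto simp: abs_if)
        then show ?thesis using h0[OF xt out] by simp
      qed simp
    qed
    also have "\<dots> = f (x(k := R + 1)) * g (x(k := R + 1)) - f (x(k := - (R + 1))) * g (x(k := - (R + 1)))"
      using R(1) by (intro integral_FTC_atLeastAtMost ch has_vector_derivative_at_within[OF der]) auto
    also have "\<dots> = 0"
      using R(1) not_in_supp[OF xt out, of "R + 1"] not_in_supp[OF xt out, of "- (R + 1)"] by simp
    finally show ?thesis .
  qed
  have I: "insert k ?I = {..<d}" using k by auto
  have "integral\<^sup>L (lebn d) ?h = (\<integral>x. (\<integral>y. ?h (x(k := y)) \<partial>lborel) \<partial>Pi\<^sub>M ?I (\<lambda>_. lborel))"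
    using lborel_prod.product_integral_insert[of ?I k ?h] int by (simp only: I) auto
  also have "\<dots> = (\<integral>x. 0 \<partial>Pi\<^sub>M ?I (\<lambda>_. lborel :: real measure))"
    by (rule Bochner_Integration.integral_cong[OF refl inner])
  finally show ?thesis by simp
qed

text \<open>The product rule lives on the whole space; it transfers to \<open>U\<close> because
  \<open>f\<close> and its partial derivatives vanish off \<open>U\<close>.\<close>

lemma test_funs_weak_deriv:
  assumes U: "openin (euc d) U" and f: "f \<in> test_funs d U" and k: "k < d"
  shows "is_weak_deriv d U k f (partial_deriv k f)"
  unfolding is_weak_deriv_def
proof
  fix g assume g: "g \<in> test_funs d U"
  have top: "openin (euc d) (topspace (euc d))" by simp
  note f' = test_funsD[OF f] and g' = test_funsD[OF g]
  have 0: "f x = 0" "partial_deriv k f x = 0" if "x \<in> topspace (euc d)" "x \<notin> U" for x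
    using not_in_supp[of x d f] partial_deriv_not_in_supp[OF k, of x f] f'(3) that by auto
  have 1: "f x = 0" "partial_deriv k f x = 0" if "x \<in> topspace (euc d)" "x \<notin> supp d f" for x
    using not_in_supp[of x d f] partial_deriv_not_in_supp[OF k, of x f] that by auto
  note cont = smooth_imp_continuous[OF f'(1)] smooth_imp_continuous_partial[OF f'(1) k]
    smooth_imp_continuous[OF g'(1)] smooth_imp_continuous_partial[OF g'(1) k]
  have i1: "integrable (lebn d) (\<lambda>x. f x * partial_deriv k g x)"
    by (rule compact_support_integrable(2)[OF top _ f'(2)])
      (auto simp: 1 intro!: continuous_map_mult_complex cont)
  have i2: "integrable (lebn d) (\<lambda>x. partial_deriv k f x * g x)"
    by (rule compact_support_integrable(2)[OF top _ f'(2)])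
      (auto simp: 1 intro!: continuous_map_mult_complex cont)
  have "(\<integral>x. f x * partial_deriv k g x \<partial>lebn d) + (\<integral>x. partial_deriv k f x * g x \<partial>lebn d) = 0"
    using integral_product_rule[OF f g k] i1 i2 by simp
  then show "(\<integral>x. f x * partial_deriv k g x \<partial>leb_on d U) = - (\<integral>x. partial_deriv k f x * g x \<partial>leb_on d U)"
    using 0 by (subst (1 2) integral_leb_on[OF U]) (auto simp: eq_neg_iff_add_eq_0)
qed

section \<open>The fundamental lemma of the calculus of variations\<close>

definition plateau :: "nat \<Rightarrow> real \<Rightarrow> real \<Rightarrow> real \<Rightarrow> real" where
  "plateau m p q t = sstep (real m * (t - p)) * sstep (real m * (q - t))"

lemma smooth1_plateau: "smooth1 (plateau m p q)"
proof -
  have "smooth1 (\<lambda>t. sstep (real m * t + (- real m * p)) * sstep (- real m * t + real m * q))"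
    by (intro smooth1_mult smooth1_affine smooth1_sstep)
  then show ?thesis
    by (simp add: plateau_def[abs_def] algebra_simps)
qed

lemma plateau_outside:
  assumes "t \<notin> {p<..<q}"
  shows "plateau m p q t = 0"
proof -
  consider "t - p \<le> 0" | "q - t \<le> 0" using assms by force
  then show ?thesis
  proof cases
    case 1
    then have "sstep (real m * (t - p)) = 0" by (intro sstep_eq_0 mult_nonneg_nonpos) auto
    then show ?thesis by (simp add: plateau_def)
  next
    case 2
    then have "sstep (real m * (q - t)) = 0" by (intro sstep_eq_0 mult_nonneg_nonpos) auto
    then show ?thesis by (simp add: plateau_def)
  qed
qed

lemma plateau_bounds: "0 \<le> plateau m p q t" "plateau m p q t \<le> 1"
  unfolding plateau_def by (intro mult_nonneg_nonneg mult_le_one sstep_bounds)+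

text \<open>The two ramps of \<open>plateau m p q\<close> have length \<open>1 / m\<close> and lie
  inside the interval, so at a fixed interior point the value is eventually 1, while outside it is
  always 0.\<close>

lemma plateau_tendsto: "(\<lambda>m. plateau m p q t) \<longlonglongrightarrow> indicat_real {p<..<q} t"
proof (cases "t \<in> {p<..<q}")
  case True
  have ev: "eventually (\<lambda>m. real m * c \<ge> 1) sequentially" if "c > 0" for c
  proof -
    obtain N :: nat where "real N > 1 / c" using reals_Archimedean2 by blast
    then have "real m * c \<ge> 1" if "m \<ge> N" for m
    proof -
      have "1 < real N * c" using \<open>real N > 1 / c\<close> \<open>c > 0\<close> by (simp add: field_simps)
      also have "\<dots> \<le> real m * c" using that \<open>c > 0\<close> by (intro mult_right_mono) auto
      finally show ?thesis by simp
    qed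
    then show ?thesis by (auto simp: eventually_sequentially)
  qed
  have "eventually (\<lambda>m. plateau m p q t = 1) sequentially"
    using ev[of "t - p"] ev[of "q - t"] True
    by (auto simp: plateau_def sstep_eq_1 elim: eventually_elim2)
  then show ?thesis using True by (simp add: tendsto_eventually)
qed (simp add: plateau_outside)

text \<open>A square integrable function need not be integrable, but its product with the square
  integrable indicator of a bounded box is.\<close>

lemma L2_integrable_box:
  assumes U: "openin (euc d) U" and g: "g \<in> L2 d U" and sub: "Pi\<^sub>E {..<d} (\<lambda>i. {a i..b i}) \<subseteq> U"
  shows "integrable (leb_on d U) (\<lambda>x. indicator (obox d a b) x *\<^sub>R g x)"
proof -
  have "(\<lambda>x. indicator (obox d a b) x :: complex) \<in> L2 d U"
  proof -
    define R where "R = (\<Sum>i<d. \<bar>a i\<bar> + \<bar>b i\<bar>)"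
    have R: "\<bar>a i\<bar> + \<bar>b i\<bar> \<le> R" if "i < d" for i
      unfolding R_def using that by (intro member_le_sum) auto
    have R0: "R \<ge> 0" unfolding R_def by (intro sum_nonneg) auto
    show ?thesis
    proof (rule L2_bounded(1)[OF U _ R0, of _ 1])
      fix x i assume "i < d" "\<bar>x i\<bar> > R"
      with R[of i] have "x i \<notin> {a i<..<b i}" by auto
      with \<open>i < d\<close> have "x \<notin> obox d a b" unfolding obox_def PiE_iff by blast
      then show "indicator (obox d a b) x = (0 :: complex)" by simp
    qed (use sets_obox in \<open>auto simp: indicator_def\<close>)
  qed
  from L2_mult(1)[OF this g] show ?thesis
    by (rule back_subst[of "integrable (leb_on d U)"]) (auto simp: fun_eq_iff indicator_def)
qed

text \<open>Products of plateaus are test functions, because the closed box lies in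
  \<open>U\<close>. They converge pointwise to the indicator of the open box, and \<open>g\<close>
  cut off to the box dominates.\<close>

lemma integral_obox_eq_0:
  assumes U: "openin (euc d) U" and g: "g \<in> L2 d U"
    and test: "\<And>\<phi>. \<phi> \<in> test_funs d U \<Longrightarrow> (\<integral>x. g x * \<phi> x \<partial>leb_on d U) = 0"
    and sub: "Pi\<^sub>E {..<d} (\<lambda>i. {p i..q i}) \<subseteq> U"
  shows "(\<integral>x. indicator (obox d p q) x *\<^sub>R g x \<partial>leb_on d U) = 0"
proof -
  note [measurable] = L2D(1)[OF g]
  define \<phi> where "\<phi> m = ctensor d (\<lambda>i. plateau m (p i) (q i))" for m
  have \<phi>: "\<phi> m \<in> test_funs d U" for m
    unfolding \<phi>_def
    by (rule test_funs_ctensor[OF smooth1_plateau sub]) (auto intro!: plateau_outside)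
  have [measurable]: "\<phi> m \<in> borel_measurable (leb_on d U)" for m
    using L2D(1)[OF test_funs_L2[OF U \<phi>]] .
  have ind: "indicator (obox d p q) x = (\<Prod>i<d. indicat_real {p i<..<q i} (x i))" if "x \<in> U" for x
  proof (cases "x \<in> obox d p q")
    case True
    then show ?thesis by (auto simp: obox_def PiE_iff)
  next
    case False
    have "x \<in> topspace (euc d)" using openin_subset[OF U] that by auto
    with False obtain i where "i < d" "x i \<notin> {p i<..<q i}" by (auto simp: obox_def topspace_euc PiE_iff)
    then have "\<exists>i\<in>{..<d}. indicat_real {p i<..<q i} (x i) = 0"
      by (intro bexI[of _ i]) (simp_all add: indicator_def)
    then have "(\<Prod>i<d. indicat_real {p i<..<q i} (x i)) = 0" by (intro prod_zero) auto
    with False show ?thesis by simp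
  qed
  have lim: "(\<lambda>m. \<phi> m x) \<longlonglongrightarrow> of_real (indicator (obox d p q) x)" if "x \<in> U" for x
    unfolding ind[OF that] \<phi>_def ctensor_def by (intro tendsto_of_real tendsto_prod plateau_tendsto)
  have bd: "cmod (\<phi> m x) \<le> indicator (obox d p q) x" if "x \<in> U" for m x
  proof -
    have "cmod (\<phi> m x) = (\<Prod>i<d. plateau m (p i) (q i) (x i))"
      unfolding \<phi>_def ctensor_def norm_of_real by (intro abs_of_nonneg prod_nonneg) (auto simp: plateau_bounds)
    also have "\<dots> \<le> (\<Prod>i<d. indicat_real {p i<..<q i} (x i))"
    proof (intro prod_mono conjI plateau_bounds)
      fix i show "plateau m (p i) (q i) (x i) \<le> indicat_real {p i<..<q i} (x i)"
        by (cases "x i \<in> {p i<..<q i}") (simp_all add: plateau_bounds plateau_outside)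
    qed
    finally show ?thesis by (simp add: ind[OF that])
  qed
  have sp: "space (leb_on d U) = U" by (rule openin_sets_lebn[OF U])
  have "(\<lambda>m. \<integral>x. g x * \<phi> m x \<partial>leb_on d U) \<longlonglongrightarrow> (\<integral>x. indicator (obox d p q) x *\<^sub>R g x \<partial>leb_on d U)"
  proof (rule integral_dominated_convergence)
    have i: "integrable (leb_on d U) (\<lambda>x. indicator (obox d p q) x *\<^sub>R g x)"
      by (rule L2_integrable_box[OF U g sub])
    then show "integrable (leb_on d U) (\<lambda>x. norm (indicat_real (obox d p q) x *\<^sub>R g x))"
      by (rule integrable_norm)
    show "(\<lambda>x. indicator (obox d p q) x *\<^sub>R g x) \<in> borel_measurable (leb_on d U)"
      by (rule borel_measurable_integrable[OF i])
    show "AE x in leb_on d U. (\<lambda>m. g x * \<phi> m x) \<longlonglongrightarrow> indicator (obox d p q) x *\<^sub>R g x"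
    proof (rule AE_I2)
      fix x assume "x \<in> space (leb_on d U)"
      then have "(\<lambda>m. g x * \<phi> m x) \<longlonglongrightarrow> g x * of_real (indicator (obox d p q) x)"
        using sp by (intro tendsto_mult tendsto_const lim) auto
      then show "(\<lambda>m. g x * \<phi> m x) \<longlonglongrightarrow> indicator (obox d p q) x *\<^sub>R g x"
        by (simp add: scaleR_conv_of_real mult.commute)
    qed
    show "AE x in leb_on d U. norm (g x * \<phi> m x) \<le> norm (indicat_real (obox d p q) x *\<^sub>R g x)" for m
    proof (rule AE_I2)
      fix x assume "x \<in> space (leb_on d U)"
      then show "norm (g x * \<phi> m x) \<le> norm (indicat_real (obox d p q) x *\<^sub>R g x)"
        using mult_left_mono[OF bd[of x m] norm_ge_zero[of "g x"]] sp
        by (simp add: norm_mult mult.commute)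
    qed
  qed measurable
  then show ?thesis using test[OF \<phi>] by (simp add: LIMSEQ_const_iff)
qed

lemma obox_Int: "obox d a b \<inter> obox d p q = obox d (\<lambda>i. max (a i) (p i)) (\<lambda>i. min (b i) (q i))"
  unfolding obox_def PiE_Int by (rule PiE_cong) auto

lemma fundamental_lemma_box:
  assumes U: "openin (euc d) U" and g: "g \<in> L2 d U"
    and test: "\<And>\<phi>. \<phi> \<in> test_funs d U \<Longrightarrow> (\<integral>x. g x * \<phi> x \<partial>leb_on d U) = 0"
    and sub: "Pi\<^sub>E {..<d} (\<lambda>i. {a i..b i}) \<subseteq> U"
  shows "AE x in leb_on d U. x \<in> obox d a b \<longrightarrow> g x = 0"
proof -
  let ?M = "leb_on d U"
  \<comment> \<open>Restricting to the box gives an integrable function, to which countable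
    additivity applies.\<close>
  define h where "h x = indicator (obox d a b) x *\<^sub>R g x" for x
  have h: "integrable ?M h" unfolding h_def by (rule L2_integrable_box[OF U g sub])
  have setsM: "A \<in> sets (lebn d)" if "A \<in> sets ?M" for A
    using that openin_sets_lebn[OF U] by (auto simp: leb_on_def sets_restrict_space)
  have AM: "A \<inter> U \<in> sets ?M" if "A \<in> sets (lebn d)" for A
    using that by (auto simp: leb_on_def sets_restrict_space Int_commute)
  have sp: "space ?M = U" by (rule openin_sets_lebn[OF U])
  have ih: "set_integrable ?M (A \<inter> U) h" if "A \<in> sets (lebn d)" for A
    unfolding set_integrable_def by (rule integrable_mult_indicator[OF AM[OF that] h])
  have hb: "(\<integral>x. indicator (obox d p q \<inter> U) x *\<^sub>R h x \<partial>?M) = 0" for p q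
  proof -
    let ?p = "\<lambda>i. max (p i) (a i)" and ?q = "\<lambda>i. min (q i) (b i)"
    have "Pi\<^sub>E {..<d} (\<lambda>i. {?p i..?q i}) \<subseteq> U" using sub by (auto simp: PiE_iff subset_iff)
    from integral_obox_eq_0[OF U g test this]
    have 0: "(\<integral>x. indicator (obox d ?p ?q) x *\<^sub>R g x \<partial>?M) = 0" by blast
    have "(\<integral>x. indicator (obox d p q \<inter> U) x *\<^sub>R h x \<partial>?M) =
        (\<integral>x. indicator (obox d ?p ?q) x *\<^sub>R g x \<partial>?M)"
      by (rule Bochner_Integration.integral_cong[OF refl])
        (auto simp: h_def obox_Int[symmetric] indicator_def sp)
    with 0 show ?thesis by simp
  qed
  have P: "(\<integral>x. indicator (A \<inter> U) x *\<^sub>R h x \<partial>?M) = 0" if "A \<in> sets (lebn d)" for A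
  \<comment> \<open>Dynkin induction from the open boxes, which are stable under intersection, to
    all measurable sets.\<close>
  proof -
    have "Int_stable (range (\<lambda>(a, b). obox d a b))"
    proof (rule Int_stableI)
      have "obox d p q \<in> range (\<lambda>(a, b). obox d a b)" for p q by (rule range_eqI[of _ _ "(p, q)"]) simp
      then show "A \<inter> B \<in> range (\<lambda>(a, b). obox d a b)"
        if "A \<in> range (\<lambda>(a, b). obox d a b)" "B \<in> range (\<lambda>(a, b). obox d a b)" for A B
        using that by (auto simp: obox_Int)
    qed
    moreover have "range (\<lambda>(a, b). obox d a b) \<subseteq> Pow (topspace (euc d))"
      by (auto simp: obox_def topspace_euc)
    moreover have "A \<in> sigma_sets (topspace (euc d)) (range (\<lambda>(a, b). obox d a b))"
      using that unfolding sets_PiM_oboxes .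
    ultimately show ?thesis
    proof (induction A rule: sigma_sets_induct_disjoint)
      case (basic A)
      then show ?case using hb by auto
    next
      case empty
      then show ?case by simp
    next
      case (compl A)
      have A: "A \<in> sets (lebn d)" using compl(1) unfolding sets_PiM_oboxes .
      have "(\<integral>x. indicator ((topspace (euc d) - A) \<inter> U) x *\<^sub>R h x \<partial>?M) =
          (\<integral>x. h x - indicator (A \<inter> U) x *\<^sub>R h x \<partial>?M)"
        using openin_subset[OF U]
        by (intro Bochner_Integration.integral_cong[OF refl]) (auto simp: indicator_def sp)
      also have "\<dots> = (\<integral>x. h x \<partial>?M) - (\<integral>x. indicator (A \<inter> U) x *\<^sub>R h x \<partial>?M)"
        using ih[OF A] h by (simp add: set_integrable_def)
      \<comment> \<open>The total integral of \<open>h\<close> is itself an integral over a box,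
        hence zero; this settles complements.\<close>
      also have "(\<integral>x. h x \<partial>?M) = (\<integral>x. indicator (obox d a b \<inter> U) x *\<^sub>R h x \<partial>?M)"
        by (rule Bochner_Integration.integral_cong[OF refl]) (auto simp: h_def indicator_def sp)
      finally show ?case using compl(2) hb by simp
    next
      case (union A)
      have A: "A i \<in> sets (lebn d)" for i using union(2) unfolding sets_PiM_oboxes by blast
      have "(\<integral>x. indicator ((\<Union>i. A i) \<inter> U) x *\<^sub>R h x \<partial>?M) = (LINT x:(\<Union>i. A i \<inter> U)|?M. h x)"
        by (simp add: set_lebesgue_integral_def Int_UN_distrib2)
      also have "\<dots> = (\<Sum>i. (LINT x:(A i \<inter> U)|?M. h x))"
      proof (rule lebesgue_integral_countable_add[OF AM[OF A]])
        show "set_integrable ?M (\<Union>i. A i \<inter> U) h"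
          using ih[of "\<Union>i. A i"] A by (simp add: Int_UN_distrib2 sets.countable_UN)
        show "A i \<inter> U \<inter> (A j \<inter> U) = {}" if "i \<noteq> j" for i j
          using union(1) that by (auto simp: disjoint_family_on_def)
      qed
      also have "\<dots> = 0" using union(3) by (simp add: set_lebesgue_integral_def)
      finally show ?case .
    qed
  qed
  have P': "(\<integral>x. indicator A x *\<^sub>R h x \<partial>?M) = 0" if "A \<in> sets ?M" for A
    using P[OF setsM[OF that]] sets.sets_into_space[OF that] by (simp add: sp inf.absorb1)
  have ihA: "integrable ?M (\<lambda>x. indicator A x *\<^sub>R h x)" if "A \<in> sets ?M" for A
    by (rule integrable_mult_indicator[OF that h])
  have "AE x in ?M. Re (h x) = 0"
  proof (rule density_unique_real)
    show "(LINT x:A|?M. Re (h x)) = (LINT x:A|?M. 0)" if "A \<in> sets ?M" for A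
      using integral_Re[OF ihA[OF that]] P'[OF that] by (simp add: set_lebesgue_integral_def)
  qed (use h in auto)
  moreover have "AE x in ?M. Im (h x) = 0"
  proof (rule density_unique_real)
    show "(LINT x:A|?M. Im (h x)) = (LINT x:A|?M. 0)" if "A \<in> sets ?M" for A
      using integral_Im[OF ihA[OF that]] P'[OF that] by (simp add: set_lebesgue_integral_def)
  qed (use h in auto)
  ultimately show ?thesis
    by eventually_elim (auto simp: h_def complex_eq_iff)
qed

lemma fundamental_lemma:
  assumes U: "openin (euc d) U" and g: "g \<in> L2 d U"
    and test: "\<And>\<phi>. \<phi> \<in> test_funs d U \<Longrightarrow> (\<integral>x. g x * \<phi> x \<partial>leb_on d U) = 0"
  shows "AE x in leb_on d U. g x = 0"
proof -
  obtain B where B: "countable B" "\<Union>B = U"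
    "\<forall>Q\<in>B. \<exists>a b. Q = obox d a b \<and> Pi\<^sub>E {..<d} (\<lambda>i. {a i..b i}) \<subseteq> U"
    using openin_euc_countable_boxes[OF U] .
  have "AE x in leb_on d U. x \<in> Q \<longrightarrow> g x = 0" if "Q \<in> B" for Q
  proof -
    obtain a b where "Q = obox d a b" "Pi\<^sub>E {..<d} (\<lambda>i. {a i..b i}) \<subseteq> U"
      using bspec[OF B(3) \<open>Q \<in> B\<close>] by (elim exE conjE) (rule that)
    with fundamental_lemma_box[OF U g test, of a b] show ?thesis by simp
  qed
  then have "AE x in leb_on d U. \<forall>Q\<in>B. x \<in> Q \<longrightarrow> g x = 0"
    by (subst AE_ball_countable[OF B(1)]) blast
  then show ?thesis
    using AE_space[of "leb_on d U"]
    by eventually_elim (use B(2) in \<open>auto simp: openin_sets_lebn(3)[OF U]\<close>)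
qed

section \<open>Weak gradients and the space H01\<close>

lemma sqn_cong:
  assumes "openin (euc d) U" "\<And>x. x \<in> U \<Longrightarrow> f x = g x"
  shows "sqn d U f = sqn d U g"
  unfolding sqn_def
  by (rule Bochner_Integration.integral_cong) (auto simp: openin_sets_lebn(3)[OF assms(1)] assms(2))

text \<open>The difference of two weak derivatives is orthogonal to every test function.\<close>

lemma weak_deriv_AE_unique:
  assumes U: "openin (euc d) U" and g: "g \<in> L2 d U" "is_weak_deriv d U k f g"
    and h: "h \<in> L2 d U" "is_weak_deriv d U k f h"
  shows "AE x in leb_on d U. g x = h x"
proof -
  have "AE x in leb_on d U. g x - h x = 0"
  proof (rule fundamental_lemma[OF U L2_diff(1)[OF g(1) h(1)]])
    fix \<phi> assume \<phi>: "\<phi> \<in> test_funs d U"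
    note i = L2_mult(1)[OF g(1) test_funs_L2[OF U \<phi>]] L2_mult(1)[OF h(1) test_funs_L2[OF U \<phi>]]
    have "(\<integral>x. (g x - h x) * \<phi> x \<partial>leb_on d U) =
        (\<integral>x. g x * \<phi> x \<partial>leb_on d U) - (\<integral>x. h x * \<phi> x \<partial>leb_on d U)"
      using i by (simp add: left_diff_distrib)
    also have "\<dots> = 0" using g(2) h(2) \<phi> by (simp add: is_weak_deriv_def)
    finally show "(\<integral>x. (g x - h x) * \<phi> x \<partial>leb_on d U) = 0" .
  qed
  then show ?thesis by simp
qed

lemma is_weak_deriv_lincomb:
  assumes U: "openin (euc d) U" and k: "k < d"
    and f: "f \<in> L2 d U" "g \<in> L2 d U" "is_weak_deriv d U k f g"
    and f': "f' \<in> L2 d U" "g' \<in> L2 d U" "is_weak_deriv d U k f' g'"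
  shows "is_weak_deriv d U k (\<lambda>x. a * f x + b * f' x) (\<lambda>x. a * g x + b * g' x)"
  unfolding is_weak_deriv_def
proof
  fix \<phi> assume \<phi>: "\<phi> \<in> test_funs d U"
  note L = test_funs_L2[OF U \<phi>] test_funs_L2[OF U test_funs_partial[OF \<phi> k]]
  have lin: "(\<integral>x. (a * u x + b * v x) * w x \<partial>leb_on d U) =
      a * (\<integral>x. u x * w x \<partial>leb_on d U) + b * (\<integral>x. v x * w x \<partial>leb_on d U)"
    if "u \<in> L2 d U" "v \<in> L2 d U" "w \<in> L2 d U" for u v w
    using L2_mult(1)[OF that(1,3)] L2_mult(1)[OF that(2,3)] by (simp add: distrib_right mult.assoc)
  show "(\<integral>x. (a * f x + b * f' x) * partial_deriv k \<phi> x \<partial>leb_on d U) =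
      - (\<integral>x. (a * g x + b * g' x) * \<phi> x \<partial>leb_on d U)"
    using f(3) f'(3) \<phi> by (simp add: lin f f' L is_weak_deriv_def)
qed

text \<open>Whatever representative \<open>weak_deriv\<close> picks, its squared norm is that of any
  known weak derivative, and the Sobolev norm sees nothing else.\<close>

lemma weak_deriv_properties:
  assumes U: "openin (euc d) U" and g: "g \<in> L2 d U" "is_weak_deriv d U k f g"
  shows "weak_deriv d U k f \<in> L2 d U" "is_weak_deriv d U k f (weak_deriv d U k f)"
    "sqn d U (weak_deriv d U k f) = sqn d U g"
proof -
  have *: "weak_deriv d U k f \<in> L2 d U \<and> is_weak_deriv d U k f (weak_deriv d U k f)"
    unfolding weak_deriv_def by (rule someI[of _ g]) (use g in simp)
  then show "weak_deriv d U k f \<in> L2 d U" "is_weak_deriv d U k f (weak_deriv d U k f)" by auto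
  from * g have "AE x in leb_on d U. weak_deriv d U k f x = g x"
    by (intro weak_deriv_AE_unique[OF U]) auto
  then show "sqn d U (weak_deriv d U k f) = sqn d U g"
    using * g L2D(1) by (intro L2_cong_AE(2)) auto
qed

text \<open>Derivatives carried as explicit data: linear combinations act on them directly, and the
  choice in \<open>weak_deriv\<close> only enters through \<open>H1_norm_weak_grad\<close>.\<close>

definition weak_grad :: "nat \<Rightarrow> (nat \<Rightarrow> real) set \<Rightarrow> cfun \<Rightarrow> (nat \<Rightarrow> cfun) \<Rightarrow> bool" where
  "weak_grad d U f G \<longleftrightarrow> f \<in> L2 d U \<and> (\<forall>k<d. G k \<in> L2 d U \<and> is_weak_deriv d U k f (G k))"

lemma H1_iff_weak_grad: "f \<in> H1 d U \<longleftrightarrow> (\<exists>G. weak_grad d U f G)"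
proof
  assume f: "f \<in> H1 d U"
  then have "\<forall>k. \<exists>g. k < d \<longrightarrow> g \<in> L2 d U \<and> is_weak_deriv d U k f g"
    by (auto simp: H1_def)
  from choice[OF this] f show "\<exists>G. weak_grad d U f G"
    by (auto simp: weak_grad_def H1_def)
qed (auto simp: weak_grad_def H1_def)

lemma weak_grad_lincomb:
  assumes "openin (euc d) U" "weak_grad d U f G" "weak_grad d U f' G'"
  shows "weak_grad d U (\<lambda>x. a * f x + b * f' x) (\<lambda>k x. a * G k x + b * G' k x)"
  using assms by (auto simp: weak_grad_def intro!: L2_add(1) L2_scale(1) is_weak_deriv_lincomb)

lemma weak_grad_diff:
  assumes "openin (euc d) U" "weak_grad d U f G" "weak_grad d U f' G'"
  shows "weak_grad d U (\<lambda>x. f x - f' x) (\<lambda>k x. G k x - G' k x)"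
  using weak_grad_lincomb[OF assms, of 1 "-1"] by simp

lemma test_funs_weak_grad:
  assumes "openin (euc d) U" "f \<in> test_funs d U"
  shows "weak_grad d U f (\<lambda>k. partial_deriv k f)"
  unfolding weak_grad_def
  using test_funs_L2[OF assms] test_funs_L2[OF assms(1) test_funs_partial[OF assms(2)]]
    test_funs_weak_deriv[OF assms] by simp

lemma H1_norm_weak_grad:
  assumes U: "openin (euc d) U" and G: "weak_grad d U f G"
  shows "H1_norm d U f = sqrt (sqn d U f + (\<Sum>k<d. sqn d U (G k)))"
proof -
  have "(\<Sum>k<d. sqn d U (weak_deriv d U k f)) = (\<Sum>k<d. sqn d U (G k))"
    using G by (intro sum.cong weak_deriv_properties(3)[OF U]) (auto simp: weak_grad_def)
  then show ?thesis
    by (simp add: H1_norm_def grad_form_def L2_inner_self flip: of_real_sum)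
qed

lemma H1_norm_less_iff:
  assumes "openin (euc d) U" "weak_grad d U f G" "\<epsilon> > 0"
  shows "H1_norm d U f < \<epsilon> \<longleftrightarrow> sqn d U f + (\<Sum>k<d. sqn d U (G k)) < \<epsilon>\<^sup>2"
  unfolding H1_norm_weak_grad[OF assms(1,2)]
  using assms(3) by (metis abs_of_pos real_sqrt_abs real_sqrt_less_iff)

text \<open>
  Membership in \<open>H01\<close> without the choice made in \<^const>\<open>weak_deriv\<close>: the functions \<open>G k\<close> need not be
  known to be weak derivatives of \<open>f\<close>, the approximation forces this.
\<close>

definition test_approx :: "nat \<Rightarrow> (nat \<Rightarrow> real) set \<Rightarrow> cfun \<Rightarrow> (nat \<Rightarrow> cfun) \<Rightarrow> bool" where
  "test_approx d U f G \<longleftrightarrow> f \<in> L2 d U \<and> (\<forall>k<d. G k \<in> L2 d U) \<and>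
    (\<forall>\<epsilon>>0. \<exists>\<phi>\<in>test_funs d U. sqn d U (\<lambda>x. f x - \<phi> x) < \<epsilon> \<and>
      (\<forall>k<d. sqn d U (\<lambda>x. G k x - partial_deriv k \<phi> x) < \<epsilon>))"

text \<open>Integration by parts holds for the approximating test functions, and both of its sides
  are continuous in the square norm for a fixed \<zeta>.\<close>

lemma test_approx_weak_deriv:
  assumes U: "openin (euc d) U" and a: "test_approx d U f G" and k: "k < d"
  shows "is_weak_deriv d U k f (G k)"
  unfolding is_weak_deriv_def
proof
  fix \<zeta> assume \<zeta>: "\<zeta> \<in> test_funs d U"
  let ?I = "\<lambda>u v. (\<integral>x. u x * v x \<partial>leb_on d U)"
  have L: "\<zeta> \<in> L2 d U" "partial_deriv k \<zeta> \<in> L2 d U"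
    using test_funs_L2[OF U \<zeta>] test_funs_L2[OF U test_funs_partial[OF \<zeta> k]] by auto
  have f: "f \<in> L2 d U" and G: "G k \<in> L2 d U" using a k by (auto simp: test_approx_def)
  have "cmod (?I f (partial_deriv k \<zeta>) + ?I (G k) \<zeta>) < \<eta>" if \<eta>: "\<eta> > 0" for \<eta>
  proof -
    obtain e1 where e1: "e1 > 0"
      "\<forall>u\<in>L2 d U. sqn d U u < e1 \<longrightarrow> cmod (?I u (partial_deriv k \<zeta>)) < \<eta> / 2"
      by (rule L2_pairing_continuous[OF L(2), of "\<eta> / 2"]) (use \<eta> in auto)
    obtain e2 where e2: "e2 > 0"
      "\<forall>u\<in>L2 d U. sqn d U u < e2 \<longrightarrow> cmod (?I u \<zeta>) < \<eta> / 2"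
      by (rule L2_pairing_continuous[OF L(1), of "\<eta> / 2"]) (use \<eta> in auto)
    have "min e1 e2 > 0" using e1 e2 by simp
    then obtain \<phi> where \<phi>: "\<phi> \<in> test_funs d U" "sqn d U (\<lambda>x. f x - \<phi> x) < min e1 e2"
      "sqn d U (\<lambda>x. G k x - partial_deriv k \<phi> x) < min e1 e2"
      using a k unfolding test_approx_def by metis
    have L': "\<phi> \<in> L2 d U" "partial_deriv k \<phi> \<in> L2 d U"
      using test_funs_L2[OF U \<phi>(1)] test_funs_L2[OF U test_funs_partial[OF \<phi>(1) k]] by auto
    have 1: "?I (\<lambda>x. f x - \<phi> x) (partial_deriv k \<zeta>) = ?I f (partial_deriv k \<zeta>) - ?I \<phi> (partial_deriv k \<zeta>)"
      using L2_mult(1)[OF f L(2)] L2_mult(1)[OF L'(1) L(2)] by (simp add: left_diff_distrib)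
    have 2: "?I (\<lambda>x. G k x - partial_deriv k \<phi> x) \<zeta> = ?I (G k) \<zeta> - ?I (partial_deriv k \<phi>) \<zeta>"
      using L2_mult(1)[OF G L(1)] L2_mult(1)[OF L'(2) L(1)] by (simp add: left_diff_distrib)
    have "?I \<phi> (partial_deriv k \<zeta>) = - ?I (partial_deriv k \<phi>) \<zeta>"
      using test_funs_weak_deriv[OF U \<phi>(1) k] \<zeta> by (simp add: is_weak_deriv_def)
    then have "?I f (partial_deriv k \<zeta>) + ?I (G k) \<zeta> =
        ?I (\<lambda>x. f x - \<phi> x) (partial_deriv k \<zeta>) + ?I (\<lambda>x. G k x - partial_deriv k \<phi> x) \<zeta>"
      unfolding 1 2 by simp
    moreover have "cmod (?I (\<lambda>x. f x - \<phi> x) (partial_deriv k \<zeta>)) < \<eta> / 2"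
      using e1(2)[rule_format, OF L2_diff(1)[OF f L'(1)]] \<phi>(2) by simp
    moreover have "cmod (?I (\<lambda>x. G k x - partial_deriv k \<phi> x) \<zeta>) < \<eta> / 2"
      using e2(2)[rule_format, OF L2_diff(1)[OF G L'(2)]] \<phi>(3) by simp
    ultimately show ?thesis
      using norm_triangle_ineq[of "?I (\<lambda>x. f x - \<phi> x) (partial_deriv k \<zeta>)"
          "?I (\<lambda>x. G k x - partial_deriv k \<phi> x) \<zeta>"] by simp
  qed
  then have "cmod (?I f (partial_deriv k \<zeta>) + ?I (G k) \<zeta>) \<le> 0"
    by (meson less_irrefl not_le)
  then show "?I f (partial_deriv k \<zeta>) = - ?I (G k) \<zeta>" by (simp add: eq_neg_iff_add_eq_0)
qed

lemma test_approx_weak_grad: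
  assumes "openin (euc d) U" "test_approx d U f G"
  shows "weak_grad d U f G"
  using assms test_approx_weak_deriv[OF assms] by (auto simp: weak_grad_def test_approx_def)

lemma sum_less_bound:
  fixes f :: "nat \<Rightarrow> real"
  assumes "c < e" "\<forall>k<d. f k < e" "e > 0"
  shows "c + (\<Sum>k<d. f k) < (real d + 1) * e"
proof -
  have "(\<Sum>k<d. f k) \<le> (\<Sum>k<d. e)" using assms(2) by (intro sum_mono) (auto intro: less_imp_le)
  with assms(1) show ?thesis by (simp add: distrib_right)
qed

lemma H01_iff_test_approx:
  assumes U: "openin (euc d) U"
  shows "f \<in> H01 d U \<longleftrightarrow> (\<exists>G. test_approx d U f G)"
proof
  assume f: "f \<in> H01 d U"
  then obtain G where G: "weak_grad d U f G"
    by (auto simp: H01_def H1_closure_def H1_iff_weak_grad)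
  have "\<exists>\<phi>\<in>test_funs d U. sqn d U (\<lambda>x. f x - \<phi> x) < \<epsilon> \<and>
      (\<forall>k<d. sqn d U (\<lambda>x. G k x - partial_deriv k \<phi> x) < \<epsilon>)" if "\<epsilon> > 0" for \<epsilon>
  proof -
    have "sqrt \<epsilon> > 0" using that by simp
    then obtain \<phi> where \<phi>: "\<phi> \<in> test_funs d U" "H1_norm d U (\<lambda>x. f x - \<phi> x) < sqrt \<epsilon>"
      using f unfolding H01_def H1_closure_def by blast
    have w: "weak_grad d U (\<lambda>x. f x - \<phi> x) (\<lambda>k x. G k x - partial_deriv k \<phi> x)"
      by (rule weak_grad_diff[OF U G test_funs_weak_grad[OF U \<phi>(1)]])
    let ?s = "\<lambda>k. sqn d U (\<lambda>x. G k x - partial_deriv k \<phi> x)"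
    have less: "sqn d U (\<lambda>x. f x - \<phi> x) + (\<Sum>k<d. ?s k) < \<epsilon>"
      using \<phi>(2) H1_norm_less_iff[OF U w \<open>sqrt \<epsilon> > 0\<close>] that by simp
    have "0 \<le> (\<Sum>k<d. ?s k)" by (intro sum_nonneg sqn_nonneg)
    moreover have "?s k \<le> (\<Sum>k<d. ?s k)" if "k < d" for k
      using that by (intro member_le_sum) (auto simp: sqn_nonneg)
    moreover note less sqn_nonneg[of d U "\<lambda>x. f x - \<phi> x"]
    ultimately have "sqn d U (\<lambda>x. f x - \<phi> x) < \<epsilon>" "\<forall>k<d. ?s k < \<epsilon>"
      by fastforce+
    with \<phi>(1) show ?thesis by blast
  qed
  with G show "\<exists>G. test_approx d U f G" unfolding test_approx_def weak_grad_def by blast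
next
  assume "\<exists>G. test_approx d U f G"
  then obtain G where G: "test_approx d U f G" by blast
  note w = test_approx_weak_grad[OF U G]
  have "\<exists>\<phi>\<in>test_funs d U. H1_norm d U (\<lambda>x. f x - \<phi> x) < \<epsilon>" if e: "\<epsilon> > 0" for \<epsilon>
  proof -
    \<comment> \<open>The squared Sobolev norm collects \<open>d + 1\<close> squares, each below
      this share.\<close>
    have "\<epsilon>\<^sup>2 / (real d + 1) > 0" using e by simp
    then obtain \<phi> where \<phi>: "\<phi> \<in> test_funs d U" "sqn d U (\<lambda>x. f x - \<phi> x) < \<epsilon>\<^sup>2 / (real d + 1)"
      "\<forall>k<d. sqn d U (\<lambda>x. G k x - partial_deriv k \<phi> x) < \<epsilon>\<^sup>2 / (real d + 1)"
      using G unfolding test_approx_def by blast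
    have "weak_grad d U (\<lambda>x. f x - \<phi> x) (\<lambda>k x. G k x - partial_deriv k \<phi> x)"
      by (rule weak_grad_diff[OF U w test_funs_weak_grad[OF U \<phi>(1)]])
    moreover have "(real d + 1) * (\<epsilon>\<^sup>2 / (real d + 1)) = \<epsilon>\<^sup>2" by simp
    ultimately show ?thesis
      using sum_less_bound[OF \<phi>(2,3)] \<phi>(1) e H1_norm_less_iff[OF U _ e] by force
  qed
  with w show "f \<in> H01 d U"
    unfolding H01_def H1_closure_def H1_iff_weak_grad by blast
qed

lemma test_funs_test_approx:
  assumes "openin (euc d) U" "f \<in> test_funs d U"
  shows "test_approx d U f (\<lambda>k. partial_deriv k f)"
proof -
  have "sqn d U (\<lambda>x. h x - h x) = 0" for h by (simp add: sqn_def)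
  then show ?thesis
    using assms(2) test_funs_weak_grad[OF assms]
    by (auto simp: test_approx_def weak_grad_def intro!: bexI[of _ f])
qed

lemma test_funs_subset_H01: "openin (euc d) U \<Longrightarrow> test_funs d U \<subseteq> H01 d U"
  using test_funs_test_approx H01_iff_test_approx by blast

lemma sqn_diff_trans:
  assumes "f \<in> L2 d U" "g \<in> L2 d U" "h \<in> L2 d U"
  shows "sqn d U (\<lambda>x. f x - h x) \<le> 2 * sqn d U (\<lambda>x. f x - g x) + 2 * sqn d U (\<lambda>x. g x - h x)"
  using L2_add(2)[OF L2_diff(1)[OF assms(1,2)] L2_diff(1)[OF assms(2,3)]] by simp

lemma sqn_lincomb_diff:
  assumes "f \<in> L2 d U" "f' \<in> L2 d U" "g \<in> L2 d U" "g' \<in> L2 d U"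
  shows "sqn d U (\<lambda>x. (a * f x + b * f' x) - (a * g x + b * g' x)) \<le>
    2 * (cmod a)\<^sup>2 * sqn d U (\<lambda>x. f x - g x) + 2 * (cmod b)\<^sup>2 * sqn d U (\<lambda>x. f' x - g' x)"
proof -
  have "(\<lambda>x. (a * f x + b * f' x) - (a * g x + b * g' x)) = (\<lambda>x. a * (f x - g x) + b * (f' x - g' x))"
    by (simp add: algebra_simps)
  then show ?thesis
    using L2_add(2)[OF L2_scale(1)[OF L2_diff(1)[OF assms(1,3)]] L2_scale(1)[OF L2_diff(1)[OF assms(2,4)]], of a b]
    by (simp add: L2_scale(2) L2_diff(1) assms)
qed

lemma H01_lincomb:
  assumes U: "openin (euc d) U" and "f \<in> H01 d U" "f' \<in> H01 d U"
  shows "(\<lambda>x. a * f x + b * f' x) \<in> H01 d U"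
proof -
  obtain G G' where G: "test_approx d U f G" "test_approx d U f' G'"
    using assms by (auto simp: H01_iff_test_approx)
  define H where "H = (\<lambda>k x. a * G k x + b * G' k x)"
  \<comment> \<open>The summand 1 makes \<open>C\<close> positive even for \<open>a = b = 0\<close>,
    and the gap between \<open>C - 1\<close> and \<open>C\<close> yields the strict
    inequality.\<close>
  define C where "C = 2 * (cmod a)\<^sup>2 + 2 * (cmod b)\<^sup>2 + 1"
  have C: "C > 0" by (simp add: C_def add_nonneg_pos)
  have "test_approx d U (\<lambda>x. a * f x + b * f' x) H"
    unfolding test_approx_def
  proof (intro conjI allI impI)
    show "(\<lambda>x. a * f x + b * f' x) \<in> L2 d U"
      using G by (intro L2_add(1) L2_scale(1)) (auto simp: test_approx_def)
    show "H k \<in> L2 d U" if "k < d" for k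
      unfolding H_def using G that by (intro L2_add(1) L2_scale(1)) (auto simp: test_approx_def)
    fix \<epsilon> :: real assume "\<epsilon> > 0"
    then have e: "\<epsilon> / C > 0" using C by simp
    obtain \<phi> where \<phi>: "\<phi> \<in> test_funs d U" "sqn d U (\<lambda>x. f x - \<phi> x) < \<epsilon> / C"
      "\<And>k. k < d \<Longrightarrow> sqn d U (\<lambda>x. G k x - partial_deriv k \<phi> x) < \<epsilon> / C"
      using G(1) e unfolding test_approx_def by blast
    obtain \<psi> where \<psi>: "\<psi> \<in> test_funs d U" "sqn d U (\<lambda>x. f' x - \<psi> x) < \<epsilon> / C"
      "\<And>k. k < d \<Longrightarrow> sqn d U (\<lambda>x. G' k x - partial_deriv k \<psi> x) < \<epsilon> / C"
      using G(2) e unfolding test_approx_def by blast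
    have le: "2 * (cmod a)\<^sup>2 * s + 2 * (cmod b)\<^sup>2 * t < \<epsilon>" if "s < \<epsilon> / C" "t < \<epsilon> / C" for s t
    proof -
      have "2 * (cmod a)\<^sup>2 * s + 2 * (cmod b)\<^sup>2 * t \<le> 2 * (cmod a)\<^sup>2 * (\<epsilon> / C) + 2 * (cmod b)\<^sup>2 * (\<epsilon> / C)"
        using that by (intro add_mono mult_left_mono) auto
      also have "\<dots> = (2 * (cmod a)\<^sup>2 + 2 * (cmod b)\<^sup>2) * (\<epsilon> / C)" by (simp only: distrib_right)
      also have "\<dots> = (C - 1) * (\<epsilon> / C)" by (simp only: C_def add_diff_cancel_right')
      also have "\<dots> < C * (\<epsilon> / C)" using e by (intro mult_strict_right_mono) auto
      also have "\<dots> = \<epsilon>" using C by simp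
      finally show ?thesis .
    qed
    let ?\<zeta> = "\<lambda>x. a * \<phi> x + b * \<psi> x"
    show "\<exists>\<zeta>\<in>test_funs d U. sqn d U (\<lambda>x. (a * f x + b * f' x) - \<zeta> x) < \<epsilon> \<and>
        (\<forall>k<d. sqn d U (\<lambda>x. H k x - partial_deriv k \<zeta> x) < \<epsilon>)"
    proof (intro bexI[of _ ?\<zeta>] conjI allI impI)
      show "?\<zeta> \<in> test_funs d U" by (rule test_funs_lincomb) fact+
      show "sqn d U (\<lambda>x. (a * f x + b * f' x) - ?\<zeta> x) < \<epsilon>"
        using G \<phi>(1) \<psi>(1)
        by (intro le_less_trans[OF sqn_lincomb_diff le[OF \<phi>(2) \<psi>(2)]])
          (auto simp: test_approx_def intro: test_funs_L2[OF U])
      fix k assume k: "k < d"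
      have "sqn d U (\<lambda>x. H k x - partial_deriv k ?\<zeta> x) =
          sqn d U (\<lambda>x. H k x - (a * partial_deriv k \<phi> x + b * partial_deriv k \<psi> x))"
        using openin_subset[OF U] k test_funsD(1)[OF \<phi>(1)] test_funsD(1)[OF \<psi>(1)]
        by (intro sqn_cong[OF U] arg_cong2[of _ _ _ _ "(-)"] smooth_lincomb(2)) auto
      also have "\<dots> < \<epsilon>"
        unfolding H_def
        using G k \<phi>(1) \<psi>(1)
        by (intro le_less_trans[OF sqn_lincomb_diff le[OF \<phi>(3)[OF k] \<psi>(3)[OF k]]])
          (auto simp: test_approx_def intro!: test_funs_L2[OF U] test_funs_partial)
      finally show "sqn d U (\<lambda>x. H k x - partial_deriv k ?\<zeta> x) < \<epsilon>" .
    qed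
  qed
  with U show ?thesis by (auto simp: H01_iff_test_approx)
qed

lemma cspan_subset_H01:
  assumes U: "openin (euc d) U" and S: "S \<subseteq> H01 d U"
  shows "cspan S \<subseteq> H01 d U"
proof
  fix F assume "F \<in> cspan S"
  then obtain A c where F: "F = (\<lambda>x. \<Sum>s\<in>A. c s * s x)" and A: "finite A" "A \<subseteq> S"
    by (auto simp: cspan_def)
  have z: "(\<lambda>x. 0) \<in> H01 d U"
    using zero_in_test_funs test_funs_subset_H01[OF U] by blast
  have "(\<lambda>x. \<Sum>s\<in>A. c s * s x) \<in> H01 d U"
    using A
  proof (induction A rule: finite_induct)
    case (insert s A)
    then have "(\<lambda>x. c s * s x + 1 * (\<Sum>s\<in>A. c s * s x)) \<in> H01 d U"
      using S by (intro H01_lincomb[OF U, of s "\<lambda>x. \<Sum>s\<in>A. c s * s x"]) auto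
    with insert show ?case by simp
  qed (simp add: z)
  with F show "F \<in> H01 d U" by simp
qed

text \<open>Summing the inequality with factors 2 over the function and its derivatives suffices:
  two halves give \<open>4 * (\<epsilon> / 2)\<^sup>2 = \<epsilon>\<^sup>2\<close>.\<close>

lemma H1_norm_diff_trans:
  assumes U: "openin (euc d) U" and "f \<in> H1 d U" "g \<in> H1 d U" "h \<in> H1 d U" "\<epsilon> > 0"
    and "H1_norm d U (\<lambda>x. f x - g x) < \<epsilon> / 2" "H1_norm d U (\<lambda>x. g x - h x) < \<epsilon> / 2"
  shows "H1_norm d U (\<lambda>x. f x - h x) < \<epsilon>"
proof -
  obtain F G H where w: "weak_grad d U f F" "weak_grad d U g G" "weak_grad d U h H"
    using assms by (auto simp: H1_iff_weak_grad)
  note fg = weak_grad_diff[OF U w(1,2)] and gh = weak_grad_diff[OF U w(2,3)]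
    and fh = weak_grad_diff[OF U w(1,3)]
  have L: "f \<in> L2 d U" "g \<in> L2 d U" "h \<in> L2 d U"
    "\<And>k. k < d \<Longrightarrow> F k \<in> L2 d U" "\<And>k. k < d \<Longrightarrow> G k \<in> L2 d U" "\<And>k. k < d \<Longrightarrow> H k \<in> L2 d U"
    using w by (auto simp: weak_grad_def)
  have e: "\<epsilon> / 2 > 0" using assms by simp
  let ?a = "sqn d U (\<lambda>x. f x - g x) + (\<Sum>k<d. sqn d U (\<lambda>x. F k x - G k x))"
  let ?b = "sqn d U (\<lambda>x. g x - h x) + (\<Sum>k<d. sqn d U (\<lambda>x. G k x - H k x))"
  have "sqn d U (\<lambda>x. f x - h x) + (\<Sum>k<d. sqn d U (\<lambda>x. F k x - H k x)) \<le>
      (2 * sqn d U (\<lambda>x. f x - g x) + 2 * sqn d U (\<lambda>x. g x - h x)) +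
      (\<Sum>k<d. 2 * sqn d U (\<lambda>x. F k x - G k x) + 2 * sqn d U (\<lambda>x. G k x - H k x))"
    by (intro add_mono sum_mono sqn_diff_trans L) auto
  also have "\<dots> = 2 * ?a + 2 * ?b" by (simp add: sum.distrib sum_distrib_left)
  also have "\<dots> < 2 * (\<epsilon> / 2)\<^sup>2 + 2 * (\<epsilon> / 2)\<^sup>2"
    using assms(6,7) H1_norm_less_iff[OF U fg e] H1_norm_less_iff[OF U gh e]
    by (intro add_strict_mono) auto
  also have "\<dots> = \<epsilon>\<^sup>2" by (simp add: power2_eq_square)
  finally show ?thesis using H1_norm_less_iff[OF U fh assms(5)] by simp
qed

text \<open>Since \<open>H01\<close> is itself a closure, approximating an approximant by test
  functions costs only half of \<epsilon> once more.\<close>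

lemma H1_closure_subset_H01:
  assumes U: "openin (euc d) U" and S: "S \<subseteq> H01 d U"
  shows "H1_closure d U S \<subseteq> H01 d U"
proof
  fix f assume f: "f \<in> H1_closure d U S"
  have H1: "H01 d U \<subseteq> H1 d U" by (auto simp: H01_def H1_closure_def)
  have "\<exists>\<phi>\<in>test_funs d U. H1_norm d U (\<lambda>x. f x - \<phi> x) < \<epsilon>" if e: "\<epsilon> > 0" for \<epsilon>
  proof -
    have "\<epsilon> / 2 > 0" using e by simp
    then obtain g where g: "g \<in> S" "H1_norm d U (\<lambda>x. f x - g x) < \<epsilon> / 2"
      using f unfolding H1_closure_def by blast
    with S have "g \<in> H01 d U" by blast
    with \<open>\<epsilon> / 2 > 0\<close> obtain \<phi> where \<phi>: "\<phi> \<in> test_funs d U" "H1_norm d U (\<lambda>x. g x - \<phi> x) < \<epsilon> / 2"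
      unfolding H01_def H1_closure_def by blast
    have "\<phi> \<in> H1 d U" using \<phi>(1) test_funs_subset_H01[OF U] H1 by blast
    moreover have "f \<in> H1 d U" "g \<in> H1 d U" using f g S H1 by (auto simp: H1_closure_def)
    ultimately have "H1_norm d U (\<lambda>x. f x - \<phi> x) < \<epsilon>"
      using H1_norm_diff_trans[OF U, of f g \<phi> \<epsilon>] g \<phi> e by simp
    with \<phi>(1) show ?thesis by blast
  qed
  with f show "f \<in> H01 d U" by (simp add: H01_def H1_closure_def)
qed

section \<open>Tensor products of two functions\<close>

text \<open>Glues two blocks into one point; splitting the result returns the blocks. It transports
  the product of two Lebesgue measures to the concatenated coordinates, where Tonelli is
  needed.\<close>

definition join :: "nat \<Rightarrow> nat \<Rightarrow> (nat \<Rightarrow> real) \<times> (nat \<Rightarrow> real) \<Rightarrow> (nat \<Rightarrow> real)" where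
  "join a b = (\<lambda>(x, y). \<lambda>i\<in>{..<a + b}. if i < a then x i else y (i - a))"

lemma measurable_join: "join a b \<in> measurable (lebn a \<Otimes>\<^sub>M lebn b) (lebn (a + b))"
proof -
  have "(\<lambda>p. \<lambda>i\<in>{..<a + b}. if i < a then fst p i else snd p (i - a))
      \<in> measurable (lebn a \<Otimes>\<^sub>M lebn b) (lebn (a + b))"
  proof (rule measurable_restrict)
    fix i assume i: "i \<in> {..<a + b}"
    show "(\<lambda>p. if i < a then fst p i else snd p (i - a)) \<in> measurable (lebn a \<Otimes>\<^sub>M lebn b) lborel"
    proof (cases "i < a")
      case True
      then have "(\<lambda>x. x i) \<in> measurable (lebn a) lborel"
        by (intro measurable_component_singleton) auto
      from measurable_compose[OF measurable_fst this] True show ?thesis by simp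
    next
      case False
      then have "(\<lambda>x. x (i - a)) \<in> measurable (lebn b) lborel"
        using i by (intro measurable_component_singleton) auto
      from measurable_compose[OF measurable_snd this] False show ?thesis by simp
    qed
  qed
  then show ?thesis by (simp add: join_def case_prod_beta)
qed

lemma prod_lessThan_add:
  fixes f :: "nat \<Rightarrow> 'a :: comm_monoid_mult"
  shows "(\<Prod>i<a + b. f i) = (\<Prod>i<a. f i) * (\<Prod>i<b. f (a + i))"
  by (induction b) (simp_all add: mult.assoc)

text \<open>A product measure is determined by its values on measurable boxes, and the preimage of a
  box under \<open>join\<close> is the product of two boxes.\<close>

lemma distr_join: "distr (lebn a \<Otimes>\<^sub>M lebn b) (lebn (a + b)) (join a b) = lebn (a + b)"
proof (rule lborel_prod.PiM_eqI)
  fix A :: "nat \<Rightarrow> real set" assume A: "\<And>i. i \<in> {..<a + b} \<Longrightarrow> A i \<in> sets lborel"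
  interpret B: sigma_finite_measure "lebn b" by (rule lborel_prod.sigma_finite) simp
  have pre: "join a b -` Pi\<^sub>E {..<a + b} A \<inter> space (lebn a \<Otimes>\<^sub>M lebn b) =
      Pi\<^sub>E {..<a} A \<times> Pi\<^sub>E {..<b} (\<lambda>i. A (a + i))"
  proof (intro equalityI subsetI)
    fix p assume p: "p \<in> join a b -` Pi\<^sub>E {..<a + b} A \<inter> space (lebn a \<Otimes>\<^sub>M lebn b)"
    obtain x y where xy: "p = (x, y)" by (cases p)
    have sp: "x \<in> extensional {..<a}" "y \<in> extensional {..<b}"
      using p by (auto simp: xy space_pair_measure space_PiM PiE_iff)
    have j: "join a b (x, y) i \<in> A i" if "i < a + b" for i
      using p that by (auto simp: xy PiE_iff)
    have "x i \<in> A i" if "i < a" for i using j[of i] that by (simp add: join_def)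
    moreover have "y i \<in> A (a + i)" if "i < b" for i using j[of "a + i"] that by (simp add: join_def)
    ultimately show "p \<in> Pi\<^sub>E {..<a} A \<times> Pi\<^sub>E {..<b} (\<lambda>i. A (a + i))"
      using sp by (simp add: xy PiE_iff)
  next
    fix p assume p: "p \<in> Pi\<^sub>E {..<a} A \<times> Pi\<^sub>E {..<b} (\<lambda>i. A (a + i))"
    obtain x y where xy: "p = (x, y)" by (cases p)
    have x: "x i \<in> A i" if "i < a" for i using p that by (auto simp: xy PiE_iff)
    have y: "y i \<in> A (a + i)" if "i < b" for i using p that by (auto simp: xy PiE_iff)
    have "join a b (x, y) i \<in> A i" if "i < a + b" for i
      using x[of i] y[of "i - a"] that by (cases "i < a") (auto simp: join_def)
    then have "join a b (x, y) \<in> Pi\<^sub>E {..<a + b} A" by (auto simp: join_def)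
    with p show "p \<in> join a b -` Pi\<^sub>E {..<a + b} A \<inter> space (lebn a \<Otimes>\<^sub>M lebn b)"
      by (auto simp: xy space_pair_measure space_PiM PiE_iff)
  qed
  have s: "Pi\<^sub>E {..<a + b} A \<in> sets (lebn (a + b))" "Pi\<^sub>E {..<a} A \<in> sets (lebn a)"
    "Pi\<^sub>E {..<b} (\<lambda>i. A (a + i)) \<in> sets (lebn b)"
    using A by (auto intro!: sets_PiM_I_finite)
  have "emeasure (distr (lebn a \<Otimes>\<^sub>M lebn b) (lebn (a + b)) (join a b)) (Pi\<^sub>E {..<a + b} A) =
      emeasure (lebn a) (Pi\<^sub>E {..<a} A) * emeasure (lebn b) (Pi\<^sub>E {..<b} (\<lambda>i. A (a + i)))"
    by (simp only: emeasure_distr[OF measurable_join s(1)] pre B.emeasure_pair_measure_Times[OF s(2,3)])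
  also have "\<dots> = (\<Prod>i<a. emeasure lborel (A i)) * (\<Prod>i<b. emeasure lborel (A (a + i)))"
    using A by (intro arg_cong2[of _ _ _ _ "(*)"] lborel_prod.emeasure_PiM) auto
  also have "\<dots> = (\<Prod>i<a + b. emeasure lborel (A i))" by (simp add: prod_lessThan_add)
  finally show "emeasure (distr (lebn a \<Otimes>\<^sub>M lebn b) (lebn (a + b)) (join a b)) (Pi\<^sub>E {..<a + b} A) =
      (\<Prod>i<a + b. emeasure lborel (A i))" .
qed auto

lemma measurable_fst_blk: "fst_blk a \<in> measurable (lebn (a + b)) (lebn a)"
  unfolding fst_blk_def[abs_def] by (rule measurable_restrict_subset) auto

lemma measurable_snd_blk: "snd_blk a b \<in> measurable (lebn (a + b)) (lebn b)"
  unfolding snd_blk_def[abs_def] by (intro measurable_restrict measurable_component_singleton) auto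

lemma blk_join:
  assumes "x \<in> topspace (euc a)" "y \<in> topspace (euc b)"
  shows "fst_blk a (join a b (x, y)) = x" "snd_blk a b (join a b (x, y)) = y"
  using assms by (auto simp: fst_blk_def snd_blk_def join_def fun_eq_iff topspace_euc PiE_iff extensional_def)

lemma nn_integral_blk_mult:
  assumes f[measurable]: "f \<in> borel_measurable (lebn a)" and g[measurable]: "g \<in> borel_measurable (lebn b)"
  shows "(\<integral>\<^sup>+x. f (fst_blk a x) * g (snd_blk a b x) \<partial>lebn (a + b)) =
    (\<integral>\<^sup>+x. f x \<partial>lebn a) * (\<integral>\<^sup>+y. g y \<partial>lebn b)"
proof -
  interpret B: sigma_finite_measure "lebn b" by (rule lborel_prod.sigma_finite) simp
  note [measurable] = measurable_fst_blk measurable_snd_blk measurable_join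
  have "(\<integral>\<^sup>+x. f (fst_blk a x) * g (snd_blk a b x) \<partial>lebn (a + b)) =
      (\<integral>\<^sup>+x. f (fst_blk a x) * g (snd_blk a b x) \<partial>distr (lebn a \<Otimes>\<^sub>M lebn b) (lebn (a + b)) (join a b))"
    by (simp only: distr_join)
  also have "\<dots> = (\<integral>\<^sup>+p. f (fst_blk a (join a b p)) * g (snd_blk a b (join a b p)) \<partial>(lebn a \<Otimes>\<^sub>M lebn b))"
    by (rule nn_integral_distr) measurable
  also have "\<dots> = (\<integral>\<^sup>+p. f (fst p) * g (snd p) \<partial>(lebn a \<Otimes>\<^sub>M lebn b))"
    by (rule nn_integral_cong) (auto simp: space_pair_measure space_PiM_lborel blk_join)
  also have "\<dots> = (\<integral>\<^sup>+x. (\<integral>\<^sup>+y. f x * g y \<partial>lebn b) \<partial>lebn a)"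
    by (subst B.nn_integral_fst[symmetric]) auto
  also have "\<dots> = (\<integral>\<^sup>+x. f x * (\<integral>\<^sup>+y. g y \<partial>lebn b) \<partial>lebn a)"
    by (intro nn_integral_cong nn_integral_cmult) auto
  also have "\<dots> = (\<integral>\<^sup>+x. f x \<partial>lebn a) * (\<integral>\<^sup>+y. g y \<partial>lebn b)"
    by (rule nn_integral_multc) auto
  finally show ?thesis .
qed

lemma nn_integral_L2:
  assumes "f \<in> L2 d U"
  shows "(\<integral>\<^sup>+x. ennreal ((cmod (f x))\<^sup>2) \<partial>leb_on d U) = ennreal (sqn d U f)"
  unfolding sqn_def using L2D[OF assms] by (intro nn_integral_eq_integral) auto

text \<open>Tonelli for nonnegative integrands yields integrability and the value of the norm at
  once. The indicators of \<open>U\<close> and \<open>V\<close> multiply to that of the product set,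
  which moves the computation to the full spaces.\<close>

lemma L2_tens:
  assumes U: "openin (euc a) U" and V: "openin (euc b) V" and f: "f \<in> L2 a U" and g: "g \<in> L2 b V"
  shows "tens a b f g \<in> L2 (a + b) (prod2 a b U V)"
    and "sqn (a + b) (prod2 a b U V) (tens a b f g) = sqn a U f * sqn b V g"
proof -
  let ?W = "prod2 a b U V"
  have W: "openin (euc (a + b)) ?W" by (rule openin_prod2[OF U V])
  have 1: "fst_blk a \<in> measurable (leb_on (a + b) ?W) (leb_on a U)"
    unfolding leb_on_def by (rule measurable_restrict_space3[OF measurable_fst_blk]) (auto simp: prod2_def)
  have 2: "snd_blk a b \<in> measurable (leb_on (a + b) ?W) (leb_on b V)"
    unfolding leb_on_def by (rule measurable_restrict_space3[OF measurable_snd_blk]) (auto simp: prod2_def)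
  have meas: "tens a b f g \<in> borel_measurable (leb_on (a + b) ?W)"
    unfolding tens_def
    by (intro borel_measurable_times measurable_compose[OF 1 L2D(1)[OF f]] measurable_compose[OF 2 L2D(1)[OF g]])
  let ?F = "\<lambda>x. ennreal ((cmod (f x))\<^sup>2) * indicator U x" and ?G = "\<lambda>y. ennreal ((cmod (g y))\<^sup>2) * indicator V y"
  have F: "?F \<in> borel_measurable (lebn a)" and G: "?G \<in> borel_measurable (lebn b)"
    using L2D(1)[OF f] L2D(1)[OF g]
    by (auto simp: leb_on_def borel_measurable_restrict_space_iff_ennreal[OF openin_sets_lebn(2)[OF U], symmetric]
      borel_measurable_restrict_space_iff_ennreal[OF openin_sets_lebn(2)[OF V], symmetric])
  have "(\<integral>\<^sup>+x. ennreal ((cmod (tens a b f g x))\<^sup>2) \<partial>leb_on (a + b) ?W) =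
      (\<integral>\<^sup>+x. ennreal ((cmod (tens a b f g x))\<^sup>2) * indicator ?W x \<partial>lebn (a + b))"
    unfolding leb_on_def by (rule nn_integral_restrict_space[OF openin_sets_lebn(2)[OF W]])
  also have "\<dots> = (\<integral>\<^sup>+x. ?F (fst_blk a x) * ?G (snd_blk a b x) \<partial>lebn (a + b))"
  proof (rule nn_integral_cong)
    fix x assume "x \<in> space (lebn (a + b))"
    then have "indicator ?W x = (indicator U (fst_blk a x) * indicator V (snd_blk a b x) :: ennreal)"
      by (auto simp: prod2_def indicator_def space_PiM_lborel)
    then show "ennreal ((cmod (tens a b f g x))\<^sup>2) * indicator ?W x = ?F (fst_blk a x) * ?G (snd_blk a b x)"
      by (simp add: tens_def norm_mult power_mult_distrib ennreal_mult mult_ac)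
  qed
  also have "\<dots> = (\<integral>\<^sup>+x. ?F x \<partial>lebn a) * (\<integral>\<^sup>+y. ?G y \<partial>lebn b)"
    by (rule nn_integral_blk_mult[OF F G])
  also have "(\<integral>\<^sup>+x. ?F x \<partial>lebn a) = ennreal (sqn a U f)"
    using nn_integral_L2[OF f] by (simp add: leb_on_def nn_integral_restrict_space[OF openin_sets_lebn(2)[OF U]])
  also have "(\<integral>\<^sup>+y. ?G y \<partial>lebn b) = ennreal (sqn b V g)"
    using nn_integral_L2[OF g] by (simp add: leb_on_def nn_integral_restrict_space[OF openin_sets_lebn(2)[OF V]])
  finally have "(\<integral>\<^sup>+x. ennreal ((cmod (tens a b f g x))\<^sup>2) \<partial>leb_on (a + b) ?W) = ennreal (sqn a U f * sqn b V g)"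
    by (simp add: ennreal_mult sqn_nonneg)
  then have "integrable (leb_on (a + b) ?W) (\<lambda>x. (cmod (tens a b f g x))\<^sup>2) \<and>
      (\<integral>x. (cmod (tens a b f g x))\<^sup>2 \<partial>leb_on (a + b) ?W) = sqn a U f * sqn b V g"
    using meas by (subst nn_integral_eq_integrable[symmetric]) (auto simp: sqn_nonneg)
  then show "tens a b f g \<in> L2 (a + b) ?W" "sqn (a + b) ?W (tens a b f g) = sqn a U f * sqn b V g"
    using meas by (auto simp: L2_def sqn_def)
qed

text \<open>Replacing one factor at a time writes the difference as the tensor of
  \<open>f - \<phi>\<close> with \<open>g\<close> plus the tensor of \<phi> with
  \<open>g - \<psi>\<close>; both norms factor.\<close>

lemma sqn_tens_diff:
  assumes U: "openin (euc a) U" and V: "openin (euc b) V"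
    and L: "f \<in> L2 a U" "\<phi> \<in> L2 a U" "g \<in> L2 b V" "\<psi> \<in> L2 b V"
    and s: "sqn a U f \<le> A" "sqn b V g \<le> B" "sqn a U (\<lambda>x. f x - \<phi> x) < \<delta>" "sqn b V (\<lambda>x. g x - \<psi> x) < \<delta>" "\<delta> \<le> 1"
  shows "sqn (a + b) (prod2 a b U V) (\<lambda>x. tens a b f g x - tens a b \<phi> \<psi> x) \<le> (2 * B + 4 * A + 4) * \<delta>"
proof -
  let ?S = "sqn (a + b) (prod2 a b U V)"
  have \<delta>: "\<delta> > 0" using s(3) sqn_nonneg[of a U "\<lambda>x. f x - \<phi> x"] by simp
  \<comment> \<open>The second tensor contains \<phi> itself, whose norm is controlled through
    \<open>f - (f - \<phi>)\<close>; here \<delta> being at most 1 is used.\<close>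
  have "sqn a U \<phi> = sqn a U (\<lambda>x. f x - (f x - \<phi> x))" by simp
  also have "\<dots> \<le> 2 * sqn a U f + 2 * sqn a U (\<lambda>x. f x - \<phi> x)"
    by (rule L2_diff(2)[OF L(1) L2_diff(1)[OF L(1,2)]])
  finally have \<phi>: "sqn a U \<phi> \<le> 2 * A + 2" using s by simp
  have "?S (\<lambda>x. tens a b f g x - tens a b \<phi> \<psi> x) =
      ?S (\<lambda>x. tens a b (\<lambda>x. f x - \<phi> x) g x + tens a b \<phi> (\<lambda>x. g x - \<psi> x) x)"
    by (simp add: tens_def algebra_simps)
  also have "\<dots> \<le> 2 * ?S (tens a b (\<lambda>x. f x - \<phi> x) g) + 2 * ?S (tens a b \<phi> (\<lambda>x. g x - \<psi> x))"
    by (intro L2_add(2) L2_tens(1) U V L L2_diff(1))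
  also have "\<dots> = 2 * (sqn a U (\<lambda>x. f x - \<phi> x) * sqn b V g) + 2 * (sqn a U \<phi> * sqn b V (\<lambda>x. g x - \<psi> x))"
    using L2_tens(2)[OF U V L2_diff(1)[OF L(1,2)] L(3)] L2_tens(2)[OF U V L(2) L2_diff(1)[OF L(3,4)]] by simp
  also have "\<dots> \<le> 2 * (\<delta> * B) + 2 * ((2 * A + 2) * \<delta>)"
    using s \<phi> \<delta> by (intro add_mono mult_left_mono mult_mono) (auto simp: sqn_nonneg intro: order_trans[OF sqn_nonneg])
  also have "\<dots> = (2 * B + 4 * A + 4) * \<delta>" by (simp add: algebra_simps)
  finally show ?thesis .
qed

text \<open>A partial derivative of a tensor hits exactly one factor, so every component of the
  gradient is again a tensor and obeys the same difference bound.\<close>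

lemma test_approx_tens:
  assumes U: "openin (euc a) U" and V: "openin (euc b) V"
    and f: "test_approx a U f F" and g: "test_approx b V g G"
  shows "test_approx (a + b) (prod2 a b U V) (tens a b f g)
    (\<lambda>k. if k < a then tens a b (F k) g else tens a b f (G (k - a)))"
  unfolding test_approx_def
proof (intro conjI allI impI)
  let ?W = "prod2 a b U V"
  let ?H = "\<lambda>k. if k < a then tens a b (F k) g else tens a b f (G (k - a))"
  have W: "openin (euc (a + b)) ?W" by (rule openin_prod2[OF U V])
  have Lf: "f \<in> L2 a U" "\<And>k. k < a \<Longrightarrow> F k \<in> L2 a U" using f by (auto simp: test_approx_def)
  have Lg: "g \<in> L2 b V" "\<And>k. k < b \<Longrightarrow> G k \<in> L2 b V" using g by (auto simp: test_approx_def)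
  show "tens a b f g \<in> L2 (a + b) ?W" by (rule L2_tens(1)[OF U V Lf(1) Lg(1)])
  show "?H k \<in> L2 (a + b) ?W" if "k < a + b" for k
    using that by (auto intro!: L2_tens(1)[OF U V] Lf Lg)
  fix \<epsilon> :: real assume \<epsilon>: "\<epsilon> > 0"
  \<comment> \<open>\<open>A\<close> and \<open>B\<close> bound the function and all its derivatives
    together, so that one \<delta> serves every component.\<close>
  define A where "A = sqn a U f + (\<Sum>k<a. sqn a U (F k))"
  define B where "B = sqn b V g + (\<Sum>k<b. sqn b V (G k))"
  have A: "sqn a U f \<le> A" "k < a \<Longrightarrow> sqn a U (F k) \<le> A" for k
    using member_le_sum[of k "{..<a}" "\<lambda>k. sqn a U (F k)"] sqn_nonneg[of a U]
    by (auto simp: A_def sum_nonneg intro: add_increasing)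
  have B: "sqn b V g \<le> B" "k < b \<Longrightarrow> sqn b V (G k) \<le> B" for k
    using member_le_sum[of k "{..<b}" "\<lambda>k. sqn b V (G k)"] sqn_nonneg[of b V]
    by (auto simp: B_def sum_nonneg intro: add_increasing)
  define C where "C = 2 * B + 4 * A + 4"
  have C: "C > 0"
    using order_trans[OF sqn_nonneg A(1)] order_trans[OF sqn_nonneg B(1)] by (simp add: C_def)
  \<comment> \<open>The factor 2 makes \<open>C * \<delta>\<close> at most half of \<epsilon>; the
    cap 1 is what \<open>sqn_tens_diff\<close> asks for.\<close>
  define \<delta> where "\<delta> = min 1 (\<epsilon> / (2 * C))"
  have \<delta>: "\<delta> > 0" "\<delta> \<le> 1" using \<epsilon> C by (auto simp: \<delta>_def)
  have "C * \<delta> \<le> C * (\<epsilon> / (2 * C))" using C by (intro mult_left_mono) (auto simp: \<delta>_def)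
  also have "\<dots> < \<epsilon>" using C \<epsilon> by simp
  finally have C\<delta>: "C * \<delta> < \<epsilon>" .
  obtain \<phi> where \<phi>: "\<phi> \<in> test_funs a U" "sqn a U (\<lambda>x. f x - \<phi> x) < \<delta>"
    "\<forall>k<a. sqn a U (\<lambda>x. F k x - partial_deriv k \<phi> x) < \<delta>"
    using f \<delta>(1) unfolding test_approx_def by blast
  obtain \<psi> where \<psi>: "\<psi> \<in> test_funs b V" "sqn b V (\<lambda>x. g x - \<psi> x) < \<delta>"
    "\<forall>k<b. sqn b V (\<lambda>x. G k x - partial_deriv k \<psi> x) < \<delta>"
    using g \<delta>(1) unfolding test_approx_def by blast
  have L\<phi>: "\<phi> \<in> L2 a U" "\<And>k. k < a \<Longrightarrow> partial_deriv k \<phi> \<in> L2 a U"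
    using test_funs_L2[OF U \<phi>(1)] test_funs_L2[OF U test_funs_partial[OF \<phi>(1)]] by auto
  have L\<psi>: "\<psi> \<in> L2 b V" "\<And>k. k < b \<Longrightarrow> partial_deriv k \<psi> \<in> L2 b V"
    using test_funs_L2[OF V \<psi>(1)] test_funs_L2[OF V test_funs_partial[OF \<psi>(1)]] by auto
  note bound = sqn_tens_diff[OF U V, of _ _ _ _ A B \<delta>, folded C_def, THEN le_less_trans, OF _ _ _ _ _ _ _ _ \<delta>(2) C\<delta>]
  show "\<exists>\<zeta>\<in>test_funs (a + b) ?W. sqn (a + b) ?W (\<lambda>x. tens a b f g x - \<zeta> x) < \<epsilon> \<and>
      (\<forall>k<a + b. sqn (a + b) ?W (\<lambda>x. ?H k x - partial_deriv k \<zeta> x) < \<epsilon>)"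
  proof (intro bexI[of _ "tens a b \<phi> \<psi>"] conjI allI impI)
    show "tens a b \<phi> \<psi> \<in> test_funs (a + b) ?W" by (rule test_funs_tens) fact+
    show "sqn (a + b) ?W (\<lambda>x. tens a b f g x - tens a b \<phi> \<psi> x) < \<epsilon>"
      by (rule bound[OF Lf(1) L\<phi>(1) Lg(1) L\<psi>(1) A(1) B(1) \<phi>(2) \<psi>(2)])
    fix k assume k: "k < a + b"
    have "sqn (a + b) ?W (\<lambda>x. ?H k x - partial_deriv k (tens a b \<phi> \<psi>) x) =
        sqn (a + b) ?W (\<lambda>x. ?H k x - (if k < a then tens a b (partial_deriv k \<phi>) \<psi> x
          else tens a b \<phi> (partial_deriv (k - a) \<psi>) x))"
      using openin_subset[OF W] smooth_tens(2)[OF test_funsD(1)[OF \<phi>(1)] test_funsD(1)[OF \<psi>(1)] _ k]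
      by (intro sqn_cong[OF W]) auto
    also have "\<dots> < \<epsilon>"
    proof (cases "k < a")
      case True
      show ?thesis
        using bound[OF Lf(2)[OF True] L\<phi>(2)[OF True] Lg(1) L\<psi>(1) A(2)[OF True] B(1) \<phi>(3)[rule_format, OF True] \<psi>(2)]
        by (simp add: True)
    next
      case False
      then have k': "k - a < b" using k by auto
      show ?thesis
        using bound[OF Lf(1) L\<phi>(1) Lg(2)[OF k'] L\<psi>(2)[OF k'] A(1) B(2)[OF k'] \<phi>(2) \<psi>(3)[rule_format, OF k']]
        by (simp add: False)
    qed
    finally show "sqn (a + b) ?W (\<lambda>x. ?H k x - partial_deriv k (tens a b \<phi> \<psi>) x) < \<epsilon>" .
  qed
qed

lemma H01_tens:
  assumes "openin (euc a) U" "openin (euc b) V" "f \<in> H01 a U" "g \<in> H01 b V"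
  shows "tens a b f g \<in> H01 (a + b) (prod2 a b U V)"
  using assms test_approx_tens[OF assms(1,2)] openin_prod2[OF assms(1,2)]
  by (meson H01_iff_test_approx)

section \<open>Induction on the number of factors\<close>

lemma total_dim_Suc: "total_dim (Suc n) d = total_dim n d + d n"
  by (simp add: total_dim_def)

lemma block_less_total_dim:
  assumes "j < n" "i < d j"
  shows "(\<Sum>l<j. d l) + i < total_dim n d"
proof -
  have "(\<Sum>l<j. d l) + i < (\<Sum>l<Suc j. d l)" using assms by simp
  also have "\<dots> \<le> total_dim n d" unfolding total_dim_def using assms by (intro sum_mono2) auto
  finally show ?thesis .
qed

lemma block_fst_blk: "j < n \<Longrightarrow> block d j (fst_blk (total_dim n d) x) = block d j x"
  by (auto simp: block_def fst_blk_def block_less_total_dim fun_eq_iff)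

lemma block_snd_blk: "block d n x = snd_blk (total_dim n d) (d n) x"
  by (simp add: block_def snd_blk_def total_dim_def)

lemma elem_tensor_Suc:
  "elem_tensor (Suc n) d f = tens (total_dim n d) (d n) (elem_tensor n d f) (f n)"
  by (simp add: elem_tensor_def tens_def block_fst_blk block_snd_blk[of d n] fun_eq_iff)

lemma prod_set_Suc:
  "prod_set (Suc n) d U = prod2 (total_dim n d) (d n) (prod_set n d U) (U n)"
proof -
  have "(\<forall>j<Suc n. block d j x \<in> U j) \<longleftrightarrow>
      fst_blk (total_dim n d) x \<in> prod_set n d U \<and> snd_blk (total_dim n d) (d n) x \<in> U n" for x
    by (auto simp: prod_set_def block_fst_blk block_snd_blk[of d n, symmetric] less_Suc_eq)
  then show ?thesis unfolding prod_set_def[of "Suc n"] prod2_def total_dim_Suc by simp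
qed

lemma openin_prod_set:
  assumes "\<And>j. j < n \<Longrightarrow> openin (euc (d j)) (U j)"
  shows "openin (euc (total_dim n d)) (prod_set n d U)"
  using assms
proof (induction n)
  case 0
  have "prod_set 0 d U = topspace (euc (total_dim 0 d))" by (auto simp: prod_set_def)
  then show ?case by simp
next
  case (Suc n)
  then show ?case by (simp add: prod_set_Suc total_dim_Suc openin_prod2)
qed

lemma elem_tensor_H01:
  assumes "\<And>j. j < n \<Longrightarrow> openin (euc (d j)) (U j)" "\<And>j. j < n \<Longrightarrow> f j \<in> H01 (d j) (U j)"
  shows "elem_tensor n d f \<in> H01 (total_dim n d) (prod_set n d U)"
  using assms
proof (induction n)
  case 0
  \<comment> \<open>The empty tensor is the constant 1 on the one-point space \<open>euc 0\<close>,
    whose whole space is compact, so it is a test function.\<close>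
  have "smooth 0 (\<lambda>x. 1)"
    by (rule smooth_familyI[of 0 "\<lambda>_ _. 1"]) auto
  then have "(\<lambda>x. 1) \<in> test_funs 0 (topspace (euc 0))"
    using compactin_euc_box[of 0] closedin_euc_box[of 0]
    by (intro test_funsI[of 0 _ "topspace (euc 0)"]) (auto simp: topspace_euc)
  moreover have "prod_set 0 d U = topspace (euc 0)" by (auto simp: prod_set_def total_dim_def)
  ultimately show ?case
    using test_funs_subset_H01[of 0 "topspace (euc 0)"]
    by (auto simp: total_dim_def elem_tensor_def[abs_def])
next
  case (Suc n)
  then show ?case
    by (simp add: elem_tensor_Suc prod_set_Suc total_dim_Suc H01_tens openin_prod_set)
qed

section \<open>A smooth partition of unity on a grid\<close>

text \<open>The bump of the overview: a step up on \<open>[-1, 0]\<close> and down on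
  \<open>[0, 1]\<close>. As a difference of a step and its shift by 1, its integer translates
  telescope.\<close>

definition hat :: "real \<Rightarrow> real" where
  "hat t = sstep (t + 1) - sstep t"

lemma smooth1_hat: "smooth1 hat"
proof -
  have "smooth1 (\<lambda>t. sstep (1 * t + 1) + (-1) * sstep t)"
    by (intro smooth1_add smooth1_mult smooth1_const smooth1_affine smooth1_sstep)
  then show ?thesis by (simp add: hat_def[abs_def])
qed

lemma smooth1_DERIV: "smooth1 f \<Longrightarrow> (f has_real_derivative deriv f t) (at t)"
  using smooth1_derivs[of f 0 t] by simp

lemma deriv_hat: "deriv hat t = deriv sstep (t + 1) - deriv sstep t"
proof -
  have "(sstep has_real_derivative deriv sstep (t + 1)) (at (t + 1))"
    by (rule smooth1_DERIV[OF smooth1_sstep])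
  then have "((\<lambda>t. sstep (t + 1)) has_real_derivative deriv sstep (t + 1)) (at t)"
    by (simp add: DERIV_shift)
  then have "(hat has_real_derivative deriv sstep (t + 1) - deriv sstep t) (at t)"
    unfolding hat_def[abs_def] by (intro DERIV_diff smooth1_DERIV smooth1_sstep)
  then show ?thesis by (rule DERIV_imp_deriv)
qed

lemma deriv_sstep_eq_0:
  assumes "t < 0 \<or> t > 1"
  shows "deriv sstep t = 0"
proof -
  have "(sstep has_real_derivative 0) (at t)"
    using assms
  proof
    assume t: "t < 0"
    show ?thesis
      by (rule has_field_derivative_transform_within_open[OF DERIV_const[of 0], of "{..<0}"])
        (use t in \<open>auto simp: sstep_eq_0\<close>)
  next
    assume t: "t > 1"
    show ?thesis
      by (rule has_field_derivative_transform_within_open[OF DERIV_const[of 1], of "{1<..}"])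
        (use t in \<open>auto simp: sstep_eq_1\<close>)
  qed
  then show ?thesis by (rule DERIV_imp_deriv)
qed

lemma hat_eq_0: "\<bar>t\<bar> > 1 \<Longrightarrow> hat t = 0"
  by (cases "t > 1") (auto simp: hat_def sstep_eq_0 sstep_eq_1)

lemma deriv_hat_eq_0: "\<bar>t\<bar> > 1 \<Longrightarrow> deriv hat t = 0"
  unfolding deriv_hat by (cases "t > 1") (simp_all add: deriv_sstep_eq_0 abs_if split: if_splits)

lemma abs_hat_le_1: "\<bar>hat t\<bar> \<le> 1"
  using sstep_bounds[of t] sstep_bounds[of "t + 1"] by (auto simp: hat_def)

text \<open>Asking for \<open>C \<ge> 1\<close> lets the same constant bound \<open>hat\<close> as
  well.\<close>

lemma deriv_hat_bounded:
  obtains C where "C \<ge> 1" "\<And>t. \<bar>deriv hat t\<bar> \<le> C"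
proof -
  have "continuous_on {-1..1} (deriv hat)"
    using smooth1_derivs[OF smooth1_hat, of 1]
    by (intro continuous_at_imp_continuous_on) (auto intro: DERIV_isCont)
  then have "bounded (deriv hat ` {-1..1})"
    by (intro compact_imp_bounded compact_continuous_image) auto
  then obtain B where B: "\<forall>t\<in>{-1..1}. \<bar>deriv hat t\<bar> \<le> B"
    by (auto simp: bounded_iff)
  have "\<bar>deriv hat t\<bar> \<le> max 1 B" for t
  proof (cases "\<bar>t\<bar> > 1")
    case False
    then have "t \<in> {-1..1}" by (auto simp: abs_le_iff not_less)
    with B show ?thesis by (simp add: le_max_iff_disj)
  qed (simp add: deriv_hat_eq_0)
  then show ?thesis by (intro that[of "max 1 B"]) auto
qed

text \<open>Stated for arbitrary \<open>u\<close> because it serves both the step and the derivative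
  of the step.\<close>

lemma sum_telescope_symmetric:
  fixes u :: "real \<Rightarrow> real"
  shows "(\<Sum>k\<in>{- int N..int N}. u (t - of_int k + 1) - u (t - of_int k)) = u (t + real N + 1) - u (t - real N)"
proof (induction N)
  case (Suc N)
  have *: "{- int (Suc N)..int (Suc N)} = insert (- int (Suc N)) (insert (int (Suc N)) {- int N..int N})"
    by auto
  let ?f = "\<lambda>k :: int. u (t - of_int k + 1) - u (t - of_int k)"
  have "sum ?f {- int (Suc N)..int (Suc N)} =
      ?f (- int (Suc N)) + (?f (int (Suc N)) + sum ?f {- int N..int N})"
    unfolding * by simp
  then show ?case unfolding Suc.IH by (simp add: algebra_simps)
qed simp

text \<open>After telescoping only the values at \<open>t + N + 1 > 1\<close> and
  \<open>t - N < 0\<close> remain, where the step is constant; the strict bound on \<open>t\<close>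
  puts both points off the ramp, as the derivative requires.\<close>

lemma sum_hat:
  assumes "\<bar>t\<bar> < real N"
  shows "(\<Sum>k\<in>{- int N..int N}. hat (t - of_int k)) = 1"
    and "(\<Sum>k\<in>{- int N..int N}. deriv hat (t - of_int k)) = 0"
  unfolding hat_def[of "_ - _"] deriv_hat sum_telescope_symmetric
  using assms by (simp_all add: sstep_eq_0 sstep_eq_1 deriv_sstep_eq_0 abs_less_iff)

text \<open>Only the integers next to the floor of \<open>t\<close>, and the floor itself, lie
  within distance 1 of \<open>t\<close>; hence the 3, independent of \<open>A\<close>.\<close>

lemma sum_abs_shift_le:
  fixes g :: "real \<Rightarrow> real"
  assumes "\<And>t. \<bar>g t\<bar> \<le> C" "\<And>t. \<bar>t\<bar> > 1 \<Longrightarrow> g t = 0" "finite A" and C: "C \<ge> 0"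
  shows "(\<Sum>k\<in>A. \<bar>g (t - of_int k)\<bar>) \<le> 3 * C"
proof -
  let ?B = "{\<lfloor>t\<rfloor> - 1, \<lfloor>t\<rfloor>, \<lfloor>t\<rfloor> + 1}"
  have "g (t - of_int k) = 0" if "k \<notin> ?B" for k
  proof -
    have "k \<le> \<lfloor>t\<rfloor> - 2 \<or> k \<ge> \<lfloor>t\<rfloor> + 2" using that by auto
    then have "\<bar>t - of_int k\<bar> > 1" by linarith
    then show ?thesis by (rule assms(2))
  qed
  then have "(\<Sum>k\<in>A. \<bar>g (t - of_int k)\<bar>) = (\<Sum>k\<in>A \<inter> ?B. \<bar>g (t - of_int k)\<bar>)"
    using assms(3) by (intro sum.mono_neutral_right) auto
  also have "\<dots> \<le> (\<Sum>k\<in>?B. \<bar>g (t - of_int k)\<bar>)"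
    by (intro sum_mono2) auto
  also have "\<dots> \<le> of_nat (card ?B) * C"
    by (intro sum_bounded_above assms(1))
  also have "\<dots> \<le> 3 * C"
    using C by (intro mult_right_mono) (auto simp: card_insert_if)
  finally show ?thesis .
qed

section \<open>First-order Taylor estimates and the choice of scale\<close>

lemma taylor_step:
  fixes f :: cfun
  assumes f: "smooth d f" and m: "m < d" and z: "z \<in> topspace (euc d)"
    and b: "\<And>t. t \<in> closed_segment s r \<Longrightarrow> cmod (partial_deriv m f (z(m := t)) - c) \<le> \<omega>"
  shows "cmod (f (z(m := r)) - f (z(m := s)) - c * of_real (r - s)) \<le> \<omega> * \<bar>r - s\<bar>"
proof -
  let ?G = "\<lambda>t. f (z(m := t)) - c * of_real t"
  have der: "(?G has_vector_derivative (partial_deriv m f (z(m := t)) - c)) (at t)" for t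
    by (rule has_vector_derivative_diff[OF smooth_partial_derivative[OF f m z]])
      (auto intro!: derivative_eq_intros)
  have "norm (?G r - ?G s) \<le> \<omega> * norm (r - s)"
  proof (rule differentiable_bound[of "closed_segment s r" ?G "\<lambda>t h. h *\<^sub>R (partial_deriv m f (z(m := t)) - c)"])
    fix t assume t: "t \<in> closed_segment s r"
    show "(?G has_derivative (\<lambda>h. h *\<^sub>R (partial_deriv m f (z(m := t)) - c))) (at t within closed_segment s r)"
      using has_vector_derivative_at_within[OF der] unfolding has_vector_derivative_def .
    show "onorm (\<lambda>h. h *\<^sub>R (partial_deriv m f (z(m := t)) - c)) \<le> \<omega>"
      using b[OF t] by (intro onorm_le) (simp add: mult.commute[of \<omega>] mult_left_mono)
  qed auto
  then show ?thesis by (simp add: algebra_simps)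
qed

text \<open>The path from \<open>y\<close> to \<open>x\<close> changes one coordinate at a time and
  stays in the cube; each step is a mean value inequality with error at most
  \<open>h * \<omega>\<close>. The slope in \<open>taylor_step\<close> is a free \<open>c\<close> so
  that it can be taken at the centre instead of at the start of the step.\<close>

lemma taylor_sball:
  fixes f :: cfun
  assumes f: "smooth d f" and xy: "x \<in> topspace (euc d)" "y \<in> topspace (euc d)"
    "\<And>i. i < d \<Longrightarrow> \<bar>x i - y i\<bar> \<le> h"
    and b: "\<And>u k. u \<in> sball d y h \<Longrightarrow> k < d \<Longrightarrow> cmod (partial_deriv k f u - partial_deriv k f y) \<le> \<omega>"
    and \<omega>: "\<omega> \<ge> 0" and h: "h \<ge> 0"
  shows "cmod (f x - (f y + (\<Sum>j<d. partial_deriv j f y * of_real (x j - y j)))) \<le> real d * (h * \<omega>)"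
proof -
  \<comment> \<open>The corner of the path that agrees with \<open>x\<close> in the first
    \<open>m\<close> coordinates and with \<open>y\<close> in the others.\<close>
  define z where "z m = (\<lambda>i. if i < m then x i else y i)" for m :: nat
  have z: "z m \<in> topspace (euc d)" if "m \<le> d" for m
    using xy(1,2) that by (auto simp: z_def topspace_euc PiE_iff extensional_def)
  have "cmod (f (z m) - (f y + (\<Sum>j<m. partial_deriv j f y * of_real (x j - y j)))) \<le> real m * (h * \<omega>)"
    if "m \<le> d" for m
    using that
  proof (induction m)
    case 0
    have "z 0 = y" by (simp add: z_def)
    then show ?case by simp
  next
    case (Suc m)
    have zs: "(z m)(m := x m) = z (Suc m)" "(z m)(m := y m) = z m"
      by (auto simp: z_def fun_eq_iff less_Suc_eq)
    have "cmod (f ((z m)(m := x m)) - f ((z m)(m := y m)) - partial_deriv m f y * of_real (x m - y m))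
        \<le> \<omega> * \<bar>x m - y m\<bar>"
    proof (rule taylor_step[OF f])
      show "m < d" "z m \<in> topspace (euc d)" using Suc.prems z by auto
      fix t assume t: "t \<in> closed_segment (y m) (x m)"
      have "\<bar>t - y m\<bar> \<le> \<bar>x m - y m\<bar>"
        using t by (auto simp: closed_segment_eq_real_ivl split: if_splits)
      then have "\<bar>((z m)(m := t)) i - y i\<bar> \<le> h" if "i < d" for i
        using xy(3)[OF that] h by (auto simp: z_def)
      then have "(z m)(m := t) \<in> sball d y h"
        using topspace_euc_upd[OF z[of m]] Suc.prems by (auto simp: sball_def)
      then show "cmod (partial_deriv m f ((z m)(m := t)) - partial_deriv m f y) \<le> \<omega>"
        using b Suc.prems by auto
    qed
    also have "\<omega> * \<bar>x m - y m\<bar> \<le> h * \<omega>"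
      using xy(3)[of m] Suc.prems \<omega> by (simp add: mult.commute[of h] mult_left_mono)
    finally have 1: "cmod (f (z (Suc m)) - f (z m) - partial_deriv m f y * of_real (x m - y m)) \<le> h * \<omega>"
      unfolding zs .
    have "f (z (Suc m)) - (f y + (\<Sum>j<Suc m. partial_deriv j f y * of_real (x j - y j))) =
        (f (z (Suc m)) - f (z m) - partial_deriv m f y * of_real (x m - y m)) +
        (f (z m) - (f y + (\<Sum>j<m. partial_deriv j f y * of_real (x j - y j))))"
      by simp
    also have "cmod \<dots> \<le> h * \<omega> + real m * (h * \<omega>)"
      using 1 Suc by (intro norm_triangle_mono) auto
    finally show ?case by (simp add: algebra_simps)
  qed
  moreover have "z d = x"
    using xy(1,2) by (auto simp: z_def fun_eq_iff topspace_euc PiE_iff extensional_def)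
  ultimately show ?thesis by (metis order_refl)
qed

text \<open>Containment of cubes is only possible around the support, but the oscillation bound must
  hold for every centre, since the point \<open>x\<close> and the nodes near it may lie on different
  sides of the boundary of the support.\<close>

lemma test_funs_uniform_scale:
  assumes W: "openin (euc d) W" and f: "f \<in> test_funs d W" and \<omega>: "\<omega> > 0"
  obtains h where "h > 0" "h \<le> 1" "\<forall>y\<in>supp d f. sball d y h \<subseteq> W"
    "\<forall>y\<in>topspace (euc d). \<forall>u\<in>sball d y h. \<forall>k<d. cmod (partial_deriv k f u - partial_deriv k f y) \<le> \<omega>"
proof -
  note f' = test_funsD[OF f]
  let ?P = "\<lambda>B. B \<subseteq> W \<and> (\<forall>u\<in>B. \<forall>v\<in>B. \<forall>k<d. cmod (partial_deriv k f u - partial_deriv k f v) \<le> \<omega>)"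
  have "\<exists>r>0. ?P (sball d y r)" if y: "y \<in> supp d f" for y
  proof -
    let ?S = "\<lambda>u. \<Sum>k<d. cmod (partial_deriv k f u - partial_deriv k f y)"
    have cS: "continuous_map (euc d) euclideanreal ?S"
      by (intro continuous_map_sum continuous_map_norm continuous_map_diff smooth_imp_continuous_partial f')
        auto
    \<comment> \<open>Half of \<omega>, because two points of the cube are compared through its
      centre.\<close>
    have "openin (euc d) {u \<in> topspace (euc d). ?S u \<in> {..<\<omega> / 2}}"
      by (rule openin_continuous_map_preimage[OF cS]) auto
    then have op: "openin (euc d) (W \<inter> {u \<in> topspace (euc d). ?S u \<in> {..<\<omega> / 2}})"
      using W by (rule openin_Int[rotated])
    have "y \<in> W \<inter> {u \<in> topspace (euc d). ?S u \<in> {..<\<omega> / 2}}"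
      using y f'(3) supp_subset_topspace[of d f] \<omega> by auto
    from openin_euc_sball[OF op this] obtain r
      where r: "r > 0" "sball d y r \<subseteq> W \<inter> {u \<in> topspace (euc d). ?S u \<in> {..<\<omega> / 2}}" by blast
    have near: "cmod (partial_deriv k f u - partial_deriv k f y) \<le> \<omega> / 2" if "u \<in> sball d y r" "k < d" for u k
    proof -
      have "cmod (partial_deriv k f u - partial_deriv k f y) \<le> ?S u"
        using that(2) by (intro member_le_sum) auto
      also have "\<dots> \<le> \<omega> / 2" using r(2) that(1) by auto
      finally show ?thesis .
    qed
    have "cmod (partial_deriv k f u - partial_deriv k f v) \<le> \<omega>"
      if "u \<in> sball d y r" "v \<in> sball d y r" "k < d" for u v k
      using norm_triangle_mono[OF near[OF that(1,3)] near[OF that(2,3), unfolded norm_minus_commute[of "partial_deriv k f v"]]]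
      by simp
    with r show ?thesis by blast
  qed
  then have "\<exists>h>0. \<forall>y\<in>supp d f. ?P (sball d y h)"
    by (intro compactin_euc_uniform_sball[OF f'(2)]) blast+
  then obtain h0 where h0: "h0 > 0" "\<forall>y\<in>supp d f. ?P (sball d y h0)" by blast
  define h where "h = min h0 1"
  have h: "h > 0" "h \<le> 1" "h \<le> h0" using h0(1) by (auto simp: h_def)
  have sub: "sball d y h \<subseteq> sball d y h0" for y using h(3) by (auto simp: sball_def)
  have "cmod (partial_deriv k f u - partial_deriv k f y) \<le> \<omega>"
    if y: "y \<in> topspace (euc d)" and u: "u \<in> sball d y h" and k: "k < d" for y u k
  proof -
    have uy: "u \<in> topspace (euc d)" "y \<in> sball d u h" "u \<in> sball d u h" "y \<in> sball d y h"
      using y u h(1) by (auto simp: sball_def abs_minus_commute)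
    \<comment> \<open>If only \<open>u\<close> lies in the support, the cube around \<open>u\<close>
      contains \<open>y\<close> and the roles are exchanged; if neither does, both derivatives are
      zero.\<close>
    consider "y \<in> supp d f" | "u \<in> supp d f" | "y \<notin> supp d f" "u \<notin> supp d f" by blast
    then show ?thesis
    proof cases
      case 1
      then show ?thesis using h0(2) sub uy u k by blast
    next
      case 2
      then show ?thesis using h0(2) sub uy u k by blast
    next
      case 3
      then show ?thesis using partial_deriv_not_in_supp[OF k] y uy(1) \<omega> by simp
    qed
  qed
  then show ?thesis using h h0(2) sub by (intro that[of h]) blast+
qed

section \<open>Complex linear spans\<close>

lemma cspan_scale_base: "s \<in> S \<Longrightarrow> (\<lambda>x. c * s x) \<in> cspan S"
  unfolding cspan_def by (auto intro!: exI[of _ "{s}"] exI[of _ "\<lambda>_. c"])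

lemma cspan_zero: "(\<lambda>x. 0) \<in> cspan S"
  unfolding cspan_def by (auto intro!: exI[of _ "{}"])

lemma cspan_add:
  assumes "F \<in> cspan S" "G \<in> cspan S"
  shows "(\<lambda>x. F x + G x) \<in> cspan S"
proof -
  obtain A a where F: "F = (\<lambda>x. \<Sum>s\<in>A. a s * s x)" "finite A" "A \<subseteq> S"
    using assms(1) by (auto simp: cspan_def)
  obtain B b where G: "G = (\<lambda>x. \<Sum>s\<in>B. b s * s x)" "finite B" "B \<subseteq> S"
    using assms(2) by (auto simp: cspan_def)
  \<comment> \<open>The two index sets of functions may overlap, so coefficients are extended by
    zero and added on the union.\<close>
  let ?c = "\<lambda>s. (if s \<in> A then a s else 0) + (if s \<in> B then b s else 0)"
  have "F x = (\<Sum>s\<in>A \<union> B. (if s \<in> A then a s else 0) * s x)" for x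
    unfolding F(1) using F(2) G(2) by (intro sum.mono_neutral_cong_left) auto
  moreover have "G x = (\<Sum>s\<in>A \<union> B. (if s \<in> B then b s else 0) * s x)" for x
    unfolding G(1) using F(2) G(2) by (intro sum.mono_neutral_cong_left) auto
  ultimately have "(\<lambda>x. F x + G x) = (\<lambda>x. \<Sum>s\<in>A \<union> B. ?c s * s x)"
    by (simp add: distrib_right sum.distrib)
  then show ?thesis
    unfolding cspan_def using F G by (intro CollectI exI[of _ "A \<union> B"] exI[of _ ?c]) auto
qed

lemma cspan_sum:
  assumes "finite I" "\<And>i. i \<in> I \<Longrightarrow> F i \<in> cspan S"
  shows "(\<lambda>x. \<Sum>i\<in>I. F i x) \<in> cspan S"
  using assms
proof (induction I rule: finite_induct)
  case (insert i I)
  then have "(\<lambda>x. F i x + (\<Sum>i\<in>I. F i x)) \<in> cspan S" by (intro cspan_add) auto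
  with insert show ?case by simp
qed (simp add: cspan_zero)

lemma cspan_mono: "S \<subseteq> T \<Longrightarrow> cspan S \<subseteq> cspan T"
  unfolding cspan_def by blast

lemma cspan_subset_test_funs:
  assumes "S \<subseteq> test_funs d U"
  shows "cspan S \<subseteq> test_funs d U"
proof
  fix F assume "F \<in> cspan S"
  then obtain A c where F: "F = (\<lambda>x. \<Sum>s\<in>A. c s * s x)" and A: "finite A" "A \<subseteq> S"
    by (auto simp: cspan_def)
  have "(\<lambda>x. \<Sum>s\<in>A. c s * s x) \<in> test_funs d U"
    using A
  proof (induction A rule: finite_induct)
    case (insert s A)
    then have "(\<lambda>x. c s * s x + 1 * (\<Sum>s\<in>A. c s * s x)) \<in> test_funs d U"
      using assms by (intro test_funs_lincomb[of s d U "\<lambda>x. \<Sum>s\<in>A. c s * s x"]) auto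
    with insert show ?case by simp
  qed (simp add: zero_in_test_funs)
  with F show "F \<in> test_funs d U" by simp
qed

section \<open>The quasi-interpolant and its error\<close>

definition grid :: "nat \<Rightarrow> nat \<Rightarrow> (nat \<Rightarrow> int) set" where
  "grid d N = Pi\<^sub>E {..<d} (\<lambda>_. {- int N..int N})"

definition node :: "nat \<Rightarrow> real \<Rightarrow> (nat \<Rightarrow> int) \<Rightarrow> (nat \<Rightarrow> real)" where
  "node d h \<kappa> = (\<lambda>i\<in>{..<d}. h * of_int (\<kappa> i))"

definition bump :: "nat \<Rightarrow> real \<Rightarrow> (nat \<Rightarrow> int) \<Rightarrow> cfun" where
  "bump d h \<kappa> = ctensor d (\<lambda>i t. hat (t / h - of_int (\<kappa> i)))"

lemma finite_grid: "finite (grid d N)"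
  by (simp add: grid_def finite_PiE)

lemma node_topspace: "node d h \<kappa> \<in> topspace (euc d)"
  by (simp add: node_def topspace_euc)

lemma sum_grid_prod:
  fixes g :: "nat \<Rightarrow> real \<Rightarrow> real"
  shows "(\<Sum>\<kappa>\<in>grid d N. \<Prod>i<d. g i (z i - of_int (\<kappa> i))) =
    (\<Prod>i<d. \<Sum>k\<in>{- int N..int N}. g i (z i - of_int k))"
  unfolding grid_def by (rule prod_sum_PiE[symmetric]) auto

text \<open>Distributivity splits the sum over the grid into \<open>d\<close> sums over integers,
  each with at most three nonzero terms. The bound depends on neither the grid size nor the
  scale.\<close>

lemma sum_grid_abs_prod_le:
  fixes g :: "nat \<Rightarrow> real \<Rightarrow> real"
  assumes "\<And>i t. \<bar>g i t\<bar> \<le> C" "\<And>i t. \<bar>t\<bar> > 1 \<Longrightarrow> g i t = 0" "C \<ge> 0"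
  shows "(\<Sum>\<kappa>\<in>grid d N. \<bar>\<Prod>i<d. g i (z i - of_int (\<kappa> i))\<bar>) \<le> (3 * C) ^ d"
proof -
  have "(\<Sum>\<kappa>\<in>grid d N. \<bar>\<Prod>i<d. g i (z i - of_int (\<kappa> i))\<bar>) =
      (\<Prod>i<d. \<Sum>k\<in>{- int N..int N}. \<bar>g i (z i - of_int k)\<bar>)"
    using sum_grid_prod[of "\<lambda>i t. \<bar>g i t\<bar>" z d N] by (simp add: abs_prod)
  also have "\<dots> \<le> (\<Prod>i<d. 3 * C)"
    using assms by (intro prod_mono conjI sum_nonneg sum_abs_shift_le) auto
  finally show ?thesis by simp
qed

lemma smooth1_hat_scaled: "smooth1 (\<lambda>t. hat (t / h - c))"
  using smooth1_affine[OF smooth1_hat, of "1 / h" "- c"] by simp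

lemma deriv_hat_scaled: "deriv (\<lambda>t. hat (t / h - c)) t = deriv hat (t / h - c) / h"
proof -
  have "((\<lambda>t. hat (t / h - c)) has_real_derivative deriv hat (t / h - c) * (1 / h)) (at t)"
  proof (rule DERIV_chain2[OF smooth1_DERIV[OF smooth1_hat]])
    show "((\<lambda>t. t / h - c) has_real_derivative 1 / h) (at t)"
      by (cases "h = 0") (auto intro!: derivative_eq_intros)
  qed
  then show ?thesis by (simp add: DERIV_imp_deriv)
qed

lemma smooth_bump: "smooth d (bump d h \<kappa>)"
  unfolding bump_def by (intro smooth_ctensor(1) smooth1_hat_scaled)

lemma partial_deriv_bump:
  assumes "x \<in> topspace (euc d)" "k < d"
  shows "partial_deriv k (bump d h \<kappa>) x =
    of_real (1 / h * (\<Prod>i<d. (if i = k then deriv hat else hat) (x i / h - of_int (\<kappa> i))))"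
proof -
  let ?g = "\<lambda>i. (if i = k then deriv hat else hat) (x i / h - of_int (\<kappa> i))"
  have rem: "(\<Prod>i<d. f i) = f k * (\<Prod>i\<in>{..<d} - {k}. f i)" for f :: "nat \<Rightarrow> real"
    using assms(2) by (intro prod.remove) auto
  have "partial_deriv k (bump d h \<kappa>) x = ctensor d (\<lambda>i. if i = k
      then deriv (\<lambda>t. hat (t / h - of_int (\<kappa> i))) else (\<lambda>t. hat (t / h - of_int (\<kappa> i)))) x"
    unfolding bump_def using assms by (intro smooth_ctensor(2) smooth1_hat_scaled)
  also have "\<dots> = of_real (\<Prod>i<d. if i = k then deriv hat (x i / h - of_int (\<kappa> i)) / h
      else hat (x i / h - of_int (\<kappa> i)))"
    unfolding ctensor_def by (intro arg_cong[of _ _ of_real] prod.cong) (auto simp: deriv_hat_scaled)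
  also have "\<dots> = of_real (1 / h * (\<Prod>i<d. ?g i))"
    by (subst (1 2) rem) (auto intro!: arg_cong[of _ _ of_real] prod.cong)
  finally show ?thesis .
qed

lemma bump_eq_0:
  assumes "h > 0" "i < d" "\<bar>x i - node d h \<kappa> i\<bar> > h"
  shows "bump d h \<kappa> x = 0" "j < d \<Longrightarrow> x \<in> topspace (euc d) \<Longrightarrow> partial_deriv j (bump d h \<kappa>) x = 0"
proof -
  have "x i / h - of_int (\<kappa> i) = (x i - node d h \<kappa> i) / h"
    using assms by (simp add: node_def field_simps)
  then have *: "\<bar>x i / h - of_int (\<kappa> i)\<bar> > 1"
    using assms by simp
  then have "(\<Prod>i<d. hat (x i / h - of_int (\<kappa> i))) = 0"
    using assms(2) by (intro prod_zero bexI[of _ i]) (auto simp: hat_eq_0)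
  then show "bump d h \<kappa> x = 0" by (simp only: bump_def ctensor_def of_real_0)
  have "(\<Prod>i<d. (if i = j then deriv hat else hat) (x i / h - of_int (\<kappa> i))) = 0" for j
    using assms(2) * by (intro prod_zero bexI[of _ i]) (auto simp: hat_eq_0 deriv_hat_eq_0)
  then show "partial_deriv j (bump d h \<kappa>) x = 0" if "j < d" "x \<in> topspace (euc d)"
    by (simp only: partial_deriv_bump[OF that(2,1)]) simp
qed

text \<open>The first-order Taylor polynomial of \<open>f\<close> at \<open>y\<close>; it vanishes
  identically when \<open>y\<close> is off the support of \<open>f\<close>.\<close>

definition jet :: "nat \<Rightarrow> cfun \<Rightarrow> (nat \<Rightarrow> real) \<Rightarrow> cfun" where
  "jet d f y x = f y + (\<Sum>j<d. partial_deriv j f y * of_real (x j - y j))"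

text \<open>All grid nodes are summed, so that the partition of unity applies without restriction;
  nodes off the support contribute zero and do not spoil the supports.\<close>

definition quasi_interp :: "nat \<Rightarrow> real \<Rightarrow> nat \<Rightarrow> cfun \<Rightarrow> cfun" where
  "quasi_interp d h N f x = (\<Sum>\<kappa>\<in>grid d N. jet d f (node d h \<kappa>) x * bump d h \<kappa> x)"

lemma partial_deriv_quasi_interp:
  assumes x: "x \<in> topspace (euc d)" and k: "k < d"
  shows "partial_deriv k (quasi_interp d h N f) x =
    (\<Sum>\<kappa>\<in>grid d N. partial_deriv k f (node d h \<kappa>) * bump d h \<kappa> x +
      jet d f (node d h \<kappa>) x * partial_deriv k (bump d h \<kappa>) x)"
proof -
  have jet: "((\<lambda>t. jet d f y (x(k := t))) has_vector_derivative partial_deriv k f y) (at (x k))" for y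
  proof -
    have "((\<lambda>t. partial_deriv j f y * of_real ((x(k := t)) j - y j)) has_vector_derivative
        (if j = k then partial_deriv k f y else 0)) (at (x k))" for j
      by (cases "j = k") (auto intro!: derivative_eq_intros)
    then have "((\<lambda>t. f y + (\<Sum>j<d. partial_deriv j f y * of_real ((x(k := t)) j - y j))) has_vector_derivative
        0 + (\<Sum>j<d. if j = k then partial_deriv k f y else 0)) (at (x k))"
      by (intro has_vector_derivative_add has_vector_derivative_sum has_vector_derivative_const)
    then show ?thesis using k by (simp add: jet_def)
  qed
  have "((\<lambda>t. bump d h \<kappa> (x(k := t))) has_vector_derivative partial_deriv k (bump d h \<kappa>) x) (at (x k))" for \<kappa>
    using smooth_partial_derivative[OF smooth_bump k x, of h \<kappa> "x k"] by simp
  then have "((\<lambda>t. quasi_interp d h N f (x(k := t))) has_vector_derivative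
      (\<Sum>\<kappa>\<in>grid d N. jet d f (node d h \<kappa>) (x(k := x k)) * partial_deriv k (bump d h \<kappa>) x +
        partial_deriv k f (node d h \<kappa>) * bump d h \<kappa> (x(k := x k)))) (at (x k))"
    unfolding quasi_interp_def by (intro has_vector_derivative_sum has_vector_derivative_mult jet)
  then show ?thesis
    unfolding partial_deriv_apply[of k "quasi_interp d h N f"]
    by (simp add: vector_derivative_at add.commute)
qed

text \<open>The bumps sum to 1 and their derivatives to 0, so \<open>f x\<close> may be distributed
  over the nodes. The \<open>real d\<close> part of the constant is the Taylor error, the extra 1
  comes from the gradient at \<open>x\<close> against that at the node.\<close>

lemma quasi_interp_error:
  assumes f: "smooth d f" and h: "h > 0" "h \<le> 1" and \<omega>: "\<omega> \<ge> 0"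
    and osc: "\<forall>y\<in>topspace (euc d). \<forall>u\<in>sball d y h. \<forall>k<d. cmod (partial_deriv k f u - partial_deriv k f y) \<le> \<omega>"
    and x: "x \<in> topspace (euc d)" "\<And>i. i < d \<Longrightarrow> \<bar>x i\<bar> < real N * h"
    and C: "C \<ge> 1" "\<And>t. \<bar>deriv hat t\<bar> \<le> C"
  shows "cmod (f x - quasi_interp d h N f x) \<le> (real d + 1) * (3 * C) ^ d * \<omega>"
    and "k < d \<Longrightarrow> cmod (partial_deriv k f x - partial_deriv k (quasi_interp d h N f) x) \<le>
      (real d + 1) * (3 * C) ^ d * \<omega>"
proof -
  let ?K = "grid d N" and ?b = "\<lambda>\<kappa>. bump d h \<kappa> x" and ?y = "node d h"
  have xh: "\<bar>x i / h\<bar> < real N" if "i < d" for i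
    using x(2)[OF that] h(1) by (simp add: field_simps)
  have sum1: "(\<Sum>\<kappa>\<in>?K. ?b \<kappa>) = 1"
  proof -
    have "(\<Sum>\<kappa>\<in>?K. ?b \<kappa>) = of_real (\<Sum>\<kappa>\<in>?K. \<Prod>i<d. hat (x i / h - of_int (\<kappa> i)))"
      by (simp only: bump_def ctensor_def of_real_sum)
    also have "\<dots> = of_real (\<Prod>i<d. 1)"
      unfolding sum_grid_prod[of "\<lambda>_. hat" "\<lambda>i. x i / h"]
      using sum_hat(1)[OF xh] by (intro arg_cong[of _ _ of_real] prod.cong) auto
    finally show ?thesis by simp
  qed
  have sum0: "(\<Sum>\<kappa>\<in>?K. partial_deriv k (bump d h \<kappa>) x) = 0" if k: "k < d" for k
  proof -
    have "(\<Sum>\<kappa>\<in>?K. partial_deriv k (bump d h \<kappa>) x) =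
        of_real (1 / h * (\<Sum>\<kappa>\<in>?K. \<Prod>i<d. (if i = k then deriv hat else hat) (x i / h - of_int (\<kappa> i))))"
      by (simp only: partial_deriv_bump[OF x(1) k] of_real_sum sum_distrib_left)
    also have "(\<Sum>\<kappa>\<in>?K. \<Prod>i<d. (if i = k then deriv hat else hat) (x i / h - of_int (\<kappa> i))) = 0"
      unfolding sum_grid_prod[of "\<lambda>i. if i = k then deriv hat else hat" "\<lambda>i. x i / h"]
      using sum_hat(2)[OF xh[OF k]] k by (intro prod_zero bexI[of _ k]) auto
    finally show ?thesis by simp
  qed
  \<comment> \<open>One constant covers differentiated and undifferentiated factors, so products
    with a single differentiated factor need no separate count.\<close>
  have g: "\<bar>(if i = k then deriv hat else hat) t\<bar> \<le> C" "\<bar>hat t\<bar> \<le> C"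
    "\<bar>t\<bar> > 1 \<Longrightarrow> (if i = k then deriv hat else hat) t = 0" for i k :: nat and t
    using C(1) C(2)[of t] abs_hat_le_1[of t] by (auto simp: hat_eq_0 deriv_hat_eq_0)
  have abs1: "(\<Sum>\<kappa>\<in>?K. cmod (?b \<kappa>)) \<le> (3 * C) ^ d"
    using sum_grid_abs_prod_le[of "\<lambda>_. hat" C "\<lambda>i. x i / h" d N] g(2) C(1)
    by (simp only: bump_def ctensor_def norm_of_real) (simp add: hat_eq_0)
  have abs0: "(\<Sum>\<kappa>\<in>?K. cmod (partial_deriv k (bump d h \<kappa>) x)) \<le> (3 * C) ^ d / h" if k: "k < d" for k
  proof -
    have "(\<Sum>\<kappa>\<in>?K. cmod (partial_deriv k (bump d h \<kappa>) x)) =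
        1 / h * (\<Sum>\<kappa>\<in>?K. \<bar>\<Prod>i<d. (if i = k then deriv hat else hat) (x i / h - of_int (\<kappa> i))\<bar>)"
      using h(1) by (simp only: partial_deriv_bump[OF x(1) k] norm_of_real abs_mult sum_distrib_left) simp
    also have "\<dots> \<le> 1 / h * (3 * C) ^ d"
      using h(1) C(1) g(1,3)
      by (intro mult_left_mono sum_grid_abs_prod_le[of "\<lambda>i. if i = k then deriv hat else hat" C "\<lambda>i. x i / h"]) auto
    finally show ?thesis by simp
  qed
  have near: "x \<in> sball d (?y \<kappa>) h" if "\<not> (\<exists>i<d. \<bar>x i - ?y \<kappa> i\<bar> > h)" for \<kappa>
    using that x(1) unfolding sball_def by (auto simp only: mem_Collect_eq not_less not_ex not_all)
  have T: "cmod (f x - jet d f (?y \<kappa>) x) \<le> real d * (h * \<omega>)" if "x \<in> sball d (?y \<kappa>) h" for \<kappa>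
    unfolding jet_def
    by (rule taylor_sball[OF f x(1) node_topspace])
      (use that osc node_topspace h \<omega> in \<open>auto simp: sball_def\<close>)
  \<comment> \<open>Here \<open>u\<close> stands for a bump or for its derivative; both vanish at
    distance more than \<open>h\<close> from the node, which is where no Taylor bound is
    available.\<close>
  have Tb: "cmod ((f x - jet d f (?y \<kappa>) x) * u) \<le> real d * (h * \<omega>) * cmod u"
    if "\<exists>i<d. \<bar>x i - ?y \<kappa> i\<bar> > h \<Longrightarrow> u = 0" for \<kappa> u
    using that T[OF near[of \<kappa>]] by (cases "\<exists>i<d. \<bar>x i - ?y \<kappa> i\<bar> > h") (auto simp: norm_mult mult_right_mono)
  have Db: "cmod ((partial_deriv k f x - partial_deriv k f (?y \<kappa>)) * u) \<le> \<omega> * cmod u"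
    if "\<exists>i<d. \<bar>x i - ?y \<kappa> i\<bar> > h \<Longrightarrow> u = 0" "k < d" for \<kappa> u k
  proof (cases "\<exists>i<d. \<bar>x i - ?y \<kappa> i\<bar> > h")
    case False
    with near[of \<kappa>] osc node_topspace[of d h \<kappa>] that(2)
    have "cmod (partial_deriv k f x - partial_deriv k f (?y \<kappa>)) \<le> \<omega>" by blast
    then show ?thesis by (simp add: norm_mult mult_right_mono)
  qed (use that in auto)
  let ?M = "(3 * C) ^ d"
  have M: "?M \<ge> 0" using C(1) by simp
  have zb: "?b \<kappa> = 0" if "\<exists>i<d. \<bar>x i - ?y \<kappa> i\<bar> > h" for \<kappa>
    using that bump_eq_0(1)[OF h(1)] by blast
  have zd: "partial_deriv k (bump d h \<kappa>) x = 0" if "\<exists>i<d. \<bar>x i - ?y \<kappa> i\<bar> > h" "k < d" for \<kappa> k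
    using that bump_eq_0(2)[OF h(1)] x(1) by blast
  have "f x - quasi_interp d h N f x = (\<Sum>\<kappa>\<in>?K. (f x - jet d f (?y \<kappa>) x) * ?b \<kappa>)"
    using sum1 by (simp add: quasi_interp_def left_diff_distrib sum_subtractf flip: sum_distrib_left)
  also have "cmod \<dots> \<le> (\<Sum>\<kappa>\<in>?K. real d * (h * \<omega>) * cmod (?b \<kappa>))"
    by (intro sum_norm_le Tb zb)
  also have "\<dots> = real d * (h * \<omega>) * (\<Sum>\<kappa>\<in>?K. cmod (?b \<kappa>))" by (simp only: sum_distrib_left)
  also have "\<dots> \<le> real d * (1 * \<omega>) * ?M"
    using h \<omega> abs1 by (intro mult_mono mult_left_mono mult_right_mono) (auto intro: sum_nonneg)
  also have "\<dots> \<le> (real d + 1) * ?M * \<omega>"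
    using M \<omega> by (simp add: algebra_simps)
  finally show "cmod (f x - quasi_interp d h N f x) \<le> (real d + 1) * ?M * \<omega>" .
  assume k: "k < d"
  let ?db = "\<lambda>\<kappa>. partial_deriv k (bump d h \<kappa>) x"
  \<comment> \<open>The sums equal to 1 and 0 are inserted so that the difference can be collected
    node by node.\<close>
  have "partial_deriv k f x - partial_deriv k (quasi_interp d h N f) x =
      partial_deriv k f x * (\<Sum>\<kappa>\<in>?K. ?b \<kappa>) + f x * (\<Sum>\<kappa>\<in>?K. ?db \<kappa>) -
      (\<Sum>\<kappa>\<in>?K. partial_deriv k f (?y \<kappa>) * ?b \<kappa> + jet d f (?y \<kappa>) x * ?db \<kappa>)"
    by (simp only: sum1 sum0[OF k] partial_deriv_quasi_interp[OF x(1) k]) simp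
  also have "\<dots> = (\<Sum>\<kappa>\<in>?K. (partial_deriv k f x - partial_deriv k f (?y \<kappa>)) * ?b \<kappa>) +
      (\<Sum>\<kappa>\<in>?K. (f x - jet d f (?y \<kappa>) x) * ?db \<kappa>)" (is "_ = ?S1 + ?S2")
    by (simp add: left_diff_distrib sum_subtractf sum.distrib sum_distrib_left)
  finally have eq: "partial_deriv k f x - partial_deriv k (quasi_interp d h N f) x = ?S1 + ?S2" .
  have "cmod ?S1 \<le> (\<Sum>\<kappa>\<in>?K. \<omega> * cmod (?b \<kappa>))"
    using k by (intro sum_norm_le Db zb)
  also have "\<dots> \<le> \<omega> * ?M"
    unfolding sum_distrib_left[symmetric] using \<omega> abs1 by (intro mult_left_mono) auto
  finally have S1: "cmod ?S1 \<le> \<omega> * ?M" .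
  have "cmod ?S2 \<le> (\<Sum>\<kappa>\<in>?K. real d * (h * \<omega>) * cmod (?db \<kappa>))"
    using k by (intro sum_norm_le Tb zd)
  also have "\<dots> \<le> real d * (h * \<omega>) * (?M / h)"
    unfolding sum_distrib_left[symmetric] using h \<omega> abs0[OF k] by (intro mult_left_mono) auto
  also have "\<dots> = real d * \<omega> * ?M" using h(1) by simp
  finally have S2: "cmod ?S2 \<le> real d * \<omega> * ?M" .
  show "cmod (partial_deriv k f x - partial_deriv k (quasi_interp d h N f) x) \<le> (real d + 1) * ?M * \<omega>"
    unfolding eq using norm_triangle_mono[OF S1 S2] by (simp add: algebra_simps)
qed

section \<open>Approximation by elementary tensors\<close>

lemma ctensor_add:
  "ctensor (a + b) \<theta> = tens a b (ctensor a \<theta>) (ctensor b (\<lambda>i. \<theta> (a + i)))"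
  by (simp add: ctensor_def tens_def prod_lessThan_add fst_blk_def snd_blk_def fun_eq_iff)

text \<open>The passage from single coordinates to blocks: a product over coordinates is finer than
  the division into blocks.\<close>

lemma ctensor_eq_elem_tensor:
  "ctensor (total_dim n d) \<theta> = elem_tensor n d (\<lambda>j. ctensor (d j) (\<lambda>i. \<theta> ((\<Sum>l<j. d l) + i)))"
proof (induction n)
  case 0
  show ?case by (simp add: total_dim_def ctensor_def elem_tensor_def)
next
  case (Suc n)
  then show ?case
    by (simp add: total_dim_Suc elem_tensor_Suc ctensor_add) (simp add: total_dim_def)
qed

lemma block_box_subset:
  assumes sub: "sball (total_dim n d) y h \<subseteq> prod_set n d U" and y: "y \<in> topspace (euc (total_dim n d))"
    and j: "j < n" and h: "h \<ge> 0"
  shows "Pi\<^sub>E {..<d j} (\<lambda>i. {y ((\<Sum>l<j. d l) + i) - h..y ((\<Sum>l<j. d l) + i) + h}) \<subseteq> U j"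
proof
  let ?o = "\<Sum>l<j. d l" and ?D = "total_dim n d"
  fix z assume z: "z \<in> Pi\<^sub>E {..<d j} (\<lambda>i. {y (?o + i) - h..y (?o + i) + h})"
  \<comment> \<open>The given point of block \<open>j\<close> is completed by the coordinates of
    \<open>y\<close>; the result stays in the cube, hence in the product set.\<close>
  define w where "w = (\<lambda>i. if ?o \<le> i \<and> i < ?o + d j then z (i - ?o) else y i)"
  have "?o + d j \<le> ?D"
  proof -
    have "?o + d j = (\<Sum>l<Suc j. d l)" by simp
    also have "\<dots> \<le> ?D" unfolding total_dim_def using j by (intro sum_mono2) auto
    finally show ?thesis .
  qed
  then have wt: "w \<in> topspace (euc ?D)"
    using y by (auto simp: w_def topspace_euc PiE_iff extensional_def)
  have "\<bar>w i - y i\<bar> \<le> h" for i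
  proof (cases "?o \<le> i \<and> i < ?o + d j")
    case True
    then have "z (i - ?o) \<in> {y (?o + (i - ?o)) - h..y (?o + (i - ?o)) + h}"
      by (intro PiE_mem[OF z, of "i - ?o"]) (simp add: less_diff_conv2)
    with True show ?thesis by (auto simp: w_def abs_le_iff)
  qed (use h in \<open>auto simp: w_def\<close>)
  with wt have "w \<in> sball ?D y h" by (simp add: sball_def)
  with sub j have "block d j w \<in> U j" by (auto simp: prod_set_def)
  moreover have "block d j w = z"
    using z by (auto simp: block_def w_def fun_eq_iff PiE_iff extensional_def)
  ultimately show "z \<in> U j" by simp
qed

text \<open>Both properties are recorded: the product being a test function keeps spans inside the
  test functions, and the factors being test functions places them in \<open>H01\<close> of each
  block.\<close>

definition tensor_tests :: "nat \<Rightarrow> (nat \<Rightarrow> nat) \<Rightarrow> (nat \<Rightarrow> (nat \<Rightarrow> real) set) \<Rightarrow> cfun set" where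
  "tensor_tests n d U = {F \<in> test_funs (total_dim n d) (prod_set n d U).
     \<exists>f. F = elem_tensor n d f \<and> (\<forall>j<n. f j \<in> test_funs (d j) (U j))}"

lemma ctensor_in_tensor_tests:
  assumes sub: "sball (total_dim n d) y h \<subseteq> prod_set n d U" and y: "y \<in> topspace (euc (total_dim n d))"
    and h: "h \<ge> 0" and \<theta>: "\<And>i. smooth1 (\<theta> i)" "\<And>i t. i < total_dim n d \<Longrightarrow> \<bar>t - y i\<bar> > h \<Longrightarrow> \<theta> i t = 0"
  shows "ctensor (total_dim n d) \<theta> \<in> tensor_tests n d U"
proof -
  let ?D = "total_dim n d"
  have out: "\<theta> i t = 0" if "i < ?D" "t \<notin> {y i - h..y i + h}" for i t
    using that by (intro \<theta>(2)) (auto simp: abs_le_iff not_le)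
  have "Pi\<^sub>E {..<?D} (\<lambda>i. {y i - h..y i + h}) \<subseteq> sball ?D y h"
  proof
    fix x assume x: "x \<in> Pi\<^sub>E {..<?D} (\<lambda>i. {y i - h..y i + h})"
    have "\<bar>x i - y i\<bar> \<le> h" if "i < ?D" for i
      using PiE_mem[OF x, of i] that by (auto simp: abs_le_iff)
    with x show "x \<in> sball ?D y h" by (auto simp: sball_def topspace_euc PiE_iff)
  qed
  with sub have "ctensor ?D \<theta> \<in> test_funs ?D (prod_set n d U)"
    using \<theta>(1) out by (intro test_funs_ctensor[of _ _ "\<lambda>i. y i - h" "\<lambda>i. y i + h"]) auto
  moreover have "ctensor (d j) (\<lambda>i. \<theta> ((\<Sum>l<j. d l) + i)) \<in> test_funs (d j) (U j)" if "j < n" for j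
    using \<theta>(1) out block_less_total_dim[OF that]
    by (intro test_funs_ctensor[OF _ block_box_subset[OF sub y that h]]) auto
  ultimately show ?thesis
    unfolding tensor_tests_def ctensor_eq_elem_tensor[of n d \<theta>] by blast
qed

lemma jet_eq_0:
  assumes "y \<in> topspace (euc d)" "y \<notin> supp d f"
  shows "jet d f y x = 0"
  using assms by (simp add: jet_def not_in_supp partial_deriv_not_in_supp)

lemma quasi_interp_in_cspan:
  assumes h: "h > 0" and sub: "\<forall>y\<in>supp (total_dim n d) f. sball (total_dim n d) y h \<subseteq> prod_set n d U"
  shows "quasi_interp (total_dim n d) h N f \<in> cspan (tensor_tests n d U)"
  unfolding quasi_interp_def[abs_def]
proof (rule cspan_sum[OF finite_grid])
  let ?D = "total_dim n d" and ?S = "tensor_tests n d U"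
  fix \<kappa>
  let ?y = "node ?D h \<kappa>"
  show "(\<lambda>x. jet ?D f ?y x * bump ?D h \<kappa> x) \<in> cspan ?S"
  proof (cases "?y \<in> supp ?D f")
    case False
    then show ?thesis by (simp add: jet_eq_0 node_topspace cspan_zero)
  next
    case True
    with sub have sub': "sball ?D ?y h \<subseteq> prod_set n d U" by blast
    have out: "hat (t / h - of_int (\<kappa> i)) = 0" if "i < ?D" "\<bar>t - ?y i\<bar> > h" for i t
    proof -
      have "t / h - of_int (\<kappa> i) = (t - ?y i) / h" using that h by (simp add: node_def field_simps)
      then show ?thesis using that h by (intro hat_eq_0) simp
    qed
    \<comment> \<open>A linear term of the jet times the bump is again a product of functions of one
      variable: the monomial is absorbed into the \<open>j\<close>-th factor.\<close>
    define \<theta> where "\<theta> j = (\<lambda>i t. (if i = j then t - ?y j else 1) * hat (t / h - of_int (\<kappa> i)))" for j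
    have "smooth1 (\<lambda>t. t - c)" for c
      using smooth1_affine[OF smooth1_id, of 1 "- c"] by simp
    then have sm: "smooth1 (\<theta> j i)" for i j
      unfolding \<theta>_def
      by (intro smooth1_mult smooth1_hat_scaled) (cases "i = j"; simp add: smooth1_const)
    have 1: "bump ?D h \<kappa> \<in> ?S"
      unfolding bump_def
      by (rule ctensor_in_tensor_tests[OF sub' node_topspace less_imp_le[OF h] smooth1_hat_scaled out])
    have 2: "ctensor ?D (\<theta> j) \<in> ?S" for j
      by (rule ctensor_in_tensor_tests[OF sub' node_topspace less_imp_le[OF h] sm])
        (simp add: \<theta>_def out)
    have ct: "ctensor ?D (\<theta> j) x = of_real (x j - ?y j) * bump ?D h \<kappa> x" if "j < ?D" for j x
    proof -
      have "(\<Prod>i<?D. \<theta> j i (x i)) =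
          (\<Prod>i<?D. if i = j then x j - ?y j else 1) * (\<Prod>i<?D. hat (x i / h - of_int (\<kappa> i)))"
        unfolding prod.distrib[symmetric] by (rule prod.cong) (auto simp: \<theta>_def)
      also have "(\<Prod>i<?D. if i = j then x j - ?y j else 1) = x j - ?y j"
        using that by simp
      finally show ?thesis by (simp only: ctensor_def bump_def of_real_mult)
    qed
    have "(\<lambda>x. jet ?D f ?y x * bump ?D h \<kappa> x) =
        (\<lambda>x. f ?y * bump ?D h \<kappa> x + (\<Sum>j<?D. partial_deriv j f ?y * ctensor ?D (\<theta> j) x))"
      by (simp add: jet_def distrib_right sum_distrib_right ct mult.assoc fun_eq_iff)
    also have "\<dots> \<in> cspan ?S"
      by (intro cspan_add cspan_sum cspan_scale_base 1 2) auto
    finally show ?thesis .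
  qed
qed

text \<open>Contributing nodes have coordinates of modulus at most \<open>R\<close>, and a bump
  reaches at most \<open>h \<le> 1\<close> further.\<close>

lemma quasi_interp_eq_0:
  assumes h: "h > 0" "h \<le> 1" and R: "\<And>y i. y \<in> supp d f \<Longrightarrow> i < d \<Longrightarrow> \<bar>y i\<bar> \<le> R"
    and i: "i < d" "\<bar>x i\<bar> > R + 1"
  shows "quasi_interp d h N f x = 0"
  unfolding quasi_interp_def
proof (rule sum.neutral, rule ballI)
  fix \<kappa>
  show "jet d f (node d h \<kappa>) x * bump d h \<kappa> x = 0"
  proof (cases "node d h \<kappa> \<in> supp d f")
    case True
    have "\<bar>x i - node d h \<kappa> i\<bar> > h" using R[OF True i(1)] i(2) h(2) by linarith
    then show ?thesis using bump_eq_0(1)[OF h(1) i(1)] by simp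
  qed (simp add: jet_eq_0 node_topspace)
qed

lemma test_funs_approx_tensor_tests:
  assumes W: "openin (euc (total_dim n d)) (prod_set n d U)"
    and f: "f \<in> test_funs (total_dim n d) (prod_set n d U)" and \<epsilon>: "\<epsilon> > 0"
  shows "\<exists>P\<in>cspan (tensor_tests n d U). H1_norm (total_dim n d) (prod_set n d U) (\<lambda>x. f x - P x) < \<epsilon>"
proof -
  let ?D = "total_dim n d" and ?W = "prod_set n d U"
  note f' = test_funsD[OF f]
  obtain R where R: "R > 0" "\<And>y i. y \<in> supp ?D f \<Longrightarrow> i < ?D \<Longrightarrow> \<bar>y i\<bar> \<le> R"
    using compactin_euc_bounded[OF f'(2)] by metis
  obtain C where C: "C \<ge> 1" "\<And>t. \<bar>deriv hat t\<bar> \<le> C" using deriv_hat_bounded by metis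
  \<comment> \<open>\<open>M\<close> is the constant of \<open>quasi_interp_error\<close>,
    \<open>V\<close> the volume of the cube of radius \<open>R + 1\<close> outside which both
    functions vanish, and \<open>K\<close> adds up the function and its partial derivatives. The
    extra 1 makes the final inequality strict.\<close>
  define M where "M = (real ?D + 1) * (3 * C) ^ ?D"
  define V where "V = (2 * (R + 1)) ^ ?D"
  define K where "K = (real ?D + 1) * (M\<^sup>2 * V) + 1"
  have V: "V \<ge> 0" using R(1) by (simp add: V_def)
  have K: "K > 0" using V by (simp add: K_def add_nonneg_pos)
  define \<omega> where "\<omega> = \<epsilon> / sqrt K"
  have \<omega>: "\<omega> > 0" using K \<epsilon> by (simp add: \<omega>_def)
  have \<omega>2: "\<omega>\<^sup>2 * K = \<epsilon>\<^sup>2" using K by (simp add: \<omega>_def power_divide)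
  obtain h where h: "h > 0" "h \<le> 1" and sub: "\<forall>y\<in>supp ?D f. sball ?D y h \<subseteq> ?W"
    and osc: "\<forall>y\<in>topspace (euc ?D). \<forall>u\<in>sball ?D y h. \<forall>k<?D. cmod (partial_deriv k f u - partial_deriv k f y) \<le> \<omega>"
    using test_funs_uniform_scale[OF W f \<omega>] by metis
  \<comment> \<open>The grid has to reach beyond the cube of radius \<open>R + 1\<close>, so that
    the partition of unity is complete there.\<close>
  obtain N :: nat where "real N > (R + 1) / h" using reals_Archimedean2 by blast
  then have N: "R + 1 < real N * h" using h(1) by (simp add: field_simps)
  define P where "P = quasi_interp ?D h N f"
  have Pc: "P \<in> cspan (tensor_tests n d U)"
    unfolding P_def by (rule quasi_interp_in_cspan[OF h(1) sub])
  then have Pt: "P \<in> test_funs ?D ?W"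
    using cspan_subset_test_funs[of "tensor_tests n d U"] by (auto simp: tensor_tests_def)
  have P0: "P x = 0" if "i < ?D" "\<bar>x i\<bar> > R + 1" for x i
    unfolding P_def using quasi_interp_eq_0[of h ?D f R i x N] h R(2) that by simp
  have "supp ?D P \<subseteq> Pi\<^sub>E {..<?D} (\<lambda>i. {- (R + 1)..R + 1})"
  proof (rule supp_subset[OF closedin_euc_box])
    fix x assume "x \<in> topspace (euc ?D)" "x \<notin> Pi\<^sub>E {..<?D} (\<lambda>i. {- (R + 1)..R + 1})"
    then obtain i where "i < ?D" "x i \<notin> {- (R + 1)..R + 1}" by (auto simp: topspace_euc PiE_iff)
    then show "P x = 0" by (intro P0[of i]) (auto simp: abs_le_iff not_le)
  qed
  then have outP: "x \<notin> supp ?D P" if "i < ?D" "\<bar>x i\<bar> > R + 1" for x i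
    using that PiE_mem[of x "{..<?D}" "\<lambda>i. {- (R + 1)..R + 1}" i] by (auto simp: abs_if split: if_splits)
  have outf: "x \<notin> supp ?D f" if "i < ?D" "\<bar>x i\<bar> > R + 1" for x i
    using R(2)[of x i] that by auto
  have Mw: "M * \<omega> \<ge> 0" using C(1) \<omega> by (simp add: M_def)
  \<comment> \<open>Either both functions and their derivatives vanish at \<open>x\<close>, or the
    error estimate for the full partition of unity is available.\<close>
  have dich: "(\<exists>i<?D. \<bar>x i\<bar> > R + 1) \<or> (\<forall>i<?D. \<bar>x i\<bar> < real N * h)" for x
    using N by (meson le_less_trans not_less)
  have bd0: "cmod (f x - P x) \<le> M * \<omega>" if x: "x \<in> topspace (euc ?D)" for x
    using dich[of x]
  proof
    assume "\<exists>i<?D. \<bar>x i\<bar> > R + 1"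
    then show ?thesis using not_in_supp[OF x outf] not_in_supp[OF x outP] Mw by auto
  next
    assume "\<forall>i<?D. \<bar>x i\<bar> < real N * h"
    then show ?thesis
      unfolding P_def M_def
      using quasi_interp_error(1)[OF f'(1) h less_imp_le[OF \<omega>] osc x _ C] by blast
  qed
  have bd1: "cmod (partial_deriv k f x - partial_deriv k P x) \<le> M * \<omega>"
    if x: "x \<in> topspace (euc ?D)" and k: "k < ?D" for x k
    using dich[of x]
  proof
    assume "\<exists>i<?D. \<bar>x i\<bar> > R + 1"
    then show ?thesis
      using partial_deriv_not_in_supp[OF k x outf] partial_deriv_not_in_supp[OF k x outP] Mw by auto
  next
    assume "\<forall>i<?D. \<bar>x i\<bar> < real N * h"
    then show ?thesis
      unfolding P_def M_def
      using quasi_interp_error(2)[OF f'(1) h less_imp_le[OF \<omega>] osc x _ C k] by blast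
  qed
  note P' = test_funsD[OF Pt]
  have R1: "R + 1 \<ge> 0" using R(1) by simp
  have s0: "sqn ?D ?W (\<lambda>x. f x - P x) \<le> (M * \<omega>)\<^sup>2 * V"
    unfolding V_def
  proof (rule L2_bounded(3)[OF W _ R1 _ bd0])
    show "(\<lambda>x. f x - P x) \<in> borel_measurable (lebn ?D)"
      by (rule continuous_map_euc_measurable[OF continuous_map_diff[OF
            smooth_imp_continuous[OF f'(1)] smooth_imp_continuous[OF P'(1)]]])
    show "f x - P x = 0" if "x \<in> topspace (euc ?D)" "i < ?D" "\<bar>x i\<bar> > R + 1" for x i
      using not_in_supp[OF that(1) outf[of i x, OF that(2,3)]] not_in_supp[OF that(1) outP[of i x, OF that(2,3)]] by simp
  qed
  have s1: "sqn ?D ?W (\<lambda>x. partial_deriv k f x - partial_deriv k P x) \<le> (M * \<omega>)\<^sup>2 * V" if k: "k < ?D" for k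
    unfolding V_def
  proof (rule L2_bounded(3)[OF W _ R1 _ bd1[OF _ k]])
    show "(\<lambda>x. partial_deriv k f x - partial_deriv k P x) \<in> borel_measurable (lebn ?D)"
      by (rule continuous_map_euc_measurable[OF continuous_map_diff[OF
            smooth_imp_continuous_partial[OF f'(1) k] smooth_imp_continuous_partial[OF P'(1) k]]])
    show "partial_deriv k f x - partial_deriv k P x = 0"
      if "x \<in> topspace (euc ?D)" "i < ?D" "\<bar>x i\<bar> > R + 1" for x i
      using partial_deriv_not_in_supp[OF k that(1) outf[of i x, OF that(2,3)]]
        partial_deriv_not_in_supp[OF k that(1) outP[of i x, OF that(2,3)]] by simp
  qed
  have "sqn ?D ?W (\<lambda>x. f x - P x) + (\<Sum>k<?D. sqn ?D ?W (\<lambda>x. partial_deriv k f x - partial_deriv k P x))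
      \<le> (M * \<omega>)\<^sup>2 * V + (\<Sum>k<?D. (M * \<omega>)\<^sup>2 * V)"
    by (intro add_mono sum_mono s0 s1) auto
  also have "\<dots> = \<omega>\<^sup>2 * (K - 1)" by (simp add: K_def power_mult_distrib algebra_simps)
  also have "\<dots> < \<omega>\<^sup>2 * K" using \<omega> by (intro mult_strict_left_mono) auto
  finally have "H1_norm ?D ?W (\<lambda>x. f x - P x) < \<epsilon>"
    using H1_norm_less_iff[OF W weak_grad_diff[OF W test_funs_weak_grad[OF W f] test_funs_weak_grad[OF W Pt]] \<epsilon>]
    by (simp add: \<omega>2)
  with Pc show ?thesis by blast
qed

lemma H01_prod_eq_tensor_H:
  assumes U: "\<And>j. j < n \<Longrightarrow> openin (euc (d j)) (U j)"
  shows "H01 (total_dim n d) (prod_set n d U) = tensor_H n d U (\<lambda>j. H01 (d j) (U j))"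
proof (intro equalityI subsetI)
  let ?D = "total_dim n d" and ?W = "prod_set n d U"
  let ?S = "{elem_tensor n d f | f. \<forall>j<n. f j \<in> H01 (d j) (U j)}"
  have W: "openin (euc ?D) ?W" by (rule openin_prod_set[OF U])
  {
    fix f assume f: "f \<in> H01 ?D ?W"
    have H1: "H01 ?D ?W \<subseteq> H1 ?D ?W" by (auto simp: H01_def H1_closure_def)
    have tests: "test_funs ?D ?W \<subseteq> H1 ?D ?W" using test_funs_subset_H01[OF W] H1 by blast
    have "tensor_tests n d U \<subseteq> ?S"
    proof
      fix F assume "F \<in> tensor_tests n d U"
      then obtain g where g: "F = elem_tensor n d g" "\<forall>j<n. g j \<in> test_funs (d j) (U j)"
        by (auto simp: tensor_tests_def)
      then have "\<forall>j<n. g j \<in> H01 (d j) (U j)" using test_funs_subset_H01[OF U] by auto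
      with g(1) show "F \<in> ?S" by auto
    qed
    note sub = cspan_mono[OF this]
    have "\<exists>P\<in>cspan ?S. H1_norm ?D ?W (\<lambda>x. f x - P x) < \<epsilon>" if "\<epsilon> > 0" for \<epsilon>
    proof -
      have e: "\<epsilon> / 2 > 0" using that by simp
      obtain \<phi> where \<phi>: "\<phi> \<in> test_funs ?D ?W" "H1_norm ?D ?W (\<lambda>x. f x - \<phi> x) < \<epsilon> / 2"
        using f e unfolding H01_def H1_closure_def by blast
      obtain P where P: "P \<in> cspan (tensor_tests n d U)" "H1_norm ?D ?W (\<lambda>x. \<phi> x - P x) < \<epsilon> / 2"
        using test_funs_approx_tensor_tests[OF W \<phi>(1) e] by blast
      have "P \<in> test_funs ?D ?W"
        using P(1) cspan_subset_test_funs[of "tensor_tests n d U"] by (auto simp: tensor_tests_def)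
      then have "H1_norm ?D ?W (\<lambda>x. f x - P x) < \<epsilon>"
        using f H1 \<phi> P(2) tests that by (intro H1_norm_diff_trans[OF W, of f \<phi> P]) auto
      with P(1) sub show ?thesis by blast
    qed
    with f H1 show "f \<in> tensor_H n d U (\<lambda>j. H01 (d j) (U j))"
      unfolding tensor_H_def H1_closure_def by blast
  }
  fix f assume f: "f \<in> tensor_H n d U (\<lambda>j. H01 (d j) (U j))"
  have "?S \<subseteq> H01 ?D ?W"
  proof
    fix F assume "F \<in> ?S"
    then obtain g where "F = elem_tensor n d g" "\<forall>j<n. g j \<in> H01 (d j) (U j)" by auto
    then show "F \<in> H01 ?D ?W" by (simp add: elem_tensor_H01[OF U])
  qed
  from H1_closure_subset_H01[OF W cspan_subset_H01[OF W this]] f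
  show "f \<in> H01 ?D ?W" unfolding tensor_H_def by blast
qed

section \<open>Hermitian symmetry and uniqueness of the form operator\<close>

lemma L2_inner_commute: "L2_inner d U g f = cnj (L2_inner d U f g)"
proof -
  have "cnj (L2_inner d U f g) = (\<integral>x. cnj (f x * cnj (g x)) \<partial>leb_on d U)"
    unfolding L2_inner_def by (rule Bochner_Integration.integral_cnj[symmetric])
  also have "(\<lambda>x. cnj (f x * cnj (g x))) = (\<lambda>x. g x * cnj (f x))" by (simp add: mult.commute)
  finally show ?thesis by (simp add: L2_inner_def)
qed

lemma grad_form_commute: "grad_form d U g f = cnj (grad_form d U f g)"
  unfolding grad_form_def cnj_sum by (intro sum.cong refl L2_inner_commute)

lemma form_op_subset:
  assumes T: "is_form_op d U H T" and S: "is_form_op d U H S"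
  shows "S \<subseteq> T"
proof
  fix p assume p: "p \<in> S"
  obtain g k where gk: "p = (g, k)" by (cases p)
  have L: "g \<in> L2 d U" "k \<in> L2 d U"
    using S p by (auto simp: gk is_form_op_def self_adjoint_def lin_op_def)
  have g: "g \<in> H" using S p by (auto simp: gk is_form_op_def Domain_iff)
  have "L2_inner d U Tf g = L2_inner d U f k" if f: "(f, Tf) \<in> T" for f Tf
  proof -
    have fH: "f \<in> H" using T f by (auto simp: is_form_op_def Domain_iff)
    \<comment> \<open>The form is read twice, with \<open>g\<close> as test vector for
      \<open>T\<close> and, after conjugation, with \<open>f\<close> as test vector for
      \<open>S\<close>; both readings rely on the operator domains lying in
      \<open>H\<close>.\<close>
    have "L2_inner d U Tf g = grad_form d U f g" using T f g by (auto simp: is_form_op_def)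
    also have "\<dots> = cnj (grad_form d U g f)" by (rule grad_form_commute)
    also have "grad_form d U g f = L2_inner d U k f" using S p fH by (auto simp: gk is_form_op_def)
    finally show ?thesis by (simp add: L2_inner_commute[of d U k f])
  qed
  with L have "(g, k) \<in> adjoint_op d U T" unfolding adjoint_op_def by blast
  with T gk show "p \<in> T" unfolding is_form_op_def self_adjoint_def by simp
qed

theorem proposition3p1:
  fixes n :: nat and d :: "nat \<Rightarrow> nat" and \<Omega> :: "nat \<Rightarrow> (nat \<Rightarrow> real) set"
  assumes "n \<ge> 2"
    and "\<And>j. j < n \<Longrightarrow> openin (euc (d j)) (\<Omega> j)"
  shows "(\<forall>T L. is_form_op (total_dim n d) (prod_set n d \<Omega>)
                  (tensor_H n d \<Omega> (\<lambda>j. H01 (d j) (\<Omega> j))) T \<longrightarrow>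
                is_dirichlet_laplacian (total_dim n d) (prod_set n d \<Omega>) L \<longrightarrow>
                T = neg_op L) \<and>
         H01 (total_dim n d) (prod_set n d \<Omega>) = tensor_H n d \<Omega> (\<lambda>j. H01 (d j) (\<Omega> j))"
proof -
  have eq: "H01 (total_dim n d) (prod_set n d \<Omega>) = tensor_H n d \<Omega> (\<lambda>j. H01 (d j) (\<Omega> j))"
    by (rule H01_prod_eq_tensor_H[OF assms(2)])
  then show ?thesis
    unfolding is_dirichlet_laplacian_def by (metis form_op_subset subset_antisym)
qed

end
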